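(* Assume that all $(\mathcal{F}_t)$-martingales are continuous. Let $L$ be the end of an $(\mathcal{F}_t)$-predictable set, such that $\mathbb{P}[L=T]=0$ for every $(\mathcal{F}_t)$-stopping time $T$. Let $Z_t=\mathbb{P}[L>t\mid\mathcal{F}_t]$ (which is a.s. continuous and satisfies $Z_L=1$), and let $$\rho=\sup\Big\{t<L:\ Z_t=\inf_{u\le L}Z_u\Big\}.$$ Then: (i) $I_L=\inf_{u\le L}Z_u$ is uniformly distributed on $[0,1]$; (ii) the supermartingale $Z_t^\rho=\mathbb{P}[\rho>t\mid\mathcal{F}_t]$ associated with $\rho$ is given by $Z_t^\rho=\inf_{u\le t}Z_u$. As a consequence, $\rho$ is an $(\mathcal{F}_t)$ pseudo-stopping time.
   Context: $(\Omega,\mathcal{F},(\mathcal{F}_t)_{t\ge0},\mathbb{P})$ is a filtered probability space satisfying the usual conditions; martingales are taken càdlàg, and $\mathbb{P}[\rho>t\mid\mathcal{F}_t]$, $\mathbb{P}[L>t\mid\mathcal{F}_t]$ denote càdlàg versions. $L$ is the end of a predictable set $\Gamma\subset\mathbb{R}_+\times\Omega$ if $L(\omega)=\sup\{t:(t,\omega)\in\Gamma\}$ (with $\sup\emptyset=0$). Stopping times may take the value $+\infty$, so in particular the hypothesis gives $\mathbb{P}[L=0]=\mathbb{P}[L=\infty]=0$. A random time (nonnegative random variable) $\rho$ is an $(\mathcal{F}_t)$ pseudo-stopping time if $\mathbb{E}[M_\rho]=\mathbb{E}[M_0]$ for every $(\mathcal{F}_t)$-martingale $M$ in $\mathcal{H}^1$,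 where $\mathcal{H}^1$ is the space of càdlàg $(\mathcal{F}_t)$-martingales with $\mathbb{E}[\sup_{t\ge 0}|M_t|]<\infty$ (equivalently, for every bounded martingale). *)

theory Defs
  imports "HOL-Probability.Probability"
begin

text \<open>
  Continuous time is a real number, and every condition is restricted to \<open>t \<ge> 0\<close>; the values
  of filtrations and processes at negative times are irrelevant. Random times have values in
  \<open>ennreal\<close>, that is, in \<open>[0, \<infinity>]\<close>. The locale \<open>filtration\<close> and the predicate \<open>stopping_time\<close> of
  HOL-Probability are not used, because they have one type for the index set and for the values of
  stopping times, which excludes the value \<open>\<infinity>\<close> here.
\<close>

locale usual_filtered_prob_space = prob_space M + complete_measure M for M :: "'a measure" +
  fixes F :: "real \<Rightarrow> 'a measure"
  assumes subalgebra_F: "0 \<le> t \<Longrightarrow> subalgebra M (F t)"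
    and sets_F_mono: "0 \<le> s \<Longrightarrow> s \<le> t \<Longrightarrow> sets (F s) \<subseteq> sets (F t)"
    and null_sets_F: "null_sets M \<subseteq> sets (F 0)"
    and right_continuous_F: "0 \<le> t \<Longrightarrow> (\<Inter>s\<in>{t<..}. sets (F s)) = sets (F t)"

definition ext_stopping_time :: "(real \<Rightarrow> 'a measure) \<Rightarrow> ('a \<Rightarrow> ennreal) \<Rightarrow> bool" where
  "ext_stopping_time F T \<longleftrightarrow> (\<forall>t\<ge>0. Measurable.pred (F t) (\<lambda>\<omega>. T \<omega> \<le> ennreal t))"

definition adapted :: "(real \<Rightarrow> 'a measure) \<Rightarrow> (real \<Rightarrow> 'a \<Rightarrow> real) \<Rightarrow> bool" where
  "adapted F X \<longleftrightarrow> (\<forall>t\<ge>0. X t \<in> borel_measurable (F t))"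

definition cadlag :: "(real \<Rightarrow> real) \<Rightarrow> bool" where
  "cadlag f \<longleftrightarrow> (\<forall>t\<ge>0. continuous (at_right t) f) \<and> (\<forall>t>0. \<exists>l. (f \<longlongrightarrow> l) (at_left t))"

definition cadlag_martingale ::
    "'a measure \<Rightarrow> (real \<Rightarrow> 'a measure) \<Rightarrow> (real \<Rightarrow> 'a \<Rightarrow> real) \<Rightarrow> bool" where
  "cadlag_martingale M F X \<longleftrightarrow>
     adapted F X \<and> (\<forall>\<omega>\<in>space M. cadlag (\<lambda>t. X t \<omega>)) \<and> (\<forall>t\<ge>0. integrable M (X t)) \<and>
     (\<forall>s\<ge>0. \<forall>t\<ge>s. AE \<omega> in M. real_cond_exp M (F s) (X t) \<omega> = X s \<omega>)"

definition H1_martingale ::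
    "'a measure \<Rightarrow> (real \<Rightarrow> 'a measure) \<Rightarrow> (real \<Rightarrow> 'a \<Rightarrow> real) \<Rightarrow> bool" where
  "H1_martingale M F X \<longleftrightarrow>
     cadlag_martingale M F X \<and> (\<integral>\<^sup>+\<omega>. (SUP t\<in>{0..}. ennreal \<bar>X t \<omega>\<bar>) \<partial>M) < \<infinity>"

text \<open>The value \<open>X\<^sub>\<infinity>\<close> is the limit at infinity, which exists almost surely for a martingale
  in \<open>H\<^sup>1\<close>.\<close>

definition process_at :: "(real \<Rightarrow> 'a \<Rightarrow> real) \<Rightarrow> ('a \<Rightarrow> ennreal) \<Rightarrow> 'a \<Rightarrow> real" where
  "process_at X \<rho> \<omega> =
     (if \<rho> \<omega> = \<infinity> then Lim at_top (\<lambda>t. X t \<omega>) else X (enn2real (\<rho> \<omega>)) \<omega>)"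

definition pseudo_stopping_time ::
    "'a measure \<Rightarrow> (real \<Rightarrow> 'a measure) \<Rightarrow> ('a \<Rightarrow> ennreal) \<Rightarrow> bool" where
  "pseudo_stopping_time M F \<rho> \<longleftrightarrow>
     \<rho> \<in> borel_measurable M \<and>
     (\<forall>X. H1_martingale M F X \<longrightarrow> (\<integral>\<omega>. process_at X \<rho> \<omega> \<partial>M) = (\<integral>\<omega>. X 0 \<omega> \<partial>M))"

definition predictable_sigma :: "'a measure \<Rightarrow> (real \<Rightarrow> 'a measure) \<Rightarrow> (real \<times> 'a) measure" where
  "predictable_sigma M F = sigma ({0..} \<times> space M)
     ({{0} \<times> A | A. A \<in> sets (F 0)} \<union>
      {{s<..t} \<times> A | s t A. 0 \<le> s \<and> s \<le> t \<and> A \<in> sets (F s)})"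

text \<open>The supremum is taken in \<open>ennreal\<close>, where the supremum of the empty set is \<open>0\<close>.\<close>

definition end_of :: "(real \<times> 'a) set \<Rightarrow> 'a \<Rightarrow> ennreal" where
  "end_of \<Gamma> \<omega> = (SUP t\<in>{t. 0 \<le> t \<and> (t, \<omega>) \<in> \<Gamma>}. ennreal t)"

definition end_of_predictable_set ::
    "'a measure \<Rightarrow> (real \<Rightarrow> 'a measure) \<Rightarrow> ('a \<Rightarrow> ennreal) \<Rightarrow> bool" where
  "end_of_predictable_set M F L \<longleftrightarrow>
     (\<exists>\<Gamma>\<in>sets (predictable_sigma M F). \<forall>\<omega>\<in>space M. L \<omega> = end_of \<Gamma> \<omega>)"

text \<open>\<open>Z\<close> is a cadlag version of \<open>t \<mapsto> P[\<rho> > t | F\<^sub>t]\<close>.\<close>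

definition azema_supermartingale ::
    "'a measure \<Rightarrow> (real \<Rightarrow> 'a measure) \<Rightarrow> ('a \<Rightarrow> ennreal) \<Rightarrow> (real \<Rightarrow> 'a \<Rightarrow> real) \<Rightarrow> bool" where
  "azema_supermartingale M F \<rho> Z \<longleftrightarrow>
     adapted F Z \<and> (\<forall>\<omega>\<in>space M. cadlag (\<lambda>t. Z t \<omega>)) \<and>
     (\<forall>t\<ge>0. AE \<omega> in M.
        Z t \<omega> = real_cond_exp M (F t) (indicator {\<omega>\<in>space M. ennreal t < \<rho> \<omega>}) \<omega>)"

end

theory Submission
  imports Defs
begin

text \<open>
  Since all martingales are continuous, every stopping time is announced, and as \<open>L\<close> avoids
  stopping times this makes \<open>Z\<close> continuous. The debut \<open>D\<close> of the predictable set after a rational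
  time satisfies \<open>D < L\<close> where it is finite, so \<open>Z\<^sub>D = P[D < L | F\<^sub>D] = 1\<close>, and \<open>Z\<^sub>L = 1\<close> follows by
  left continuity. If \<open>S\<close> is the first time after \<open>t\<close> at which \<open>Z\<close> is below an \<open>F\<^sub>t\<close>-measurable
  level \<open>Y\<close>, where \<open>0 \<le> Y \<le> inf\<^bsub>u \<le> t\<^esub> Z\<^sub>u\<close>, then \<open>P[S < L | F\<^sub>t] = E[Z\<^sub>S | F\<^sub>t] = Y\<close>. The choice
  \<open>t = 0\<close>, \<open>Y = a\<close> gives \<open>P[I \<le> a] = a\<close>. The choice \<open>Y = inf\<^bsub>u \<le> t\<^esub> Z\<^sub>u\<close> gives \<open>P[\<rho> > t | F\<^sub>t] = Y\<close>,
  because \<open>Z\<^sub>L = 1\<close> excludes \<open>L\<close> as the place of the minimum, so that \<open>\<rho> > t\<close> exactly if \<open>S < L\<close>.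
\<close>

section \<open>Measurable projection\<close>

text \<open>The continuity hypothesis concerns martingales, while \<open>Z\<close> is only a
  supermartingale. It reaches \<open>Z\<close> through the martingale
  \<open>E[exp (- T) | F\<^sub>t]\<close>, of which a cadlag version has to be constructed before
  the hypothesis can be applied to it. Jumps of \<open>Z\<close> are then excluded by integrating
  \<open>Z\<close> and its left limit at the debut of a jump set. The times involved are suprema of
  debuts or debuts of progressive sets; that debuts are stopping times rests on the projection
  theorem, hence on the completeness of the filtration and its right continuity. Sigma-algebras at
  stopping times are avoided: each identity at a stopping time is an equality of integrals over
  \<open>T \<le> K\<close> with a finite horizon \<open>K\<close>, and conditioning on
  \<open>F t\<close> is expressed by an event \<open>A\<close> of \<open>F t\<close> off which the
  stopping time is infinite. The last claim uses that \<open>\<rho>\<close> has a decreasing Azema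
  supermartingale: a summation by parts leaves an error term that pairs increments of a continuous
  martingale with those of a monotone process, and such an error vanishes as the mesh
  shrinks.\<close>

lemma prefix_choice:
  fixes P :: "nat \<Rightarrow> (nat \<Rightarrow> 'b) \<Rightarrow> bool"
  assumes prefix: "\<And>k g h. (\<And>i. i < k \<Longrightarrow> g i = h i) \<Longrightarrow> P k g \<Longrightarrow> P k h"
    and init: "P 0 g0"
    and step: "\<And>k g. P k g \<Longrightarrow> \<exists>m. P (Suc k) (g(k := m))"
  shows "\<exists>f. \<forall>k. P k f"
proof -
  \<comment> \<open>Stage \<open>Suc k\<close> may change \<open>G\<close> only at coordinates from
    \<open>k\<close> on. Coordinate \<open>i\<close> is therefore final from stage
    \<open>Suc i\<close> on, and the sequence sought is the diagonal
    \<open>\<lambda>i. G (Suc i) i\<close>, which agrees with \<open>G k\<close> below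
    \<open>k\<close>.\<close>
  have "\<exists>G. \<forall>k. P k (G k) \<and> (\<forall>i<k. G (Suc k) i = G k i)"
  proof (rule dependent_nat_choice)
    show "\<exists>g. P 0 g" using init by blast
    fix g k assume "P k g"
    then obtain m where "P (Suc k) (g(k := m))" using step by blast
    then show "\<exists>h. P (Suc k) h \<and> (\<forall>i<k. h i = g i)"
      by (intro exI[of _ "g(k := m)"]) auto
  qed
  then obtain G where "\<forall>k. P k (G k) \<and> (\<forall>i<k. G (Suc k) i = G k i)" ..
  then have G: "\<And>k. P k (G k)" "\<And>k i. i < k \<Longrightarrow> G (Suc k) i = G k i" by auto
  have stable: "G k i = G (Suc i) i" if "i < k" for i k
    using Suc_leI[OF that] by (induction rule: dec_induct) (simp_all add: G(2) Suc_le_lessD)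
  have "P k (\<lambda>i. G (Suc i) i)" for k
    by (rule prefix[OF _ G(1)]) (rule stable)
  then show ?thesis by (intro exI[of _ "\<lambda>i. G (Suc i) i"]) simp
qed

text \<open>A Suslin scheme is indexed by infinite sequences rather than by finite ones: \<open>H n \<sigma>\<close>
  depends on \<open>\<sigma>\<close> only through the first \<open>n\<close> terms.\<close>

definition suslin_scheme :: "'x set set \<Rightarrow> (nat \<Rightarrow> (nat \<Rightarrow> nat) \<Rightarrow> 'x set) \<Rightarrow> bool" where
  "suslin_scheme P H \<longleftrightarrow>
     (\<forall>n \<sigma>. H n \<sigma> \<in> P) \<and> (\<forall>n \<sigma> \<tau>. (\<forall>i<n. \<sigma> i = \<tau> i) \<longrightarrow> H n \<sigma> = H n \<tau>)"

definition suslin :: "'x set set \<Rightarrow> 'x set set" where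
  "suslin P = {A. \<exists>H. suslin_scheme P H \<and> A = (\<Union>\<sigma>. \<Inter>n. H n \<sigma>)}"

section \<open>Closure of the Suslin operation under countable unions and intersections\<close>

lemma suslin_schemeD:
  assumes "suslin_scheme P H"
  shows "H n \<sigma> \<in> P" "(\<And>i. i < n \<Longrightarrow> \<sigma> i = \<tau> i) \<Longrightarrow> H n \<sigma> = H n \<tau>"
  using assms unfolding suslin_scheme_def by simp_all

lemma suslin_scheme_INT_subset:
  assumes "suslin_scheme (sets N) G"
  shows "(\<Inter>n. G n \<sigma>) \<subseteq> space N"
proof -
  have "(\<Inter>n. G n \<sigma>) \<subseteq> G 0 \<sigma>" by auto
  also have "\<dots> \<subseteq> space N" by (rule sets.sets_into_space[OF suslin_schemeD(1)[OF assms]])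
  finally show ?thesis .
qed

lemma suslin_base: "A \<in> P \<Longrightarrow> A \<in> suslin P"
  unfolding suslin_def suslin_scheme_def by (auto intro!: exI[of _ "\<lambda>_ _. A"])

text \<open>The first term of a sequence names the member of the union, and the remaining terms run
  through the scheme of that member. Level 0 may not read any term, so \<open>\<Omega>\<close>
  stands there and every scheme is delayed by one level.\<close>

lemma suslin_UN:
  assumes A: "\<And>j::nat. A j \<in> suslin P" and \<Omega>: "\<Omega> \<in> P" "\<And>j. A j \<subseteq> \<Omega>"
  shows "(\<Union>j. A j) \<in> suslin P"
proof -
  have "\<forall>j. \<exists>H. suslin_scheme P H \<and> A j = (\<Union>\<sigma>. \<Inter>n. H n \<sigma>)" using A unfolding suslin_def by simp
  then obtain H where "\<forall>j. suslin_scheme P (H j) \<and> A j = (\<Union>\<sigma>. \<Inter>n. H j n \<sigma>)"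
    by (rule choice[THEN exE])
  then have H: "\<And>j. suslin_scheme P (H j)" "\<And>j. A j = (\<Union>\<sigma>. \<Inter>n. H j n \<sigma>)" by simp_all
  define H' where "H' n \<sigma> = (case n of 0 \<Rightarrow> \<Omega> | Suc m \<Rightarrow> H (\<sigma> 0) m (\<lambda>i. \<sigma> (Suc i)))" for n \<sigma>
  have "suslin_scheme P H'"
    unfolding suslin_scheme_def
  proof (intro conjI allI impI)
    show "H' n \<sigma> \<in> P" for n \<sigma>
      using suslin_schemeD(1)[OF H(1)] \<Omega> by (auto simp: H'_def split: nat.split)
    show "H' n \<sigma> = H' n \<tau>" if "\<forall>i<n. \<sigma> i = \<tau> i" for n \<sigma> \<tau>
    proof (cases n)
      case (Suc m)
      then have "\<sigma> 0 = \<tau> 0" "\<And>i. i < m \<Longrightarrow> \<sigma> (Suc i) = \<tau> (Suc i)" using that by auto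
      moreover from this(2) have "H (\<tau> 0) m (\<lambda>i. \<sigma> (Suc i)) = H (\<tau> 0) m (\<lambda>i. \<tau> (Suc i))"
        by (rule suslin_schemeD(2)[OF H(1)])
      ultimately show ?thesis by (simp add: H'_def Suc)
    qed (simp add: H'_def)
  qed
  moreover have "(\<Union>j. A j) = (\<Union>\<sigma>. \<Inter>n. H' n \<sigma>)"
  proof (intro equalityI subsetI)
    fix x assume "x \<in> (\<Union>j. A j)"
    then obtain j where j: "x \<in> A j" ..
    then obtain \<sigma> where "\<forall>n. x \<in> H j n \<sigma>" unfolding H(2) by auto
    with j \<Omega>(2) have x: "x \<in> \<Omega>" "\<And>n. x \<in> H j n \<sigma>" by auto
    have "x \<in> H' n (\<lambda>i. case i of 0 \<Rightarrow> j | Suc i \<Rightarrow> \<sigma> i)" for n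
      using x by (cases n) (auto simp: H'_def)
    then show "x \<in> (\<Union>\<sigma>. \<Inter>n. H' n \<sigma>)" by (intro UN_I[OF UNIV_I] INT_I)
  next
    fix x assume "x \<in> (\<Union>\<sigma>. \<Inter>n. H' n \<sigma>)"
    then obtain \<sigma> where \<sigma>: "\<And>n. x \<in> H' n \<sigma>" by auto
    have "x \<in> H (\<sigma> 0) n (\<lambda>i. \<sigma> (Suc i))" for n using \<sigma>[of "Suc n"] by (simp add: H'_def)
    then have "x \<in> A (\<sigma> 0)" unfolding H(2) by (intro UN_I[OF UNIV_I] INT_I)
    then show "x \<in> (\<Union>j. A j)" by auto
  qed
  ultimately show ?thesis unfolding suslin_def by (intro CollectI exI[of _ H'] conjI)
qed

text \<open>Level \<open>m\<close> of the scheme with number \<open>j\<close> will be placed at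
  level \<open>prod_encode (j, m)\<close> of a combined scheme. It reads the coordinates
  \<open>prod_encode (j, i)\<close> with \<open>i < m\<close>, which must lie below that
  level.\<close>

lemma prod_encode_strict_mono: "i < m \<Longrightarrow> prod_encode (j, i) < prod_encode (j, m)"
proof (induction m)
  case (Suc m)
  have "prod_encode (j, m) < prod_encode (j, Suc m)" by (simp add: prod_encode_def)
  with Suc show ?case by (cases "i = m") auto
qed simp

text \<open>The pairing function splits a single sequence into countably many independent ones, one
  for each \<open>j\<close>, so that a choice of a sequence for every \<open>j\<close> is again one
  sequence.\<close>

lemma suslin_INT:
  assumes A: "\<And>j::nat. A j \<in> suslin P"
  shows "(\<Inter>j. A j) \<in> suslin P"
proof -
  have "\<forall>j. \<exists>H. suslin_scheme P H \<and> A j = (\<Union>\<sigma>. \<Inter>n. H n \<sigma>)" using A unfolding suslin_def by simp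
  then obtain H where "\<forall>j. suslin_scheme P (H j) \<and> A j = (\<Union>\<sigma>. \<Inter>n. H j n \<sigma>)"
    by (rule choice[THEN exE])
  then have H: "\<And>j. suslin_scheme P (H j)" "\<And>j. A j = (\<Union>\<sigma>. \<Inter>n. H j n \<sigma>)" by simp_all
  define H' where "H' n \<sigma> = (case prod_decode n of (j, m) \<Rightarrow> H j m (\<lambda>i. \<sigma> (prod_encode (j, i))))" for n \<sigma>
  have "suslin_scheme P H'"
    unfolding suslin_scheme_def
  proof (intro conjI allI impI)
    show "H' n \<sigma> \<in> P" for n \<sigma>
      using suslin_schemeD(1)[OF H(1)] by (auto simp: H'_def split: prod.split)
    show "H' n \<sigma> = H' n \<tau>" if \<sigma>: "\<forall>i<n. \<sigma> i = \<tau> i" for n \<sigma> \<tau>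
    proof -
      obtain j m where n: "n = prod_encode (j, m)" by (metis prod_decode_inverse surj_pair)
      have "H j m (\<lambda>i. \<sigma> (prod_encode (j, i))) = H j m (\<lambda>i. \<tau> (prod_encode (j, i)))"
        using \<sigma> by (intro suslin_schemeD(2)[OF H(1)]) (auto simp: n prod_encode_strict_mono)
      then show ?thesis by (simp add: H'_def n)
    qed
  qed
  moreover have "(\<Inter>j. A j) = (\<Union>\<sigma>. \<Inter>n. H' n \<sigma>)"
  proof (intro equalityI subsetI)
    fix x assume "x \<in> (\<Inter>j. A j)"
    then have "\<forall>j. \<exists>\<sigma>. \<forall>n. x \<in> H j n \<sigma>" unfolding H(2) by auto
    then obtain s where "\<forall>j n. x \<in> H j n (s j)" by (rule choice[THEN exE])
    then have s: "\<And>j n. x \<in> H j n (s j)" by simp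
    have "x \<in> H' n (\<lambda>i. case prod_decode i of (j, m) \<Rightarrow> s j m)" for n
      using s by (auto simp: H'_def split: prod.split)
    then show "x \<in> (\<Union>\<sigma>. \<Inter>n. H' n \<sigma>)" by (intro UN_I[OF UNIV_I] INT_I)
  next
    fix x assume "x \<in> (\<Union>\<sigma>. \<Inter>n. H' n \<sigma>)"
    then obtain \<sigma> where \<sigma>: "\<And>n. x \<in> H' n \<sigma>" by auto
    have "x \<in> H j n (\<lambda>i. \<sigma> (prod_encode (j, i)))" for j n
      using \<sigma>[of "prod_encode (j, n)"] by (simp add: H'_def)
    then show "x \<in> (\<Inter>j. A j)" unfolding H(2) by (intro INT_I UN_I[OF UNIV_I])
  qed
  ultimately show ?thesis unfolding suslin_def by (intro CollectI exI[of _ H'] conjI)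
qed

text \<open>Complements of Suslin sets need not be Suslin, so the induction carries a set together
  with its complement; the complement of a countable union is then a countable intersection.\<close>

lemma sigma_sets_suslin:
  assumes "A \<in> sigma_sets \<Omega> G"
    and P: "{} \<in> P" "\<Omega> \<in> P"
    and G: "\<And>A. A \<in> G \<Longrightarrow> A \<subseteq> \<Omega> \<and> A \<in> suslin P \<and> \<Omega> - A \<in> suslin P"
  shows "A \<in> suslin P" "\<Omega> - A \<in> suslin P"
proof -
  have "A \<subseteq> \<Omega> \<and> A \<in> suslin P \<and> \<Omega> - A \<in> suslin P"
    using assms(1)
  proof induction
    case Empty then show ?case using P by (auto intro: suslin_base)
  next
    case (Compl A) then show ?case by (auto simp: double_diff)
  next
    case (Union A)
    have "\<Omega> - (\<Union>i. A i) = (\<Inter>i. \<Omega> - A i)" by blast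
    then show ?case using Union suslin_UN[of A P \<Omega>] suslin_INT[of "\<lambda>i. \<Omega> - A i" P] P by auto
  qed (use G in blast)
  then show "A \<in> suslin P" "\<Omega> - A \<in> suslin P" by auto
qed

text \<open>The Suslin operation is approximated from inside: truncating the sequences by a suitable
  bound \<open>f\<close> loses little outer measure, and what remains contains, by Koenig's lemma, the
  measurable set \<open>\<Inter>k. B k\<close>.\<close>

lemma suslin_inner_approx:
  fixes N :: "'w measure"
  assumes N: "finite_measure N" and G: "suslin_scheme (sets N) G"
    and dec: "\<And>n \<sigma>. G (Suc n) \<sigma> \<subseteq> G n \<sigma>"
    and c: "c < outer_measure_of N (\<Union>\<sigma>. \<Inter>n. G n \<sigma>)"
  shows "\<exists>B\<in>sets N. B \<subseteq> (\<Union>\<sigma>. \<Inter>n. G n \<sigma>) \<and> c \<le> emeasure N B"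
proof -
  interpret finite_measure N by fact
  define A where "A k f = (\<Union>\<sigma>\<in>{\<sigma>. \<forall>i<k. \<sigma> i \<le> f i}. \<Inter>n. G n \<sigma>)" for k :: nat and f :: "nat \<Rightarrow> nat"
  have A_prefix: "A k g = A k h" if "\<And>i. i < k \<Longrightarrow> g i = h i" for k g h
    using that unfolding A_def by auto
  have GM[measurable]: "G n \<sigma> \<in> sets N" for n \<sigma> using suslin_schemeD(1)[OF G] .
  have A_space: "A k f \<subseteq> space N" for k f
    unfolding A_def using suslin_scheme_INT_subset[OF G] by (intro UN_least)
  have A_mono: "A k g \<subseteq> A k h" if "\<And>i. i < k \<Longrightarrow> g i \<le> h i" for k g h
    unfolding A_def by (intro UN_mono) (use that in \<open>auto intro: order_trans\<close>)
  \<comment> \<open>With the bound on term \<open>k\<close> raised to infinity, the sets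
    \<open>A (Suc k) (g(k := m))\<close> increase to \<open>A k g\<close>. Outer measure is
    continuous along increasing sequences of arbitrary sets, so some finite bound \<open>m\<close>
    keeps it above \<open>c\<close>.\<close>
  have "\<exists>f. \<forall>k. c < outer_measure_of N (A k f)"
  proof (rule prefix_choice)
    show "c < outer_measure_of N (A k g) \<Longrightarrow> c < outer_measure_of N (A k h)"
      if "\<And>i. i < k \<Longrightarrow> g i = h i" for k g h using A_prefix[OF that] by simp
    show "c < outer_measure_of N (A 0 (\<lambda>_. 0))" using c by (simp add: A_def)
    fix k g assume "c < outer_measure_of N (A k g)"
    moreover have "A k g = (\<Union>m. A (Suc k) (g(k := m)))"
      unfolding A_def by (auto simp: less_Suc_eq)
    moreover have "(SUP m. outer_measure_of N (A (Suc k) (g(k := m)))) =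
        outer_measure_of N (\<Union>m. A (Suc k) (g(k := m)))"
      by (intro SUP_outer_measure_of_incseq A_space incseq_SucI A_mono) auto
    ultimately have "c < (SUP m. outer_measure_of N (A (Suc k) (g(k := m))))" by argo
    then show "\<exists>m. c < outer_measure_of N (A (Suc k) (g(k := m)))" by (simp add: less_SUP_iff)
  qed
  then obtain f where "\<forall>k. c < outer_measure_of N (A k f)" ..
  then have f: "\<And>k. c < outer_measure_of N (A k f)" ..
  define B where "B k = (\<Union>\<sigma>\<in>{\<sigma>. \<forall>i<k. \<sigma> i \<le> f i}. G k \<sigma>)" for k
  \<comment> \<open>Since \<open>G k\<close> reads only \<open>k\<close> terms, finite lists can
    replace sequences as the index. There are countably many lists, which makes \<open>B k\<close>
    measurable.\<close>
  have "B k = (\<Union>l\<in>{l. \<forall>i<k. l ! i \<le> f i}. G k ((!) l))" for k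
  proof (intro equalityI subsetI)
    fix x assume "x \<in> B k"
    then obtain \<sigma> where \<sigma>: "\<forall>i<k. \<sigma> i \<le> f i" "x \<in> G k \<sigma>" unfolding B_def by blast
    have "G k ((!) (map \<sigma> [0..<k])) = G k \<sigma>" by (rule suslin_schemeD(2)[OF G]) simp
    then show "x \<in> (\<Union>l\<in>{l. \<forall>i<k. l ! i \<le> f i}. G k ((!) l))"
      using \<sigma> by (intro UN_I[of "map \<sigma> [0..<k]"]) auto
  qed (auto simp: B_def)
  then have B_sets[measurable]: "B k \<in> sets N" for k by (auto intro!: sets.countable_UN'')
  have "decseq B"
  proof (rule decseq_SucI)
    show "B (Suc k) \<subseteq> B k" for k unfolding B_def by (intro UN_mono dec) auto
  qed
  moreover have cB: "c \<le> emeasure N (B k)" for k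
  proof -
    have "A k f \<subseteq> B k" unfolding A_def B_def by (intro UN_mono INT_lower) auto
    then show ?thesis
      using f[of k] outer_measure_of_mono[of "A k f" "B k" N] by simp
  qed
  ultimately have "(INF k. emeasure N (B k)) = emeasure N (\<Inter>k. B k)"
    using B_sets by (intro INF_emeasure_decseq) auto
  moreover have "c \<le> (INF k. emeasure N (B k))" using cB by (rule INF_greatest)
  ultimately have "c \<le> emeasure N (\<Inter>k. B k)" by simp
  moreover have "(\<Inter>k. B k) \<subseteq> (\<Union>\<sigma>. \<Inter>n. G n \<sigma>)"
  proof
    fix x assume x: "x \<in> (\<Inter>k. B k)"
    \<comment> \<open>In terms of Koenig's lemma, \<open>Q k \<tau>\<close> says that the first
      \<open>k\<close> terms of \<open>\<tau>\<close> form a node of the finitely branching tree of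
      bounded prefixes below which there are survivors at arbitrarily high levels.\<close>
    define Q where "Q k \<tau> \<longleftrightarrow> (\<forall>n. \<exists>\<sigma>. (\<forall>i<k. \<sigma> i = \<tau> i) \<and> (\<forall>i<n. \<sigma> i \<le> f i) \<and> x \<in> G n \<sigma>)" for k \<tau>
    have mono: "G n \<sigma> \<subseteq> G m \<sigma>" if "m \<le> n" for m n \<sigma>
      using lift_Suc_antimono_le[of "\<lambda>n. G n \<sigma>", OF dec that] .
    have "\<exists>\<tau>. \<forall>k. Q k \<tau>"
    proof (rule prefix_choice)
      show "Q k g \<Longrightarrow> Q k h" if "\<And>i. i < k \<Longrightarrow> g i = h i" for k g h
        using that by (simp add: Q_def)
      show "Q 0 (\<lambda>_. 0)" using x by (simp add: Q_def B_def)
      fix k \<tau> assume Q: "Q k \<tau>"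
      show "\<exists>m. Q (Suc k) (\<tau>(k := m))"
      proof (rule ccontr)
        assume "\<not> ?thesis"
        then have "\<forall>m. \<exists>n. \<forall>\<sigma>. \<not> ((\<forall>i<Suc k. \<sigma> i = (\<tau>(k := m)) i) \<and> (\<forall>i<n. \<sigma> i \<le> f i) \<and> x \<in> G n \<sigma>)"
          unfolding Q_def by simp
        then obtain nn where "\<forall>m \<sigma>. \<not> ((\<forall>i<Suc k. \<sigma> i = (\<tau>(k := m)) i) \<and> (\<forall>i<nn m. \<sigma> i \<le> f i) \<and> x \<in> G (nn m) \<sigma>)"
          by (rule choice[THEN exE])
        then have nn: "\<And>m \<sigma>. (\<forall>i<Suc k. \<sigma> i = (\<tau>(k := m)) i) \<Longrightarrow> (\<forall>i<nn m. \<sigma> i \<le> f i) \<Longrightarrow> x \<notin> G (nn m) \<sigma>"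
          by metis
        \<comment> \<open>If each of the finitely many successors \<open>m \<le> f k\<close> died at
          some level \<open>nn m\<close>, a level above all of these would have no survivor. The
          term \<open>Suc k\<close> ensures that the bound \<open>\<sigma> k \<le> f k\<close> is in
          force at that level.\<close>
        define n where "n = max (Suc k) (Max (nn ` {..f k}))"
        obtain \<sigma> where "(\<forall>i<k. \<sigma> i = \<tau> i) \<and> (\<forall>i<n. \<sigma> i \<le> f i) \<and> x \<in> G n \<sigma>"
          using Q[unfolded Q_def, rule_format, of n] ..
        then have \<sigma>: "\<forall>i<k. \<sigma> i = \<tau> i" "\<forall>i<n. \<sigma> i \<le> f i" "x \<in> G n \<sigma>" by simp_all
        have "\<sigma> k \<le> f k" using \<sigma>(2) by (simp add: n_def)
        then have le: "nn (\<sigma> k) \<le> n" unfolding n_def by (intro max.coboundedI2 Max_ge) auto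
        then have "x \<notin> G (nn (\<sigma> k)) \<sigma>" using \<sigma> by (intro nn) (simp_all add: less_Suc_eq)
        then show False using subsetD[OF mono[OF le] \<sigma>(3)] by simp
      qed
    qed
    then obtain \<tau> where "\<forall>k. Q k \<tau>" ..
    then have \<tau>: "\<And>k. Q k \<tau>" ..
    have "x \<in> G k \<tau>" for k
    proof -
      obtain \<sigma> where \<sigma>: "(\<forall>i<k. \<sigma> i = \<tau> i) \<and> (\<forall>i<k. \<sigma> i \<le> f i) \<and> x \<in> G k \<sigma>"
        using \<tau>[of k, unfolded Q_def, rule_format, of k] ..
      then have "G k \<sigma> = G k \<tau>" by (intro suslin_schemeD(2)[OF G]) simp
      then show ?thesis using \<sigma> by simp
    qed
    then show "x \<in> (\<Union>\<sigma>. \<Inter>n. G n \<sigma>)" by (intro UN_I[OF UNIV_I] INT_I)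
  qed
  moreover have "(\<Inter>k. B k) \<in> sets N" using B_sets by (intro sets.countable_INT) auto
  ultimately show ?thesis by (intro bexI[of _ "\<Inter>k. B k"] conjI)
qed

text \<open>Inner approximation below the outer measure yields measurable subsets of the Suslin set
  whose measures approach that of a measurable hull \<open>U\<close>. The set is thus caught between
  two measurable sets of equal finite measure, and completeness applies.\<close>

lemma suslin_scheme_measurable:
  fixes N :: "'w measure"
  assumes N: "finite_measure N" "complete_measure N" and G: "suslin_scheme (sets N) G"
    and dec: "\<And>n \<sigma>. G (Suc n) \<sigma> \<subseteq> G n \<sigma>"
  shows "(\<Union>\<sigma>. \<Inter>n. G n \<sigma>) \<in> sets N"
proof -
  interpret finite_measure N by fact
  interpret complete_measure N by fact
  define E where "E = (\<Union>\<sigma>. \<Inter>n. G n \<sigma>)"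
  have "E \<subseteq> space N"
    unfolding E_def using suslin_scheme_INT_subset[OF G] by (intro UN_least)
  then obtain U where U: "U \<in> sets N" "E \<subseteq> U" "outer_measure_of N E = emeasure N U"
    using outer_measure_of_attain[of E N] by auto
  have "\<exists>B\<in>sets N. B \<subseteq> E \<and> emeasure N U \<le> emeasure N B + ennreal (1 / Suc n)" for n
  proof (cases "emeasure N U = 0")
    case False
    then have "emeasure N U - ennreal (1 / Suc n) < emeasure N U"
      by (intro ennreal_between) (auto simp: zero_less_iff_neq_zero less_top[symmetric])
    then obtain B where "B \<in> sets N" "B \<subseteq> E" "emeasure N U - ennreal (1 / Suc n) \<le> emeasure N B"
      using suslin_inner_approx[OF N(1) G dec, of "emeasure N U - ennreal (1 / Suc n)"] U(3)
      unfolding E_def by auto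
    then show ?thesis by (auto simp: ennreal_minus_le_iff add.commute intro!: bexI[of _ B])
  qed auto
  then obtain B where B: "\<And>n. B n \<in> sets N" "\<And>n. B n \<subseteq> E"
      "\<And>n. emeasure N U \<le> emeasure N (B n) + ennreal (1 / Suc n)" by metis
  have Bsets: "(\<Union>n. B n) \<in> sets N" using B(1) by blast
  have "emeasure N U \<le> emeasure N (\<Union>n. B n)"
  proof (rule ennreal_le_epsilon)
    fix e :: real assume "0 < e"
    then obtain n where n: "1 / Suc n < e" using nat_approx_posE by metis
    have "emeasure N U \<le> emeasure N (B n) + ennreal (1 / Suc n)" by (rule B)
    also have "\<dots> \<le> emeasure N (\<Union>n. B n) + ennreal e"
      using n Bsets by (intro add_mono emeasure_mono ennreal_leI) auto
    finally show "emeasure N U \<le> emeasure N (\<Union>n. B n) + ennreal e" .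
  qed
  moreover have "emeasure N (\<Union>n. B n) \<le> emeasure N U"
    using B(2) U by (intro emeasure_mono) auto
  ultimately have "emeasure N (\<Union>n. B n) = emeasure N U" by simp
  then have "E \<in> sets N"
    using B(2) U by (intro complete_sets_sandwich[OF Bsets U(1)]) (auto simp: less_top[symmetric])
  then show ?thesis unfolding E_def .
qed

text \<open>Closed time sides allow compactness to be used when the time coordinate is projected
  away; the other side may be any measurable set.\<close>

definition closed_rectangles :: "'w measure \<Rightarrow> (real \<times> 'w) set set" where
  "closed_rectangles N = {K \<times> B | K B. closed K \<and> B \<in> sets N}"

text \<open>\<open>C\<close> is used merely as a generating family: the identity into the product is
  measurable for \<open>sigma \<Omega> C\<close> as soon as both coordinates are, so every
  product-measurable set is generated by \<open>C\<close>, and the induction on generated sets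
  finishes the argument.\<close>

lemma sets_pair_borel_suslin:
  fixes A :: "(real \<times> 'w) set"
  assumes A: "A \<in> sets (borel \<Otimes>\<^sub>M N)"
  shows "A \<in> suslin (closed_rectangles N)"
proof -
  let ?P = "closed_rectangles N"
  define \<Omega> where "\<Omega> = (UNIV :: real set) \<times> space N"
  define C where "C = {A. A \<subseteq> \<Omega> \<and> A \<in> suslin ?P \<and> \<Omega> - A \<in> suslin ?P}"
  have rect: "K \<times> B \<in> ?P" if "closed K" "B \<in> sets N" for K B
    using that unfolding closed_rectangles_def by auto
  have P: "{} \<in> ?P" "\<Omega> \<in> ?P"
    using rect[of "{}" "{}"] rect[of UNIV "space N"] by (simp_all add: \<Omega>_def)
  have C_Pow: "C \<subseteq> Pow \<Omega>" unfolding C_def by blast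
  have space: "space (sigma \<Omega> C) = \<Omega>" using C_Pow by simp
  have in_C: "A \<in> sets (sigma \<Omega> C)" if "A \<in> C" for A using that C_Pow by simp
  have "fst \<in> borel_measurable (sigma \<Omega> C)"
  proof (rule borel_measurableI_le, rule in_C)
    fix a :: real
    have "{w \<in> space (sigma \<Omega> C). fst w \<le> a} = {..a} \<times> space N" unfolding space by (auto simp: \<Omega>_def)
    moreover have "\<Omega> - {..a} \<times> space N = (\<Union>n. {a + 1 / Suc n..} \<times> space N)"
    proof -
      have "x > a \<longleftrightarrow> (\<exists>n. a + 1 / Suc n \<le> x)" for x
      proof
        assume "a < x"
        then obtain n where "1 / Suc n < x - a" using nat_approx_posE[of "x - a"] by auto
        then show "\<exists>n. a + 1 / Suc n \<le> x" by (intro exI[of _ n]) linarith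
      next
        assume "\<exists>n. a + 1 / Suc n \<le> x"
        then obtain n where "a + 1 / Suc n \<le> x" ..
        moreover have "1 / real (Suc n) > 0" by simp
        ultimately show "a < x" by linarith
      qed
      then have "{a<..} = (\<Union>n. {a + 1 / Suc n..})" by auto
      then have "{a<..} \<times> space N = (\<Union>n. {a + 1 / Suc n..} \<times> space N)" by auto
      moreover have "\<Omega> - {..a} \<times> space N = {a<..} \<times> space N" by (auto simp: \<Omega>_def)
      ultimately show ?thesis by simp
    qed
    moreover have "(\<Union>n. {a + 1 / Suc n..} \<times> space N) \<in> suslin ?P"
      using P by (intro suslin_UN[of _ _ \<Omega>] suslin_base rect) (auto simp: \<Omega>_def)
    moreover have "{..a} \<times> space N \<in> suslin ?P" by (intro suslin_base rect) auto
    ultimately show "{w \<in> space (sigma \<Omega> C). fst w \<le> a} \<in> C" unfolding C_def by (auto simp: \<Omega>_def)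
  qed
  moreover have "snd \<in> measurable (sigma \<Omega> C) N"
  proof (rule measurableI)
    fix B assume B: "B \<in> sets N"
    have "snd -` B \<inter> space (sigma \<Omega> C) = UNIV \<times> B"
      unfolding space using sets.sets_into_space[OF B] by (auto simp: \<Omega>_def)
    moreover have "\<Omega> - UNIV \<times> B = UNIV \<times> (space N - B)" by (auto simp: \<Omega>_def)
    moreover have "UNIV \<times> B \<in> suslin ?P" "UNIV \<times> (space N - B) \<in> suslin ?P"
      using B by (auto intro!: suslin_base rect)
    ultimately have "snd -` B \<inter> space (sigma \<Omega> C) \<in> C"
      using sets.sets_into_space[OF B] unfolding C_def by (auto simp: \<Omega>_def)
    then show "snd -` B \<inter> space (sigma \<Omega> C) \<in> sets (sigma \<Omega> C)" by (rule in_C)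
  qed (auto simp: space, auto simp: \<Omega>_def)
  ultimately have "(\<lambda>w. (fst w, snd w)) \<in> measurable (sigma \<Omega> C) (borel \<Otimes>\<^sub>M N)"
    by (rule measurable_Pair)
  from measurable_sets[OF this A] have "A \<inter> \<Omega> \<in> sigma_sets \<Omega> C" using C_Pow by simp
  moreover have "A \<subseteq> \<Omega>" using sets.sets_into_space[OF A] by (simp add: space_pair_measure \<Omega>_def)
  ultimately have "A \<in> sigma_sets \<Omega> C" by (simp add: Int_absorb2)
  then show ?thesis by (rule sigma_sets_suslin[OF _ P]) (auto simp: C_def)
qed

text \<open>Projection commutes with unions but not with intersections, and compactness repairs
  this: if for every \<open>n\<close> the first time sides meet within \<open>C\<close>, then all of
  them have a common time. The projection is therefore itself the result of a Suslin scheme, made of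
  the other sides \<open>b\<close>, in which a level is emptied once the time sides have no common
  point.\<close>

lemma measurable_projection_compact:
  fixes N :: "'w measure" and A :: "(real \<times> 'w) set"
  assumes N: "finite_measure N" "complete_measure N"
    and A: "A \<in> sets (borel \<Otimes>\<^sub>M N)" and C: "compact C"
  shows "{\<omega>\<in>space N. \<exists>s\<in>C. (s, \<omega>) \<in> A} \<in> sets N"
proof -
  obtain H where H: "suslin_scheme (closed_rectangles N) H" "A = (\<Union>\<sigma>. \<Inter>n. H n \<sigma>)"
    using sets_pair_borel_suslin[OF A] unfolding suslin_def by blast
  have "\<forall>p\<in>closed_rectangles N. \<exists>K B. p = K \<times> B \<and> closed K \<and> B \<in> sets N"
    unfolding closed_rectangles_def by blast
  then obtain k b where kb: "\<And>p. p \<in> closed_rectangles N \<Longrightarrow> p = k p \<times> b p"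
      "\<And>p. p \<in> closed_rectangles N \<Longrightarrow> closed (k p)" "\<And>p. p \<in> closed_rectangles N \<Longrightarrow> b p \<in> sets N"
    by metis
  note HP = suslin_schemeD(1)[OF H(1)]
  define K where "K n \<sigma> = C \<inter> (\<Inter>m\<le>n. k (H m \<sigma>))" for n \<sigma>
  define G where "G n \<sigma> = (if K n \<sigma> = {} then {} else \<Inter>m\<le>n. b (H m \<sigma>))" for n \<sigma>
  have K_dec: "K (Suc n) \<sigma> \<subseteq> K n \<sigma>" for n \<sigma> by (auto simp: K_def)
  have "suslin_scheme (sets N) G"
    unfolding suslin_scheme_def
  proof (intro conjI allI impI)
    show "G n \<sigma> \<in> sets N" for n \<sigma>
      unfolding G_def using kb(3)[OF HP] by (auto intro!: sets.finite_INT)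
    show "G n \<sigma> = G n \<tau>" if "\<forall>i<n. \<sigma> i = \<tau> i" for n \<sigma> \<tau>
    proof -
      have "H m \<sigma> = H m \<tau>" if "m \<le> n" for m
        by (rule suslin_schemeD(2)[OF H(1)]) (use \<open>\<forall>i<n. \<sigma> i = \<tau> i\<close> that in auto)
      then show ?thesis by (simp add: G_def K_def)
    qed
  qed
  moreover have "G (Suc n) \<sigma> \<subseteq> G n \<sigma>" for n \<sigma>
  proof -
    have "K (Suc n) \<sigma> = {}" if "K n \<sigma> = {}" using K_dec that by blast
    then show ?thesis by (auto simp: G_def atMost_Suc)
  qed
  ultimately have "(\<Union>\<sigma>. \<Inter>n. G n \<sigma>) \<in> sets N" by (rule suslin_scheme_measurable[OF N])
  also have "(\<Union>\<sigma>. \<Inter>n. G n \<sigma>) = {\<omega>\<in>space N. \<exists>s\<in>C. (s, \<omega>) \<in> A}"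
  proof (intro equalityI subsetI)
    fix \<omega> assume "\<omega> \<in> (\<Union>\<sigma>. \<Inter>n. G n \<sigma>)"
    then obtain \<sigma> where \<omega>: "\<And>n. \<omega> \<in> G n \<sigma>" by auto
    have "(\<Inter>n. K n \<sigma>) \<noteq> {}"
    proof (rule compact_nest)
      show "compact (K n \<sigma>)" for n
        unfolding K_def using kb(2)[OF HP] C by (intro compact_Int_closed) auto
      show "K n \<sigma> \<noteq> {}" for n using \<omega>[of n] by (auto simp: G_def)
      show "K n \<sigma> \<subseteq> K m \<sigma>" if "m \<le> n" for m n using that by (auto simp: K_def)
    qed
    then obtain s where s: "\<And>n. s \<in> K n \<sigma>" by auto
    have b: "\<omega> \<in> b (H n \<sigma>)" for n using \<omega>[of n] by (auto simp: G_def split: if_splits)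
    have "(s, \<omega>) \<in> H n \<sigma>" for n
      using s[of n] b[of n] kb(1)[OF HP, of n \<sigma>] by (auto simp: K_def)
    then have "(s, \<omega>) \<in> A" unfolding H(2) by (intro UN_I[OF UNIV_I] INT_I)
    moreover have "\<omega> \<in> space N" using b[of 0] sets.sets_into_space[OF kb(3)[OF HP]] by blast
    ultimately show "\<omega> \<in> {\<omega>\<in>space N. \<exists>s\<in>C. (s, \<omega>) \<in> A}" using s[of 0] by (auto simp: K_def)
  next
    fix \<omega> assume "\<omega> \<in> {\<omega>\<in>space N. \<exists>s\<in>C. (s, \<omega>) \<in> A}"
    then obtain s \<sigma> where s: "s \<in> C" "\<And>n. (s, \<omega>) \<in> H n \<sigma>" unfolding H(2) by auto
    then have "s \<in> k (H n \<sigma>)" "\<omega> \<in> b (H n \<sigma>)" for n using kb(1)[OF HP, of n \<sigma>] by auto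
    then have "\<omega> \<in> G n \<sigma>" for n using s(1) by (auto simp: G_def K_def)
    then show "\<omega> \<in> (\<Union>\<sigma>. \<Inter>n. G n \<sigma>)" by (intro UN_I[OF UNIV_I] INT_I)
  qed
  finally show ?thesis .
qed

theorem measurable_projection:
  fixes N :: "'w measure" and A :: "(real \<times> 'w) set"
  assumes N: "finite_measure N" "complete_measure N" and A: "A \<in> sets (borel \<Otimes>\<^sub>M N)"
  shows "{\<omega>\<in>space N. \<exists>s. (s, \<omega>) \<in> A} \<in> sets N"
proof -
  have "\<exists>n::nat. s \<in> {- real n..real n}" for s :: real
    using real_arch_simple[of "\<bar>s\<bar>"] by (auto simp: abs_le_iff minus_le_iff)
  then have "{\<omega>\<in>space N. \<exists>s. (s, \<omega>) \<in> A} =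
      (\<Union>n::nat. {\<omega>\<in>space N. \<exists>s\<in>{- real n..real n}. (s, \<omega>) \<in> A})" by blast
  then show ?thesis using measurable_projection_compact[OF N A] by auto
qed

section \<open>Debuts and optional sampling\<close>

lemma (in complete_measure) measurable_AE_cong:
  assumes f: "f \<in> measurable M N" and ae: "AE \<omega> in M. f \<omega> = g \<omega>" and g: "g \<in> space M \<rightarrow> space N"
  shows "g \<in> measurable M N"
proof (rule measurableI)
  show "x \<in> space M \<Longrightarrow> g x \<in> space N" for x using g by auto
  fix A assume A: "A \<in> sets N"
  show "g -` A \<inter> space M \<in> sets M"
  proof (rule in_sets_AE)
    show "AE x in M. x \<in> f -` A \<inter> space M \<longleftrightarrow> x \<in> g -` A \<inter> space M"
      using ae by eventually_elim auto
  qed (use f A in auto)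
qed

text \<open>Times are rounded up and not down, for two reasons: the rounded value of a stopping time
  is known when it is reached, and right continuity carries values along the grid back to
  \<open>t\<close>.\<close>

definition dyadic_ceiling :: "nat \<Rightarrow> real \<Rightarrow> real" where
  "dyadic_ceiling n t = real (nat \<lceil>2 ^ n * t\<rceil>) / 2 ^ n"

lemma dyadic_ceiling_ge: "t \<le> dyadic_ceiling n t"
proof -
  have "2 ^ n * t \<le> real (nat \<lceil>2 ^ n * t\<rceil>)" by linarith
  then show ?thesis by (simp add: dyadic_ceiling_def field_simps)
qed

lemma dyadic_ceiling_le: "0 \<le> t \<Longrightarrow> dyadic_ceiling n t \<le> t + 1 / 2 ^ n"
proof -
  assume "0 \<le> t"
  then have "0 \<le> 2 ^ n * t" by simp
  then have "real (nat \<lceil>2 ^ n * t\<rceil>) \<le> 2 ^ n * t + 1" by linarith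
  then show ?thesis by (simp add: dyadic_ceiling_def field_simps)
qed

lemma tendsto_within_dyadic:
  fixes s :: "nat \<Rightarrow> real"
  assumes "\<And>n. t \<le> s n" "\<And>n. s n \<le> t + 1 / 2 ^ n"
  shows "s \<longlonglongrightarrow> t"
proof (rule tendsto_sandwich[of "\<lambda>_. t" _ _ "\<lambda>n. t + 1 / 2 ^ n"])
  have "(\<lambda>n. t + (1 / 2) ^ n) \<longlonglongrightarrow> t + 0" by (intro tendsto_intros LIMSEQ_realpow_zero) auto
  then show "(\<lambda>n. t + 1 / 2 ^ n) \<longlonglongrightarrow> t" by (simp add: power_one_over)
qed (simp_all add: assms)

lemma dyadic_ceiling_tendsto: "0 \<le> t \<Longrightarrow> (\<lambda>n. dyadic_ceiling n t) \<longlonglongrightarrow> t"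
  by (intro tendsto_within_dyadic dyadic_ceiling_ge dyadic_ceiling_le)

lemma right_continuous_seq:
  fixes f :: "real \<Rightarrow> 'b::first_countable_topology"
  assumes "continuous (at_right c) f" "s \<longlonglongrightarrow> c" "\<And>n. c \<le> s n"
  shows "(\<lambda>n. f (s n)) \<longlonglongrightarrow> f c"
proof -
  have "{c..} - {c} = {c<..} - {c}" by auto
  then have "at c within {c..} = at_right c" by (simp add: at_within_def)
  then have "continuous (at c within {c..}) f" using assms(1) by simp
  then show ?thesis using assms(2,3) by (auto simp: continuous_within_sequentially o_def)
qed

text \<open>Points arbitrarily close to \<open>s\<close> from the right either include
  \<open>s\<close> itself or force the bound in the limit. This is how a closed condition on a right
  continuous path is seen to hold at a debut.\<close>

lemma right_continuous_le:
  fixes f :: "real \<Rightarrow> real"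
  assumes f: "continuous (at_right s) f" and le: "\<And>e. 0 < e \<Longrightarrow> \<exists>u\<ge>s. u < s + e \<and> f u \<le> c"
  shows "f s \<le> c"
proof (rule ccontr)
  assume less: "\<not> f s \<le> c"
  then have "eventually (\<lambda>u. c < f u) (at_right s)"
    using f unfolding continuous_within by (intro order_tendstoD(1)) auto
  then obtain b where b: "s < b" "\<And>u. s < u \<Longrightarrow> u < b \<Longrightarrow> c < f u"
    unfolding eventually_at_right_field by auto
  obtain u where u: "s \<le> u" "u < s + (b - s)" "f u \<le> c" using le[of "b - s"] b(1) by auto
  then have "s < u" using less by (cases "u = s") auto
  then show False using b(2)[of u] u by auto
qed

lemma continuous_on_tendsto_left:
  fixes f :: "real \<Rightarrow> real"
  assumes "continuous_on {0..} f" "0 < s"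
  shows "(f \<longlongrightarrow> f s) (at_left s)"
proof -
  have "continuous (at s) f" by (rule continuous_on_interior[OF assms(1)]) (use assms(2) in simp)
  then show ?thesis unfolding continuous_at by (rule tendsto_mono[OF at_le, rotated]) simp
qed

lemma cadlag_right_continuous: "cadlag f \<Longrightarrow> 0 \<le> t \<Longrightarrow> continuous (at_right t) f"
  by (simp add: cadlag_def)

lemma cadlag_dyadic_ceiling:
  assumes "cadlag f" "0 \<le> t"
  shows "(\<lambda>n. f (dyadic_ceiling n t)) \<longlonglongrightarrow> f t"
  by (rule right_continuous_seq[OF cadlag_right_continuous[OF assms] dyadic_ceiling_tendsto[OF assms(2)] dyadic_ceiling_ge])

text \<open>The horizon \<open>K\<close> restricts \<open>T\<close> to real values: at
  \<open>T \<omega> = \<infinity>\<close> the function \<open>enn2real\<close> would return 0, and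
  the indicator removes that value.\<close>

abbreviation stopped :: "(real \<Rightarrow> 'a \<Rightarrow> real) \<Rightarrow> ('a \<Rightarrow> ennreal) \<Rightarrow> real \<Rightarrow> 'a \<Rightarrow> real" where
  "stopped X T K \<equiv> \<lambda>\<omega>. indicator {\<omega>. T \<omega> \<le> ennreal K} \<omega> * X (enn2real (T \<omega>)) \<omega>"

section \<open>Progressive sets and their debuts\<close>

definition progressive :: "'a measure \<Rightarrow> (real \<Rightarrow> 'a measure) \<Rightarrow> (real \<times> 'a) set \<Rightarrow> bool" where
  "progressive M F G \<longleftrightarrow> (\<forall>t\<ge>0. ({0..t} \<times> space M) \<inter> G \<in> sets (borel \<Otimes>\<^sub>M F t))"

definition debut :: "(real \<times> 'a) set \<Rightarrow> 'a \<Rightarrow> ennreal" where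
  "debut G \<omega> = (INF t\<in>{t. 0 \<le> t \<and> (t, \<omega>) \<in> G}. ennreal t)"

lemma debut_less_iff: "debut G \<omega> < ennreal u \<longleftrightarrow> (\<exists>s. 0 \<le> s \<and> s < u \<and> (s, \<omega>) \<in> G)"
proof -
  have "ennreal s < ennreal u \<longleftrightarrow> s < u" if "0 \<le> s" for s
    using that by (simp add: ennreal_less_iff)
  then show ?thesis unfolding debut_def INF_less_iff by auto
qed

lemma debut_le: "0 \<le> s \<Longrightarrow> (s, \<omega>) \<in> G \<Longrightarrow> debut G \<omega> \<le> ennreal s"
  unfolding debut_def by (intro INF_lower) auto

lemma debut_finite:
  assumes "debut G \<omega> < \<infinity>"
  shows "\<exists>t\<ge>0. debut G \<omega> = ennreal t \<and> (\<forall>e>0. \<exists>s\<ge>t. s < t + e \<and> (s, \<omega>) \<in> G)"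
proof -
  obtain t where t: "0 \<le> t" "debut G \<omega> = ennreal t" using assms by (cases "debut G \<omega>") auto
  have "\<exists>s\<ge>t. s < t + e \<and> (s, \<omega>) \<in> G" if "0 < e" for e
  proof -
    have "debut G \<omega> < ennreal (t + e)" using t that by (simp add: ennreal_less_iff)
    then obtain s where s: "0 \<le> s" "s < t + e" "(s, \<omega>) \<in> G" unfolding debut_less_iff by auto
    then have "t \<le> s" using debut_le[of s \<omega> G] t by simp
    then show ?thesis using s by auto
  qed
  then show ?thesis using t by auto
qed

context usual_filtered_prob_space
begin

lemma space_F: "0 \<le> t \<Longrightarrow> space (F t) = space M"
  using subalgebra_F by (simp add: subalgebra_def)

lemma sets_F_subset: "0 \<le> t \<Longrightarrow> A \<in> sets (F t) \<Longrightarrow> A \<in> sets M"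
  using subalgebra_F by (auto simp: subalgebra_def)

lemma space_M_in_F: "0 \<le> t \<Longrightarrow> space M \<in> sets (F t)"
  using sets.top[of "F t"] by (simp add: space_F)

lemma sets_F_mono': "A \<in> sets (F s) \<Longrightarrow> 0 \<le> s \<Longrightarrow> s \<le> t \<Longrightarrow> A \<in> sets (F t)"
  using sets_F_mono by blast

lemma measurable_F_mono:
  assumes "f \<in> measurable (F s) N" "0 \<le> s" "s \<le> t"
  shows "f \<in> measurable (F t) N"
proof (rule measurableI)
  show "x \<in> space (F t) \<Longrightarrow> f x \<in> space N" for x
    using measurable_space[OF assms(1), of x] assms by (simp add: space_F)
  show "f -` A \<inter> space (F t) \<in> sets (F t)" if "A \<in> sets N" for A
    using sets_F_mono'[OF measurable_sets[OF assms(1) that] assms(2,3)] assms(2,3) by (simp add: space_F)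
qed

lemma measurable_F_M: "f \<in> measurable (F t) N \<Longrightarrow> 0 \<le> t \<Longrightarrow> f \<in> measurable M N"
  using measurable_from_subalg[OF subalgebra_F] by blast

lemma null_sets_in_F: "N \<in> null_sets M \<Longrightarrow> 0 \<le> t \<Longrightarrow> N \<in> sets (F t)"
  using null_sets_F sets_F_mono' by blast

lemma sets_F_right:
  assumes "0 \<le> t" "\<And>u. t < u \<Longrightarrow> A \<in> sets (F u)"
  shows "A \<in> sets (F t)"
  using right_continuous_F[OF assms(1)] assms(2) by blast

lemma measurable_F_right:
  assumes t: "0 \<le> t" and f: "\<And>u. t < u \<Longrightarrow> f \<in> measurable (F u) N"
  shows "f \<in> measurable (F t) N"
proof (rule measurableI)
  show "x \<in> space (F t) \<Longrightarrow> f x \<in> space N" for x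
    using measurable_space[OF f[of "t + 1"], of x] t by (simp add: space_F)
  fix A assume A: "A \<in> sets N"
  have "f -` A \<inter> space M \<in> sets (F u)" if "t < u" for u
    using measurable_sets[OF f[OF that] A] that t by (simp add: space_F)
  then have "f -` A \<inter> space M \<in> sets (F t)" by (rule sets_F_right[OF t])
  then show "f -` A \<inter> space (F t) \<in> sets (F t)" using t by (simp add: space_F)
qed

lemma sigma_finite_subalgebra_F: "0 \<le> t \<Longrightarrow> sigma_finite_subalgebra M (F t)"
  by (intro finite_measure_subalgebra_is_sigma_finite finite_measure_subalgebra.intro
      finite_measure_subalgebra_axioms.intro finite_measure_axioms subalgebra_F)

text \<open>All null sets of \<open>M\<close> lie in \<open>F 0\<close> and hence in every
  \<open>F t\<close>, so the restriction of \<open>M\<close> to \<open>F t\<close> is a complete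
  finite measure and the projection theorem applies to it.\<close>

lemma projection_F:
  fixes A :: "(real \<times> 'a) set"
  assumes t: "0 \<le> t" and A: "A \<in> sets (borel \<Otimes>\<^sub>M F t)"
  shows "{\<omega>\<in>space M. \<exists>s. (s, \<omega>) \<in> A} \<in> sets (F t)"
proof -
  let ?N = "restr_to_subalg M (F t)"
  have N: "sets ?N = sets (F t)" "space ?N = space M"
    by (simp_all add: sets_restr_to_subalg[OF subalgebra_F[OF t]] space_restr_to_subalg)
  have "finite_measure ?N" by (rule finite_measure_restr_to_subalg[OF subalgebra_F[OF t] finite_measure_axioms])
  moreover have "complete_measure ?N"
  proof
    fix B A assume BA: "B \<subseteq> A" "A \<in> null_sets ?N"
    then have "A \<in> null_sets M" using null_sets_restr_to_subalg[OF subalgebra_F[OF t]] by auto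
    then show "B \<in> sets ?N" using complete2[OF BA(1)] null_sets_in_F t by (simp add: N)
  qed
  moreover have "A \<in> sets (borel \<Otimes>\<^sub>M ?N)"
    using A by (simp cong: sets_pair_measure_cong add: N(1))
  ultimately have "{\<omega>\<in>space ?N. \<exists>s. (s, \<omega>) \<in> A} \<in> sets ?N" by (rule measurable_projection)
  then show ?thesis by (simp only: N)
qed

lemma ext_stopping_time_iff:
  "ext_stopping_time F T \<longleftrightarrow> (\<forall>t\<ge>0. {\<omega>\<in>space M. T \<omega> \<le> ennreal t} \<in> sets (F t))"
  unfolding ext_stopping_time_def by (auto simp: pred_def space_F)

text \<open>A strict inequality \<open>debut G < r\<close> is a projection of the part of
  \<open>G\<close> before \<open>r\<close>, and it is an event of \<open>F u\<close> if
  \<open>r \<le> u\<close>. The non-strict event at \<open>t\<close> is the intersection over levels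
  \<open>r\<close> decreasing to \<open>t\<close> within \<open>(t, u]\<close>; hence it lies in
  \<open>F u\<close> for every \<open>u > t\<close>, and by right continuity of the filtration in
  \<open>F t\<close>.\<close>

lemma ext_stopping_time_debut:
  assumes G: "progressive M F G"
  shows "ext_stopping_time F (debut G)"
  unfolding ext_stopping_time_iff
proof (intro allI impI, rule sets_F_right, assumption)
  fix t u :: real assume t: "0 \<le> t" "t < u"
  define P where "P n = {\<omega>\<in>space M. \<exists>s. (s, \<omega>) \<in> ({0..u} \<times> space M) \<inter> G \<inter> ({..< t + (u - t) / Suc n} \<times> space M)}" for n
  have "{\<omega>\<in>space M. debut G \<omega> \<le> ennreal t} = (\<Inter>n. P n)"
  proof -
    have "debut G \<omega> \<le> ennreal t \<longleftrightarrow> (\<forall>n. debut G \<omega> < ennreal (t + (u - t) / Suc n))" for \<omega>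
    proof
      assume le: "debut G \<omega> \<le> ennreal t"
      show "\<forall>n. debut G \<omega> < ennreal (t + (u - t) / Suc n)"
      proof
        fix n
        have "ennreal t < ennreal (t + (u - t) / Suc n)" using t by (simp add: ennreal_less_iff)
        then show "debut G \<omega> < ennreal (t + (u - t) / Suc n)" using le by (rule le_less_trans[rotated])
      qed
    next
      assume *: "\<forall>n. debut G \<omega> < ennreal (t + (u - t) / Suc n)"
      have "(\<lambda>n. ennreal (t + (u - t) / Suc n)) \<longlonglongrightarrow> ennreal (t + 0)"
        by (intro tendsto_ennrealI tendsto_intros LIMSEQ_Suc[OF lim_const_over_n])
      then show "debut G \<omega> \<le> ennreal t"
        using * by (intro LIMSEQ_le_const[where X="\<lambda>n. ennreal (t + (u - t) / Suc n)"]) (auto intro: less_imp_le)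
    qed
    moreover have "debut G \<omega> < ennreal (t + (u - t) / Suc n) \<longleftrightarrow> \<omega> \<in> P n" if "\<omega> \<in> space M" for \<omega> n
    proof -
      have "(u - t) * 1 \<le> (u - t) * Suc n" using t by (intro mult_left_mono) auto
      then have "(u - t) / Suc n \<le> u - t" by (simp add: pos_divide_le_eq)
      then have "s \<le> u" if "s < t + (u - t) / Suc n" for s using that by linarith
      then show ?thesis unfolding debut_less_iff P_def using that by auto
    qed
    ultimately have "debut G \<omega> \<le> ennreal t \<longleftrightarrow> (\<forall>n. \<omega> \<in> P n)" if "\<omega> \<in> space M" for \<omega>
      using that by presburger
    moreover have "P 0 \<subseteq> space M" unfolding P_def by auto
    ultimately show ?thesis by (auto dest: subsetD)
  qed
  moreover have "P n \<in> sets (F u)" for n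
  proof -
    have "{..< t + (u - t) / Suc n} \<times> space (F u) \<in> sets (borel \<Otimes>\<^sub>M F u)" by (intro pair_measureI) auto
    then have box: "{..< t + (u - t) / Suc n} \<times> space M \<in> sets (borel \<Otimes>\<^sub>M F u)" using t by (simp add: space_F)
    have "({0..u} \<times> space M) \<inter> G \<in> sets (borel \<Otimes>\<^sub>M F u)" using G t by (simp add: progressive_def)
    then show ?thesis unfolding P_def using t by (intro projection_F sets.Int[OF _ box]) simp_all
  qed
  ultimately show "{\<omega>\<in>space M. debut G \<omega> \<le> ennreal t} \<in> sets (F u)" by auto
qed

text \<open>A generator \<open>{s<..u} \<times> A\<close> with \<open>s \<le> t\<close> has
  \<open>A\<close> known at time \<open>t\<close>, and one with \<open>t < s\<close> leaves no trace
  on \<open>[0, t]\<close>. Cutting at \<open>t\<close> commutes with countable unions and, relative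
  to the strip, with complements.\<close>

lemma predictable_progressive:
  assumes "\<Gamma> \<in> sets (predictable_sigma M F)"
  shows "progressive M F \<Gamma>"
  unfolding progressive_def
proof (intro allI impI)
  fix t :: real assume t: "0 \<le> t"
  let ?G = "{{0} \<times> A | A. A \<in> sets (F 0)} \<union> {{s<..u} \<times> A | s u A. 0 \<le> s \<and> s \<le> u \<and> A \<in> sets (F s)}"
  have "?G \<subseteq> Pow ({0..} \<times> space M)"
    using sets.sets_into_space by (fastforce simp: space_F)
  then have "\<Gamma> \<in> sigma_sets ({0..} \<times> space M) ?G"
    using assms by (simp add: predictable_sigma_def)
  then show "({0..t} \<times> space M) \<inter> \<Gamma> \<in> sets (borel \<Otimes>\<^sub>M F t)"
  proof induction
    case (Basic A)
    then consider (zero) B where "A = {0} \<times> B" "B \<in> sets (F 0)"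
      | (interval) s u B where "A = {s<..u} \<times> B" "0 \<le> s" "s \<le> u" "B \<in> sets (F s)" by blast
    then show ?case
    proof cases
      case zero
      then have "B \<in> sets (F t)" using t by (auto intro: sets_F_mono')
      moreover have "({0..t} \<times> space M) \<inter> A = {0} \<times> B"
        using zero t sets.sets_into_space[OF zero(2)] by (auto simp: space_F)
      ultimately show ?thesis by auto
    next
      case interval
      show ?thesis
      proof (cases "s \<le> t")
        case True
        then have "B \<in> sets (F t)" using interval by (auto intro: sets_F_mono')
        moreover have "({0..t} \<times> space M) \<inter> A = {s<..min u t} \<times> B"
          using interval t sets.sets_into_space[OF interval(4)] by (auto simp: space_F)
        ultimately show ?thesis by auto
      next
        case False
        then have "({0..t} \<times> space M) \<inter> A = {}" using interval by auto
        then show ?thesis by simp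
      qed
    qed
  next
    case (Compl A)
    have "({0..t} \<times> space M) \<inter> ({0..} \<times> space M - A) = {0..t} \<times> space (F t) - ({0..t} \<times> space M) \<inter> A"
      using t by (auto simp: space_F)
    moreover have "{0..t} \<times> space (F t) \<in> sets (borel \<Otimes>\<^sub>M F t)" by (intro pair_measureI) auto
    ultimately show ?case using Compl by auto
  next
    case (Union A)
    have "({0..t} \<times> space M) \<inter> (\<Union>i. A i) = (\<Union>i. ({0..t} \<times> space M) \<inter> A i)" by (rule Int_UN_distrib)
    moreover have "\<dots> \<in> sets (borel \<Otimes>\<^sub>M F t)" by (rule sets.countable_UN) (use Union in auto)
    ultimately show ?case by simp
  qed simp
qed

text \<open>The process is approximated by its values at the right end points of dyadic cells. These
  end points are cut off at \<open>t\<close>, since otherwise the approximation would look beyond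
  \<open>t\<close>; clamping the time to \<open>[0, t]\<close> makes the process total on the
  product space.\<close>

lemma progressive_process:
  assumes Z: "adapted F Z" "\<And>\<omega>. \<omega> \<in> space M \<Longrightarrow> cadlag (\<lambda>t. Z t \<omega>)" and t: "0 \<le> t"
  shows "(\<lambda>(s, \<omega>). Z (max 0 (min s t)) \<omega>) \<in> borel_measurable (borel \<Otimes>\<^sub>M F t)"
proof (rule borel_measurable_LIMSEQ_real)
  define c where "c s = max 0 (min s t)" for s
  have c: "0 \<le> c s" "c s \<le> t" for s using t by (auto simp: c_def)
  show "(\<lambda>x. case x of (s, \<omega>) \<Rightarrow> Z (min t (real (nat \<lceil>2 ^ n * c s\<rceil>) / 2 ^ n)) \<omega>) \<in>
      borel_measurable (borel \<Otimes>\<^sub>M F t)" for n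
  proof -
    have "(\<lambda>x. Z (min t (real i / 2 ^ n)) (snd x)) \<in> borel_measurable (borel \<Otimes>\<^sub>M F t)" for i
    proof -
      have "Z (min t (real i / 2 ^ n)) \<in> borel_measurable (F (min t (real i / 2 ^ n)))"
        using Z(1) t by (simp add: adapted_def)
      then have "Z (min t (real i / 2 ^ n)) \<in> borel_measurable (F t)"
        by (rule measurable_F_mono) (use t in auto)
      then show ?thesis by (rule measurable_compose[OF measurable_snd])
    qed
    moreover have "(\<lambda>x. nat \<lceil>2 ^ n * c (fst x)\<rceil>) \<in> measurable (borel \<Otimes>\<^sub>M F t) (count_space UNIV)"
    proof -
      have "(\<lambda>s. nat \<lceil>2 ^ n * c s\<rceil>) \<in> measurable borel (count_space UNIV)" unfolding c_def by measurable
      then show ?thesis by (rule measurable_compose[OF measurable_fst])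
    qed
    ultimately have "(\<lambda>x. (\<lambda>i. Z (min t (real i / 2 ^ n)) (snd x)) (nat \<lceil>2 ^ n * c (fst x)\<rceil>)) \<in>
        borel_measurable (borel \<Otimes>\<^sub>M F t)"
      by (rule measurable_compose_countable)
    then show ?thesis by (simp add: case_prod_beta)
  qed
  fix x :: "real \<times> 'a" assume "x \<in> space (borel \<Otimes>\<^sub>M F t)"
  then obtain s \<omega> where x: "x = (s, \<omega>)" "\<omega> \<in> space M" using t by (auto simp: space_pair_measure space_F)
  have "(\<lambda>n. Z (min t (dyadic_ceiling n (c s))) \<omega>) \<longlonglongrightarrow> Z (c s) \<omega>"
  proof (rule right_continuous_seq[where f="\<lambda>t. Z t \<omega>"])
    show "continuous (at_right (c s)) (\<lambda>t. Z t \<omega>)" using Z(2) x c by (intro cadlag_right_continuous)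
    have "(\<lambda>n. min t (dyadic_ceiling n (c s))) \<longlonglongrightarrow> min t (c s)"
      by (intro tendsto_intros dyadic_ceiling_tendsto c)
    then show "(\<lambda>n. min t (dyadic_ceiling n (c s))) \<longlonglongrightarrow> c s" using c by (simp add: min_absorb2)
    show "c s \<le> min t (dyadic_ceiling n (c s))" for n using c dyadic_ceiling_ge by simp
  qed
  then show "(\<lambda>n. case x of (s, \<omega>) \<Rightarrow> Z (min t (real (nat \<lceil>2 ^ n * c s\<rceil>) / 2 ^ n)) \<omega>)
      \<longlonglongrightarrow> (case x of (s, \<omega>) \<Rightarrow> Z (max 0 (min s t)) \<omega>)"
    by (simp add: x dyadic_ceiling_def c_def)
qed

text \<open>Exceptional null sets can be collected only over countably many times. Dyadic times
  suffice, because right continuity recovers every value as a limit of values at dyadic times and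
  \<open>C\<close> is closed.\<close>

lemma AE_cadlag_closed:
  assumes N: "\<And>\<omega>. \<omega> \<in> space M \<Longrightarrow> cadlag (\<lambda>t. N t \<omega>)"
    and C: "closed C" "\<And>t. 0 \<le> t \<Longrightarrow> AE \<omega> in M. N t \<omega> \<in> C"
  shows "AE \<omega> in M. \<forall>t\<ge>0. N t \<omega> \<in> C"
proof -
  have "AE \<omega> in M. \<forall>(n::nat) (i::nat). N (real i / 2 ^ n) \<omega> \<in> C"
    unfolding AE_all_countable using C(2) by simp
  then show ?thesis
    using AE_space
  proof eventually_elim
    case (elim \<omega>)
    show ?case
    proof (intro allI impI)
      fix t :: real assume t: "0 \<le> t"
      have "(\<lambda>n. N (dyadic_ceiling n t) \<omega>) \<longlonglongrightarrow> N t \<omega>"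
        using cadlag_dyadic_ceiling[OF N t] elim by simp
      then show "N t \<omega> \<in> C"
        by (rule closed_sequentially[OF C(1), rotated]) (use elim in \<open>simp add: dyadic_ceiling_def\<close>)
    qed
  qed
qed

text \<open>On \<open>A n j\<close> the rounded value of \<open>T\<close> is the fixed time
  \<open>j / 2 ^ n\<close>, and \<open>A n j\<close> is known at that time. A stopped value thereby
  becomes a limit of finite sums over fixed times, to which conditional expectation applies term by
  term. The two processes compared later share the same sets \<open>A n j\<close>.\<close>

lemma sampling_limit:
  fixes X :: "real \<Rightarrow> 'a \<Rightarrow> real"
  assumes X: "\<And>t. 0 \<le> t \<Longrightarrow> X t \<in> borel_measurable M"
    "\<And>t \<omega>. 0 \<le> t \<Longrightarrow> \<omega> \<in> space M \<Longrightarrow> continuous (at_right t) (\<lambda>t. X t \<omega>)"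
    "AE \<omega> in M. \<forall>t\<ge>0. \<bar>X t \<omega>\<bar> \<le> B"
    and T: "ext_stopping_time F T" and K: "0 \<le> K"
  defines "A n j \<equiv> {\<omega>\<in>space M. T \<omega> \<le> ennreal K \<and> nat \<lceil>2 ^ n * enn2real (T \<omega>)\<rceil> = j}"
  shows "(\<lambda>n. \<Sum>j\<le>nat \<lceil>2 ^ n * K\<rceil>. \<integral>\<omega>. indicator (A n j) \<omega> * X (real j / 2 ^ n) \<omega> \<partial>M) \<longlonglongrightarrow>
      (\<integral>\<omega>. stopped X T K \<omega> \<partial>M)"
    and "integrable M (stopped X T K)"
    and "A n j \<in> sets (F (real j / 2 ^ n))"
proof -
  show AF: "A n j \<in> sets (F (real j / 2 ^ n))" for n j
  proof -
    have T': "{\<omega>\<in>space M. T \<omega> \<le> ennreal (min K s)} \<in> sets (F (real j / 2 ^ n))"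
      if "0 \<le> s" "s \<le> real j / 2 ^ n" for s
    proof (rule sets_F_mono')
      show "{\<omega>\<in>space M. T \<omega> \<le> ennreal (min K s)} \<in> sets (F (min K s))"
        using T K that unfolding ext_stopping_time_iff by simp
    qed (use that K in auto)
    \<comment> \<open>The event is a half-open cell \<open>((j - 1) / 2 ^ n, j / 2 ^ n]\<close>,
      except that for \<open>j = 0\<close> there is no lower condition, as \<open>T\<close> is
      nonnegative. Capping the bounds with \<open>K\<close> keeps all of them at or before time
      \<open>j / 2 ^ n\<close>.\<close>
    have iff: "T \<omega> \<le> ennreal K \<and> nat \<lceil>2 ^ n * enn2real (T \<omega>)\<rceil> = j \<longleftrightarrow>
        T \<omega> \<le> ennreal (min K (real j / 2 ^ n)) \<and>
        \<not> (0 < j \<and> T \<omega> \<le> ennreal (min K (real (j - 1) / 2 ^ n)))" for \<omega>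
    proof (cases "T \<omega>")
      case (real r)
      have "nat \<lceil>2 ^ n * r\<rceil> = j \<longleftrightarrow> 2 ^ n * r \<le> real j \<and> \<not> (0 < j \<and> 2 ^ n * r \<le> real (j - 1))"
      proof -
        have "0 \<le> 2 ^ n * r" using real by simp
        then show ?thesis by (cases j) (auto simp: le_nat_iff ceiling_eq_iff, linarith+)
      qed
      moreover have "2 ^ n * r \<le> x \<longleftrightarrow> r \<le> x / 2 ^ n" for x by (simp add: field_simps)
      ultimately show ?thesis using real K by auto
    qed (auto simp: top_unique)
    have "A n j = {\<omega>\<in>space M. T \<omega> \<le> ennreal (min K (real j / 2 ^ n))} -
        (if 0 < j then {\<omega>\<in>space M. T \<omega> \<le> ennreal (min K (real (j - 1) / 2 ^ n))} else {})"
      unfolding A_def iff by auto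
    moreover have "real (j - 1) / 2 ^ n \<le> real j / 2 ^ n" by (simp add: divide_right_mono)
    ultimately show ?thesis using T'[of "real j / 2 ^ n"] T'[of "real (j - 1) / 2 ^ n"] by auto
  qed
  then have A[measurable]: "A n j \<in> sets M" for n j by (rule sets_F_subset[rotated]) simp
  define f where "f n \<omega> = (\<Sum>j\<le>nat \<lceil>2 ^ n * K\<rceil>. indicator (A n j) \<omega> * X (real j / 2 ^ n) \<omega>)" for n \<omega>
  have X'[measurable]: "X (real j / 2 ^ n) \<in> borel_measurable M" for j n using X(1) by simp
  have f_eq: "f n \<omega> = indicator {\<omega>. T \<omega> \<le> ennreal K} \<omega> * X (dyadic_ceiling n (enn2real (T \<omega>))) \<omega>"
    if "\<omega> \<in> space M" for n \<omega>
  proof (cases "T \<omega> \<le> ennreal K")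
    case True
    define j where "j = nat \<lceil>2 ^ n * enn2real (T \<omega>)\<rceil>"
    have "enn2real (T \<omega>) \<le> K" using enn2real_mono[OF True] K by simp
    then have "j \<le> nat \<lceil>2 ^ n * K\<rceil>" unfolding j_def by (intro nat_mono ceiling_mono) simp
    have "f n \<omega> = (\<Sum>i\<le>nat \<lceil>2 ^ n * K\<rceil>. if i = j then X (real i / 2 ^ n) \<omega> else 0)"
      unfolding f_def using that True by (intro sum.cong) (auto simp: A_def j_def split: split_indicator)
    also have "\<dots> = X (real j / 2 ^ n) \<omega>" using \<open>j \<le> nat \<lceil>2 ^ n * K\<rceil>\<close> by simp
    finally show ?thesis using True by (simp add: dyadic_ceiling_def j_def)
  next
    case False
    then show ?thesis unfolding f_def A_def by simp
  qed
  have f_meas[measurable]: "f n \<in> borel_measurable M" for n unfolding f_def by measurable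
  have lim: "(\<lambda>n. f n \<omega>) \<longlonglongrightarrow> stopped X T K \<omega>"
    if "\<omega> \<in> space M" for \<omega>
    unfolding f_eq[OF that]
    by (intro tendsto_mult_left right_continuous_seq[where f="\<lambda>t. X t \<omega>"] X(2) that
        dyadic_ceiling_tendsto dyadic_ceiling_ge) auto
  have meas[measurable]: "stopped X T K \<in> borel_measurable M"
    by (rule borel_measurable_LIMSEQ_real[OF lim f_meas])
  have bound: "AE \<omega> in M. norm (f n \<omega>) \<le> \<bar>B\<bar>" for n
    using X(3) AE_space
  proof eventually_elim
    case (elim \<omega>)
    have "0 \<le> dyadic_ceiling n (enn2real (T \<omega>))" by (rule order_trans[OF enn2real_nonneg dyadic_ceiling_ge])
    then show ?case using elim by (auto simp: f_eq abs_mult split: split_indicator intro: order_trans)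
  qed
  have lim': "AE \<omega> in M. (\<lambda>n. f n \<omega>) \<longlonglongrightarrow> stopped X T K \<omega>"
    using lim by simp
  have w: "integrable M (\<lambda>_. \<bar>B\<bar>)" by simp
  note dc = integrable_dominated_convergence[OF meas f_meas w lim' bound]
    integral_dominated_convergence[OF meas f_meas w lim' bound]
  show "integrable M (stopped X T K)" by (rule dc)
  have "(\<integral>\<omega>. f n \<omega> \<partial>M) = (\<Sum>j\<le>nat \<lceil>2 ^ n * K\<rceil>. \<integral>\<omega>. indicator (A n j) \<omega> * X (real j / 2 ^ n) \<omega> \<partial>M)" for n
    unfolding f_def
  proof (rule Bochner_Integration.integral_sum)
    fix j
    show "integrable M (\<lambda>\<omega>. indicator (A n j) \<omega> * X (real j / 2 ^ n) \<omega>)"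
    proof (rule integrable_const_bound[where B="\<bar>B\<bar>"])
      show "AE \<omega> in M. norm (indicator (A n j) \<omega> * X (real j / 2 ^ n) \<omega>) \<le> \<bar>B\<bar>"
        using X(3) by eventually_elim
          (auto simp: abs_mult split: split_indicator intro: order_trans[OF _ abs_ge_self])
    qed measurable
  qed
  then show "(\<lambda>n. \<Sum>j\<le>nat \<lceil>2 ^ n * K\<rceil>. \<integral>\<omega>. indicator (A n j) \<omega> * X (real j / 2 ^ n) \<omega> \<partial>M) \<longlonglongrightarrow>
      (\<integral>\<omega>. stopped X T K \<omega> \<partial>M)" using dc(2) by simp
qed

lemma cond_exp_bounded:
  assumes t: "0 \<le> t" and W: "W \<in> borel_measurable M" "AE \<omega> in M. \<bar>W \<omega>\<bar> \<le> B"
    and N: "AE \<omega> in M. N \<omega> = real_cond_exp M (F t) W \<omega>"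
  shows "AE \<omega> in M. \<bar>N \<omega>\<bar> \<le> B"
proof -
  interpret sigma_finite_subalgebra M "F t" by (rule sigma_finite_subalgebra_F[OF t])
  have int: "integrable M W" by (rule integrable_const_bound[where B=B]) (use W in auto)
  have "AE \<omega> in M. W \<omega> \<le> B" "AE \<omega> in M. W \<omega> \<ge> - B"
    using W(2) by (eventually_elim, linarith)+
  then have "AE \<omega> in M. real_cond_exp M (F t) W \<omega> \<le> B" "AE \<omega> in M. real_cond_exp M (F t) W \<omega> \<ge> - B"
    by (simp_all add: real_cond_exp_le_c[OF int] real_cond_exp_ge_c[OF int])
  with N show ?thesis by eventually_elim auto
qed

text \<open>With \<open>W\<close> constant in time this is optional stopping for the martingale \<open>E[W | F\<^sub>t]\<close>; with
  \<open>W t\<close> the indicator of \<open>L > t\<close> it is \<open>P[T < L] = E[Z\<^sub>T]\<close>.\<close>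

lemma optional_sampling:
  fixes N W :: "real \<Rightarrow> 'a \<Rightarrow> real"
  assumes N: "adapted F N" "\<And>\<omega>. \<omega> \<in> space M \<Longrightarrow> cadlag (\<lambda>t. N t \<omega>)"
    and W: "\<And>t. 0 \<le> t \<Longrightarrow> W t \<in> borel_measurable M"
      "\<And>t \<omega>. 0 \<le> t \<Longrightarrow> \<omega> \<in> space M \<Longrightarrow> continuous (at_right t) (\<lambda>t. W t \<omega>)"
      "\<And>t \<omega>. 0 \<le> t \<Longrightarrow> \<omega> \<in> space M \<Longrightarrow> \<bar>W t \<omega>\<bar> \<le> B"
    and NW: "\<And>t. 0 \<le> t \<Longrightarrow> AE \<omega> in M. N t \<omega> = real_cond_exp M (F t) (W t) \<omega>"
    and T: "ext_stopping_time F T" and K: "0 \<le> K"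
  shows "(\<integral>\<omega>. stopped N T K \<omega> \<partial>M) =
      (\<integral>\<omega>. stopped W T K \<omega> \<partial>M)"
    and "integrable M (stopped N T K)"
    and "integrable M (stopped W T K)"
    and "AE \<omega> in M. \<forall>t\<ge>0. \<bar>N t \<omega>\<bar> \<le> B"
proof -
  have "AE \<omega> in M. N t \<omega> \<in> {-B..B}" if "0 \<le> t" for t
    using cond_exp_bounded[OF that W(1)[OF that] _ NW[OF that], of B] W(3)[OF that] by (auto simp: abs_le_iff minus_le_iff)
  then have "AE \<omega> in M. \<forall>t\<ge>0. N t \<omega> \<in> {-B..B}" by (intro AE_cadlag_closed N) auto
  then show N_bound: "AE \<omega> in M. \<forall>t\<ge>0. \<bar>N t \<omega>\<bar> \<le> B" by (auto simp: abs_le_iff minus_le_iff)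
  have N_meas: "N t \<in> borel_measurable M" if "0 \<le> t" for t
    using N(1) that by (auto simp: adapted_def intro: measurable_F_M)
  have W_bound: "AE \<omega> in M. \<forall>t\<ge>0. \<bar>W t \<omega>\<bar> \<le> B" using W(3) by auto
  have N_cont: "continuous (at_right t) (\<lambda>t. N t \<omega>)" if "0 \<le> t" "\<omega> \<in> space M" for t \<omega>
    using N(2)[OF that(2)] that(1) by (rule cadlag_right_continuous)
  note limN = sampling_limit[OF N_meas N_cont N_bound T K]
  note limW = sampling_limit[OF W(1,2) W_bound T K]
  show "integrable M (stopped N T K)"
    "integrable M (stopped W T K)"
    using limN(2) limW(2) by auto
  \<comment> \<open>By the defining property of conditional expectation, each term of the grid sum
    for \<open>N\<close> equals the corresponding term for \<open>W\<close>, so both sums have the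
    same limit.\<close>
  have "(\<integral>\<omega>. indicator A \<omega> * N t \<omega> \<partial>M) = (\<integral>\<omega>. indicator A \<omega> * W t \<omega> \<partial>M)"
    if A: "A \<in> sets (F t)" and t: "0 \<le> t" for A t
  proof -
    interpret sigma_finite_subalgebra M "F t" by (rule sigma_finite_subalgebra_F[OF t])
    have int: "integrable M (W t)" by (rule integrable_const_bound[where B=B]) (use W t in auto)
    have [measurable]: "A \<in> sets M" "N t \<in> borel_measurable M" using A t sets_F_subset N_meas by auto
    have "(\<integral>\<omega>. indicator A \<omega> * N t \<omega> \<partial>M) = (\<integral>\<omega>. indicator A \<omega> * real_cond_exp M (F t) (W t) \<omega> \<partial>M)"
      using NW[OF t] by (intro integral_cong_AE) auto
    also have "\<dots> = (\<integral>\<omega>. indicator A \<omega> * W t \<omega> \<partial>M)"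
      using real_cond_exp_intA[OF int A] by (simp add: set_lebesgue_integral_def)
    finally show ?thesis .
  qed
  note this[OF limN(3)]
  then have "(\<lambda>n. \<Sum>j\<le>nat \<lceil>2 ^ n * K\<rceil>. \<integral>\<omega>. indicator {\<omega>\<in>space M. T \<omega> \<le> ennreal K \<and> nat \<lceil>2 ^ n * enn2real (T \<omega>)\<rceil> = j} \<omega> * N (real j / 2 ^ n) \<omega> \<partial>M) =
    (\<lambda>n. \<Sum>j\<le>nat \<lceil>2 ^ n * K\<rceil>. \<integral>\<omega>. indicator {\<omega>\<in>space M. T \<omega> \<le> ennreal K \<and> nat \<lceil>2 ^ n * enn2real (T \<omega>)\<rceil> = j} \<omega> * W (real j / 2 ^ n) \<omega> \<partial>M)"
    by (intro ext sum.cong) auto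
  then show "(\<integral>\<omega>. stopped N T K \<omega> \<partial>M) =
      (\<integral>\<omega>. stopped W T K \<omega> \<partial>M)"
    using limN(1) limW(1) LIMSEQ_unique by simp
qed

end

section \<open>Cadlag versions of bounded martingales\<close>

text \<open>A greedy count of the moves of size \<open>e\<close> of a sequence, with the current reference value.
  It obeys a pathwise inequality whose last term has mean zero for a martingale.\<close>

primrec reference :: "real \<Rightarrow> (nat \<Rightarrow> real) \<Rightarrow> nat \<Rightarrow> real" where
  "reference e x 0 = x 0"
| "reference e x (Suc k) = (if e \<le> \<bar>x (Suc k) - reference e x k\<bar> then x (Suc k) else reference e x k)"

primrec moves :: "real \<Rightarrow> (nat \<Rightarrow> real) \<Rightarrow> nat \<Rightarrow> nat" where
  "moves e x 0 = 0"
| "moves e x (Suc k) = moves e x k + (if e \<le> \<bar>x (Suc k) - reference e x k\<bar> then 1 else 0)"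

lemma reference_close: "0 < e \<Longrightarrow> \<bar>x k - reference e x k\<bar> < e"
  by (cases k) auto

lemma moves_mono: "i \<le> j \<Longrightarrow> moves e x i \<le> moves e x j"
  by (rule lift_Suc_mono_le) simp_all

lemma reference_const:
  "i \<le> j \<Longrightarrow> moves e x j = moves e x i \<Longrightarrow> reference e x j = reference e x i"
proof (induction rule: dec_induct)
  case (step k)
  then have "moves e x i \<le> moves e x k" by (intro moves_mono)
  with step show ?case by (simp split: if_splits)
qed simp

text \<open>Without a counted move between \<open>i\<close> and \<open>j\<close> the reference would
  be the same at both, and both values would lie within \<open>e\<close> of it.\<close>

lemma moves_less:
  assumes "0 < e" "i \<le> j" "2 * e \<le> \<bar>x i - x j\<bar>"
  shows "Suc (moves e x i) \<le> moves e x j"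
proof (rule ccontr)
  assume "\<not> ?thesis"
  then have "reference e x j = reference e x i"
    using moves_mono[OF assms(2), of e x] by (intro reference_const assms(2)) simp
  then show False
    using reference_close[OF assms(1), of x i] reference_close[OF assms(1), of x j] assms(3) by linarith
qed

text \<open>The sum is a discrete stochastic integral of the reference value. The induction carries
  the additional square \<open>(x n - reference e x n)\<^sup>2\<close> on the left: it either
  persists, or it is at least \<open>e\<^sup>2\<close> and is exchanged for one counted
  move.\<close>

lemma moves_bound:
  assumes "0 \<le> e"
  shows "e\<^sup>2 * moves e x n \<le> (x n)\<^sup>2 - 2 * (\<Sum>k<n. reference e x k * (x (Suc k) - x k))"
proof -
  have "e\<^sup>2 * moves e x n + (x n - reference e x n)\<^sup>2 \<le>
      (x n)\<^sup>2 - (x 0)\<^sup>2 - 2 * (\<Sum>k<n. reference e x k * (x (Suc k) - x k))"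
  proof (induction n)
    case (Suc n)
    let ?r = "reference e x n"
    have "e\<^sup>2 * moves e x (Suc n) + (x (Suc n) - reference e x (Suc n))\<^sup>2 \<le>
        e\<^sup>2 * moves e x n + (x (Suc n) - ?r)\<^sup>2"
    proof (cases "e \<le> \<bar>x (Suc n) - ?r\<bar>")
      case True
      then have "e\<^sup>2 \<le> (x (Suc n) - ?r)\<^sup>2" using assms by (simp add: abs_le_square_iff[symmetric])
      then show ?thesis using True by (simp add: algebra_simps)
    qed simp
    also have "\<dots> = e\<^sup>2 * moves e x n + (x n - ?r)\<^sup>2 + (x (Suc n))\<^sup>2 - (x n)\<^sup>2 - 2 * (?r * (x (Suc n) - x n))"
      by (simp add: power2_eq_square algebra_simps)
    finally show ?case using Suc by (simp add: algebra_simps)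
  qed simp
  moreover have "0 \<le> (x n - reference e x n)\<^sup>2" "0 \<le> (x 0)\<^sup>2" by simp_all
  ultimately show ?thesis by linarith
qed

lemma abs_reference_le: "(\<And>i. \<bar>x i\<bar> \<le> B) \<Longrightarrow> \<bar>reference e x k\<bar> \<le> B"
  by (induction k) auto

text \<open>The counterpart of upcrossings without levels: successive non-overlapping pairs of
  points of \<open>D\<close> count if the values differ by \<open>e\<close> in either direction.
  Bounding these numbers controls left and right limits at once.\<close>

primrec oscillates :: "real \<Rightarrow> (real \<Rightarrow> real) \<Rightarrow> real set \<Rightarrow> nat \<Rightarrow> real \<Rightarrow> real \<Rightarrow> bool" where
  "oscillates e f D 0 a b \<longleftrightarrow> True"
| "oscillates e f D (Suc m) a b \<longleftrightarrow>
     (\<exists>p\<in>D. \<exists>q\<in>D. a \<le> p \<and> p < q \<and> q \<le> b \<and> e \<le> \<bar>f p - f q\<bar> \<and> oscillates e f D m q b)"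

lemma oscillates_SucI:
  "p \<in> D \<Longrightarrow> q \<in> D \<Longrightarrow> a \<le> p \<Longrightarrow> p < q \<Longrightarrow> q \<le> b \<Longrightarrow> e \<le> \<bar>f p - f q\<bar> \<Longrightarrow>
    oscillates e f D m q b \<Longrightarrow> oscillates e f D (Suc m) a b"
  by (simp only: oscillates.simps) blast

lemma oscillates_mono:
  assumes "oscillates e f D m a b" "e' \<le> e" "D \<subseteq> D'" "a' \<le> a" "b \<le> b'"
  shows "oscillates e' f D' m a' b'"
  using assms(1,4)
proof (induction m arbitrary: a a')
  case (Suc m)
  then obtain p q where pq: "p \<in> D" "q \<in> D" "a \<le> p" "p < q" "q \<le> b" "e \<le> \<bar>f p - f q\<bar>"
      "oscillates e f D m q b" by auto
  have "oscillates e' f D' m q b'" using Suc.IH[OF pq(7)] by simp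
  moreover have "p \<in> D'" "q \<in> D'" "a' \<le> p" "q \<le> b'" "e' \<le> \<bar>f p - f q\<bar>" using pq assms Suc.prems by auto
  ultimately show ?case using pq(4) by (simp only: oscillates.simps) blast
qed simp

text \<open>An oscillation of length \<open>m\<close> involves only finitely many points, all of
  which belong to one stage of the increasing union.\<close>

lemma oscillates_UN:
  assumes "incseq D" "oscillates e f (\<Union>n. D n) m a b"
  shows "\<exists>n. oscillates e f (D n) m a b"
  using assms(2)
proof (induction m arbitrary: a)
  case (Suc m)
  then obtain p q i j where pq: "p \<in> D i" "q \<in> D j" "a \<le> p" "p < q" "q \<le> b" "e \<le> \<bar>f p - f q\<bar>"
      "oscillates e f (\<Union>n. D n) m q b" by auto
  obtain k where k: "oscillates e f (D k) m q b" using Suc.IH[OF pq(7)] by blast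
  define n where "n = max k (max i j)"
  have "D i \<subseteq> D n" "D j \<subseteq> D n" "D k \<subseteq> D n" using assms(1) by (auto simp: n_def incseq_def)
  moreover have "oscillates e f (D n) m q b" by (rule oscillates_mono[OF k]) (use \<open>D k \<subseteq> D n\<close> in auto)
  ultimately have "oscillates e f (D n) (Suc m) a b" using pq by (simp only: oscillates.simps) blast
  then show ?case ..
qed simp

section \<open>One-sided limits along the dyadic numbers\<close>

definition dyadics_at :: "nat \<Rightarrow> real set" where
  "dyadics_at n = range (\<lambda>k::nat. real k / 2 ^ n)"

definition dyadics :: "real set" where
  "dyadics = (\<Union>n. dyadics_at n)"

lemma incseq_dyadics_at: "incseq dyadics_at"
proof (rule incseq_SucI, rule subsetI)
  fix n x assume "x \<in> dyadics_at n"
  then obtain k where "x = real k / 2 ^ n" by (auto simp: dyadics_at_def)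
  then have "x = real (2 * k) / 2 ^ Suc n" by simp
  then show "x \<in> dyadics_at (Suc n)" unfolding dyadics_at_def by blast
qed

text \<open>Each pair that differs by \<open>2 * e\<close> forces a move of size \<open>e\<close>,
  and the pairs do not overlap. The count starts at an arbitrary index \<open>i\<close> so that the
  induction can restart at the right end of a pair.\<close>

lemma oscillates_moves:
  assumes "0 < e" "oscillates (2 * e) f (dyadics_at n) m a (real j / 2 ^ n)" "real i / 2 ^ n \<le> a" "i \<le> j"
  shows "m + moves e (\<lambda>k. f (real k / 2 ^ n)) i \<le> moves e (\<lambda>k. f (real k / 2 ^ n)) j"
  using assms(2-)
proof (induction m arbitrary: a i)
  case (Suc m)
  let ?x = "\<lambda>k. f (real k / 2 ^ n)"
  from Suc.prems(1) obtain p q where pq: "p \<in> dyadics_at n" "q \<in> dyadics_at n" "a \<le> p" "p < q"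
      "q \<le> real j / 2 ^ n" "2 * e \<le> \<bar>f p - f q\<bar>" "oscillates (2 * e) f (dyadics_at n) m q (real j / 2 ^ n)"
    by auto
  obtain u v :: nat where uv: "p = real u / 2 ^ n" "q = real v / 2 ^ n" using pq(1,2) by (auto simp: dyadics_at_def)
  have le: "i \<le> u" "u \<le> v" "v \<le> j" using pq Suc.prems uv by (auto simp: field_simps)
  have "m + moves e ?x v \<le> moves e ?x j" using Suc.IH[OF pq(7) _ le(3)] uv by simp
  moreover have "Suc (moves e ?x u) \<le> moves e ?x v" using pq uv by (intro moves_less assms(1) le) simp
  moreover have "moves e ?x i \<le> moves e ?x u" by (intro moves_mono le)
  ultimately show ?case by simp
qed (simp add: moves_mono)

text \<open>In contrast to \<open>dyadic_ceiling\<close>, the value is strictly above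
  \<open>t\<close> even if \<open>t\<close> is on the grid, since a right limit must not see the
  value at \<open>t\<close>.\<close>

definition dyadic_above :: "nat \<Rightarrow> real \<Rightarrow> real" where
  "dyadic_above n t = real (Suc (nat \<lfloor>2 ^ n * t\<rfloor>)) / 2 ^ n"

lemma dyadic_above_in: "dyadic_above n t \<in> dyadics"
  unfolding dyadics_def dyadics_at_def dyadic_above_def by blast

lemma dyadic_above_gt: "t < dyadic_above n t"
proof -
  have "2 ^ n * t < real (Suc (nat \<lfloor>2 ^ n * t\<rfloor>))" by linarith
  then show ?thesis by (simp add: dyadic_above_def field_simps)
qed

lemma dyadic_above_le: "0 \<le> t \<Longrightarrow> dyadic_above n t \<le> t + 1 / 2 ^ n"
proof -
  assume "0 \<le> t"
  then have "0 \<le> 2 ^ n * t" by simp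
  then have "real (Suc (nat \<lfloor>2 ^ n * t\<rfloor>)) \<le> 2 ^ n * t + 1" by linarith
  then show ?thesis by (simp add: dyadic_above_def field_simps)
qed

lemma dyadic_above_tendsto: "0 \<le> t \<Longrightarrow> (\<lambda>n. dyadic_above n t) \<longlonglongrightarrow> t"
  by (intro tendsto_within_dyadic less_imp_le[OF dyadic_above_gt] dyadic_above_le)

definition right_of :: "real \<Rightarrow> real filter" where
  "right_of t = at t within (dyadics \<inter> {t<..})"

lemma eventually_right_of:
  "eventually P (right_of t) \<longleftrightarrow> (\<exists>d>0. \<forall>q\<in>dyadics. t < q \<and> q < t + d \<longrightarrow> P q)"
  unfolding right_of_def eventually_at by (rule ex_cong1) (auto simp: dist_real_def)

lemma filterlim_dyadic_above: "0 \<le> t \<Longrightarrow> filterlim (\<lambda>n. dyadic_above n t) (right_of t) sequentially"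
  unfolding right_of_def filterlim_at
  using dyadic_above_tendsto dyadic_above_in dyadic_above_gt by (auto intro: always_eventually simp: less_imp_neq[symmetric])

lemma right_of_neq_bot: "0 \<le> t \<Longrightarrow> right_of t \<noteq> bot"
  using filterlim_dyadic_above[of t] by (auto simp: filterlim_def filtermap_bot_iff bot_unique)

lemma cauchy_tendsto:
  fixes f :: "'b \<Rightarrow> real"
  assumes "\<And>e. 0 < e \<Longrightarrow> \<exists>P. eventually P G \<and> (\<forall>x y. P x \<and> P y \<longrightarrow> \<bar>f x - f y\<bar> < e)"
  shows "\<exists>l. (f \<longlongrightarrow> l) G"
proof (cases "G = bot")
  case False
  have "cauchy_filter (filtermap f G)"
    unfolding cauchy_filter_metric_filtermap using assms by (simp add: dist_real_def)
  moreover have "filtermap f G \<noteq> bot" using False by (simp add: filtermap_bot_iff)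
  ultimately have "\<exists>l\<in>UNIV. filtermap f G \<le> nhds l"
    using complete_UNIV[unfolded complete_uniform, rule_format, of "filtermap f G"] by simp
  then show ?thesis by (simp add: filterlim_def)
qed simp

text \<open>Horizons and sizes run through countable families, so that an almost sure statement for
  each of them gives almost sure regularity. The factor 2 is the one lost between oscillations and
  moves.\<close>

definition regular :: "(real \<Rightarrow> real) \<Rightarrow> bool" where
  "regular f \<longleftrightarrow> (\<forall>K j::nat. \<exists>m. \<not> oscillates (2 * (1 / Suc j)) f dyadics m 0 (real K))"

lemma regularD:
  assumes "regular f" "0 < e"
  obtains m where "\<not> oscillates e f dyadics m 0 b"
proof -
  obtain j :: nat where j: "1 / Suc j < e / 2" using nat_approx_posE[of "e / 2"] assms(2) by auto
  obtain K :: nat where K: "b \<le> real K" using real_arch_simple by blast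
  obtain m where "\<not> oscillates (2 * (1 / Suc j)) f dyadics m 0 (real K)"
    using assms(1) unfolding regular_def by blast
  then have "\<not> oscillates e f dyadics m 0 b"
    using oscillates_mono[of e f dyadics m 0 b "2 * (1 / Suc j)" dyadics 0 "real K"] j K by auto
  then show thesis by (rule that)
qed

lemma not_cauchy_pair:
  fixes f :: "real \<Rightarrow> real"
  assumes no: "\<not> (\<exists>P. eventually P G \<and> (\<forall>x y. P x \<and> P y \<longrightarrow> \<bar>f x - f y\<bar> < e))"
    and e: "0 < e" and Q: "eventually Q G"
  shows "\<exists>p q. Q p \<and> Q q \<and> p < q \<and> e \<le> \<bar>f p - f q\<bar>"
proof -
  have "\<not> (\<forall>x y. Q x \<and> Q y \<longrightarrow> \<bar>f x - f y\<bar> < e)" using no Q by auto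
  then obtain x y where xy: "Q x" "Q y" "e \<le> \<bar>f x - f y\<bar>" by (auto simp: not_less)
  then have "x < y \<or> y < x" using e by (cases "x = y") auto
  then show ?thesis using xy by (metis abs_minus_commute)
qed

text \<open>If the Cauchy criterion failed at \<open>t\<close>, every right neighbourhood of
  \<open>t\<close> would contain two dyadic points with values at distance \<open>e\<close>, and
  such pairs could be chained into an oscillation of any length.\<close>

lemma regular_right_limit:
  assumes f: "regular f" and t: "0 \<le> t"
  shows "\<exists>l. (f \<longlongrightarrow> l) (right_of t)"
proof (rule cauchy_tendsto, rule ccontr)
  fix e :: real assume e: "0 < e" and no: "\<not> (\<exists>P. eventually P (right_of t) \<and> (\<forall>x y. P x \<and> P y \<longrightarrow> \<bar>f x - f y\<bar> < e))"
  have pq: "\<exists>p q. (p \<in> dyadics \<and> t < p \<and> p < b) \<and> (q \<in> dyadics \<and> t < q \<and> q < b) \<and> p < q \<and> e \<le> \<bar>f p - f q\<bar>"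
    if "t < b" for b
    by (rule not_cauchy_pair[OF no e]) (use that in \<open>auto simp: eventually_right_of intro!: exI[of _ "b - t"]\<close>)
  \<comment> \<open>New pairs are put in front of the chain, between \<open>t\<close> and its left
    end \<open>a\<close>; for left limits they can be chosen in increasing order instead.\<close>
  have "\<exists>a>t. oscillates e f dyadics m a (t + 1)" for m
  proof (induction m)
    case 0 show ?case by (auto intro: exI[of _ "t + 1"])
  next
    case (Suc m)
    then obtain a where a: "t < a" "oscillates e f dyadics m a (t + 1)" by blast
    obtain p q where pq': "p \<in> dyadics" "q \<in> dyadics" "t < p" "p < q" "q < min a (t + 1)" "e \<le> \<bar>f p - f q\<bar>"
      using pq[of "min a (t + 1)"] a(1) by auto
    have "oscillates e f dyadics m q (t + 1)" by (rule oscillates_mono[OF a(2)]) (use pq' in auto)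
    then have "oscillates e f dyadics (Suc m) p (t + 1)"
      by (rule oscillates_SucI[rotated 6]) (use pq' in auto)
    then show ?case using pq'(3) by blast
  qed
  then have "oscillates e f dyadics m 0 (t + 1)" for m
    using oscillates_mono[OF _ order_refl subset_refl _ order_refl] t by (meson less_imp_le order_trans)
  then show False using regularD[OF f e] by metis
qed

lemma regular_left_limit:
  assumes f: "regular f" and t: "0 < t"
  shows "\<exists>l. (f \<longlongrightarrow> l) (at t within (dyadics \<inter> {..<t}))"
proof (rule cauchy_tendsto, rule ccontr)
  let ?F = "at t within (dyadics \<inter> {..<t})"
  fix e :: real assume e: "0 < e" and no: "\<not> (\<exists>P. eventually P ?F \<and> (\<forall>x y. P x \<and> P y \<longrightarrow> \<bar>f x - f y\<bar> < e))"
  have pq: "\<exists>p q. (p \<in> dyadics \<and> b < p \<and> p < t) \<and> (q \<in> dyadics \<and> b < q \<and> q < t) \<and> p < q \<and> e \<le> \<bar>f p - f q\<bar>"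
    if "b < t" for b
    by (rule not_cauchy_pair[OF no e])
      (use that in \<open>auto simp: eventually_at dist_real_def intro!: exI[of _ "t - b"]\<close>)
  have "oscillates e f dyadics m a t" if "a < t" for m a
    using that
  proof (induction m arbitrary: a)
    case (Suc m)
    obtain p q where pq': "p \<in> dyadics" "q \<in> dyadics" "a < p" "p < q" "q < t" "e \<le> \<bar>f p - f q\<bar>"
      using pq[OF Suc.prems] by auto
    then show ?case by (intro oscillates_SucI[of p _ q]) (auto intro: Suc.IH)
  qed simp
  then have "oscillates e f dyadics m 0 t" for m using t by blast
  then show False using regularD[OF f e] by metis
qed

definition right_limit :: "(real \<Rightarrow> real) \<Rightarrow> real \<Rightarrow> real" where
  "right_limit f t = Lim (right_of t) f"

lemma regular_tendsto_right_limit: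
  assumes "regular f" "0 \<le> t"
  shows "(f \<longlongrightarrow> right_limit f t) (right_of t)"
  using regular_right_limit[OF assms] right_of_neq_bot[OF assms(2)]
  by (auto simp: right_limit_def tendsto_Lim)

lemma right_limit_close:
  assumes "regular f" "0 \<le> u" "0 < d" "\<And>q. q \<in> dyadics \<Longrightarrow> u < q \<Longrightarrow> q < u + d \<Longrightarrow> \<bar>f q - c\<bar> \<le> e"
  shows "\<bar>right_limit f u - c\<bar> \<le> e"
proof -
  have "right_limit f u \<in> cball c e"
  proof (rule Lim_in_closed_set)
    show "eventually (\<lambda>q. f q \<in> cball c e) (right_of u)"
      unfolding eventually_right_of using assms(3,4) by (auto simp: dist_real_def abs_minus_commute)
  qed (use right_of_neq_bot regular_tendsto_right_limit assms in auto)
  then show ?thesis by (simp add: dist_real_def abs_minus_commute)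
qed

text \<open>A bound on \<open>f\<close> at the dyadic points of an open interval passes, as a weak
  inequality, to the right limits at all points of the interval. The bound \<open>e / 2\<close>
  makes it strict again.\<close>

lemma cadlag_right_limit:
  assumes f: "regular f"
  shows "cadlag (right_limit f)"
  unfolding cadlag_def
proof (intro conjI allI impI)
  fix t :: real assume t: "0 \<le> t"
  show "continuous (at_right t) (right_limit f)"
    unfolding continuous_within
  proof (rule tendstoI)
    fix e :: real assume e: "0 < e"
    have "eventually (\<lambda>q. dist (f q) (right_limit f t) < e / 2) (right_of t)"
      using regular_tendsto_right_limit[OF f t] e by (intro tendstoD) auto
    then obtain d where d: "0 < d" "\<And>q. q \<in> dyadics \<Longrightarrow> t < q \<Longrightarrow> q < t + d \<Longrightarrow> \<bar>f q - right_limit f t\<bar> \<le> e / 2"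
      unfolding eventually_right_of by (force simp: dist_real_def intro: less_imp_le)
    have "dist (right_limit f u) (right_limit f t) < e" if u: "t < u" "u < t + d" for u
    proof -
      have "\<bar>right_limit f u - right_limit f t\<bar> \<le> e / 2"
        by (rule right_limit_close[OF f, of _ "t + d - u"]) (use t u d in auto)
      then show ?thesis using e by (simp add: dist_real_def)
    qed
    then show "eventually (\<lambda>u. dist (right_limit f u) (right_limit f t) < e) (at_right t)"
      unfolding eventually_at_right_field using d(1) by (intro exI[of _ "t + d"]) auto
  qed
next
  fix t :: real assume t: "0 < t"
  obtain l where l: "(f \<longlongrightarrow> l) (at t within (dyadics \<inter> {..<t}))" using regular_left_limit[OF f t] by blast
  have "(right_limit f \<longlongrightarrow> l) (at_left t)"
  proof (rule tendstoI)
    fix e :: real assume e: "0 < e"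
    have "eventually (\<lambda>q. dist (f q) l < e / 2) (at t within (dyadics \<inter> {..<t}))"
      using l e by (intro tendstoD) auto
    then obtain d where d: "0 < d" "\<And>q. q \<in> dyadics \<Longrightarrow> q < t \<Longrightarrow> t - d < q \<Longrightarrow> \<bar>f q - l\<bar> \<le> e / 2"
      unfolding eventually_at by (force simp: dist_real_def intro: less_imp_le)
    have "dist (right_limit f u) l < e" if u: "max 0 (t - d) < u" "u < t" for u
    proof -
      have "\<bar>right_limit f u - l\<bar> \<le> e / 2"
        by (rule right_limit_close[OF f, of _ "t - u"]) (use t u d in auto)
      then show ?thesis using e by (simp add: dist_real_def)
    qed
    then show "eventually (\<lambda>u. dist (right_limit f u) l < e) (at_left t)"
      unfolding eventually_at_left_field using d(1) t by (intro exI[of _ "max 0 (t - d)"]) auto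
  qed
  then show "\<exists>l. (right_limit f \<longlongrightarrow> l) (at_left t)" ..
qed

context usual_filtered_prob_space
begin

text \<open>A version that is bounded everywhere and not only almost surely, so that the pathwise
  bounds on reference values hold without exceptional sets for each time.\<close>

definition clamped_cond_exp :: "('a \<Rightarrow> real) \<Rightarrow> real \<Rightarrow> 'a \<Rightarrow> real" where
  "clamped_cond_exp W t \<omega> = max (-1) (min 1 (real_cond_exp M (F t) W \<omega>))"

lemma abs_clamped_cond_exp: "\<bar>clamped_cond_exp W t \<omega>\<bar> \<le> 1"
  by (auto simp: clamped_cond_exp_def)

lemma clamped_cond_exp_measurable: "clamped_cond_exp W t \<in> borel_measurable (F t)"
  unfolding clamped_cond_exp_def by measurable

lemma AE_clamped_cond_exp:
  assumes W: "W \<in> borel_measurable M" "AE \<omega> in M. \<bar>W \<omega>\<bar> \<le> 1" and t: "0 \<le> t"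
  shows "AE \<omega> in M. clamped_cond_exp W t \<omega> = real_cond_exp M (F t) W \<omega>"
proof -
  have "AE \<omega> in M. \<bar>real_cond_exp M (F t) W \<omega>\<bar> \<le> 1" using cond_exp_bounded[OF t W] by simp
  then show ?thesis by eventually_elim (auto simp: clamped_cond_exp_def)
qed

lemma integral_clamped_cond_exp:
  assumes W: "W \<in> borel_measurable M" "AE \<omega> in M. \<bar>W \<omega>\<bar> \<le> 1" and t: "0 \<le> t"
    and U: "U \<in> borel_measurable (F t)" "\<And>\<omega>. \<omega> \<in> space M \<Longrightarrow> \<bar>U \<omega>\<bar> \<le> C"
  shows "(\<integral>\<omega>. U \<omega> * clamped_cond_exp W t \<omega> \<partial>M) = (\<integral>\<omega>. U \<omega> * W \<omega> \<partial>M)"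
    and "integrable M (\<lambda>\<omega>. U \<omega> * clamped_cond_exp W t \<omega>)"
proof -
  interpret sigma_finite_subalgebra M "F t" by (rule sigma_finite_subalgebra_F[OF t])
  have [measurable]: "U \<in> borel_measurable M" "clamped_cond_exp W t \<in> borel_measurable M"
    using U(1) clamped_cond_exp_measurable t by (auto intro: measurable_F_M)
  have "AE \<omega> in M. norm (U \<omega> * W \<omega>) \<le> C"
    using W(2) AE_space
  proof eventually_elim
    case (elim \<omega>)
    then show ?case using mult_mono[OF U(2)[OF elim(2)] elim(1)] U(2)[OF elim(2)] by (auto simp: abs_mult)
  qed
  then have "integrable M (\<lambda>\<omega>. U \<omega> * W \<omega>)"
    using W(1) by (intro integrable_const_bound[where B=C]) auto
  from real_cond_exp_intg(2)[OF this U(1) W(1)]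
  have "(\<integral>\<omega>. U \<omega> * real_cond_exp M (F t) W \<omega> \<partial>M) = (\<integral>\<omega>. U \<omega> * W \<omega> \<partial>M)" .
  moreover have "(\<integral>\<omega>. U \<omega> * clamped_cond_exp W t \<omega> \<partial>M) = (\<integral>\<omega>. U \<omega> * real_cond_exp M (F t) W \<omega> \<partial>M)"
    using AE_clamped_cond_exp[OF W t] by (intro integral_cong_AE) auto
  ultimately show "(\<integral>\<omega>. U \<omega> * clamped_cond_exp W t \<omega> \<partial>M) = (\<integral>\<omega>. U \<omega> * W \<omega> \<partial>M)" by simp
  show "integrable M (\<lambda>\<omega>. U \<omega> * clamped_cond_exp W t \<omega>)"
  proof (rule integrable_const_bound[where B=C])
    show "AE \<omega> in M. norm (U \<omega> * clamped_cond_exp W t \<omega>) \<le> C"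
      using AE_space
    proof eventually_elim
      case (elim \<omega>)
      then show ?case
        using mult_mono[OF U(2)[OF elim] abs_clamped_cond_exp[of W t \<omega>]] U(2)[OF elim] by (auto simp: abs_mult)
    qed
  qed measurable
qed

section \<open>Almost sure regularity of bounded martingales along the dyadics\<close>

lemma reference_measurable:
  assumes "\<And>i. i \<le> k \<Longrightarrow> X i \<in> borel_measurable N"
  shows "(\<lambda>\<omega>. reference e (\<lambda>i. X i \<omega>) k) \<in> borel_measurable N"
  using assms
proof (induction k)
  case (Suc k)
  then have [measurable]: "(\<lambda>\<omega>. reference e (\<lambda>i. X i \<omega>) k) \<in> borel_measurable N" "X (Suc k) \<in> borel_measurable N"
    by auto
  show ?case by (simp, measurable)
qed simp

lemma moves_measurable:
  assumes "\<And>i. X i \<in> borel_measurable N"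
  shows "(\<lambda>\<omega>. real (moves e (\<lambda>i. X i \<omega>) k)) \<in> borel_measurable N"
proof (induction k)
  case (Suc k)
  note [measurable] = Suc assms reference_measurable[of k X N e, OF assms]
  have "(\<lambda>\<omega>. real (moves e (\<lambda>i. X i \<omega>) k) + (if e \<le> \<bar>X (Suc k) \<omega> - reference e (\<lambda>i. X i \<omega>) k\<bar> then 1 else 0))
      \<in> borel_measurable N" by measurable
  moreover have "(\<lambda>\<omega>. real (moves e (\<lambda>i. X i \<omega>) k) + (if e \<le> \<bar>X (Suc k) \<omega> - reference e (\<lambda>i. X i \<omega>) k\<bar> then 1 else 0)) =
      (\<lambda>\<omega>. real (moves e (\<lambda>i. X i \<omega>) (Suc k)))" by auto
  ultimately show ?case by simp
qed simp

text \<open>The reference value \<open>R k\<close> is bounded by 1 and known at time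
  \<open>k / 2 ^ n\<close>, so each term of the sum in \<open>moves_bound\<close> has mean zero.
  What remains is a bound that depends neither on the mesh nor on the horizon.\<close>

lemma nn_integral_moves:
  assumes W: "W \<in> borel_measurable M" "AE \<omega> in M. \<bar>W \<omega>\<bar> \<le> 1" and e: "0 < e"
  shows "(\<integral>\<^sup>+\<omega>. ennreal (real (moves e (\<lambda>k. clamped_cond_exp W (real k / 2 ^ n) \<omega>) m)) \<partial>M) \<le> ennreal (1 / e\<^sup>2)"
proof -
  define X where "X k = clamped_cond_exp W (real k / 2 ^ n)" for k
  define R where "R k \<omega> = reference e (\<lambda>k. X k \<omega>) k" for k \<omega>
  have XF: "X k \<in> borel_measurable (F (real k / 2 ^ n))" for k unfolding X_def by (rule clamped_cond_exp_measurable)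
  have XM[measurable]: "X k \<in> borel_measurable M" for k by (rule measurable_F_M[OF XF]) simp
  have RF: "R k \<in> borel_measurable (F (real k / 2 ^ n))" for k
    unfolding R_def by (rule reference_measurable, rule measurable_F_mono[OF XF]) (auto simp: field_simps)
  have RM[measurable]: "R k \<in> borel_measurable M" for k by (rule measurable_F_M[OF RF]) simp
  have R1: "\<bar>R k \<omega>\<bar> \<le> 1" for k \<omega> unfolding R_def X_def by (intro abs_reference_le abs_clamped_cond_exp)
  have RF': "R k \<in> borel_measurable (F (real (Suc k) / 2 ^ n))" for k
    by (rule measurable_F_mono[OF RF]) (auto simp: field_simps)
  have int: "integrable M (\<lambda>\<omega>. R k \<omega> * X (Suc k) \<omega>)" "integrable M (\<lambda>\<omega>. R k \<omega> * X k \<omega>)" for k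
    using integral_clamped_cond_exp(2)[OF W _ RF'[of k] R1] integral_clamped_cond_exp(2)[OF W _ RF[of k] R1]
    by (simp_all add: X_def)
  have eq: "(\<integral>\<omega>. R k \<omega> * X (Suc k) \<omega> \<partial>M) = (\<integral>\<omega>. R k \<omega> * X k \<omega> \<partial>M)" for k
    unfolding X_def using integral_clamped_cond_exp(1)[OF W _ RF' R1] integral_clamped_cond_exp(1)[OF W _ RF R1]
    by simp
  have zero: "(\<integral>\<omega>. R k \<omega> * (X (Suc k) \<omega> - X k \<omega>) \<partial>M) = 0" "integrable M (\<lambda>\<omega>. R k \<omega> * (X (Suc k) \<omega> - X k \<omega>))" for k
    using int[of k] eq[of k] by (simp_all add: right_diff_distrib)
  have mm[measurable]: "(\<lambda>\<omega>. real (moves e (\<lambda>k. X k \<omega>) m)) \<in> borel_measurable M" by (rule moves_measurable) (rule XM)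
  have sq: "(X m \<omega>)\<^sup>2 \<le> 1" for \<omega> unfolding X_def using abs_clamped_cond_exp by (simp add: abs_square_le_1)
  have pw: "real (moves e (\<lambda>k. X k \<omega>) m) \<le> (1 - 2 * (\<Sum>k<m. R k \<omega> * (X (Suc k) \<omega> - X k \<omega>))) / e\<^sup>2" for \<omega>
    using moves_bound[of e "\<lambda>k. X k \<omega>" m] e sq[of \<omega>] by (simp add: R_def field_simps)
  have rhs: "integrable M (\<lambda>\<omega>. (1 - 2 * (\<Sum>k<m. R k \<omega> * (X (Suc k) \<omega> - X k \<omega>))) / e\<^sup>2)"
    using zero(2) by auto
  have "(\<integral>\<^sup>+\<omega>. ennreal (real (moves e (\<lambda>k. X k \<omega>) m)) \<partial>M) \<le>
      (\<integral>\<^sup>+\<omega>. ennreal ((1 - 2 * (\<Sum>k<m. R k \<omega> * (X (Suc k) \<omega> - X k \<omega>))) / e\<^sup>2) \<partial>M)"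
    using pw by (intro nn_integral_mono ennreal_leI)
  also have "\<dots> = ennreal (\<integral>\<omega>. (1 - 2 * (\<Sum>k<m. R k \<omega> * (X (Suc k) \<omega> - X k \<omega>))) / e\<^sup>2 \<partial>M)"
    using pw by (intro nn_integral_eq_integral rhs AE_I2) (meson of_nat_0_le_iff order_trans)
  also have "(\<integral>\<omega>. (1 - 2 * (\<Sum>k<m. R k \<omega> * (X (Suc k) \<omega> - X k \<omega>))) / e\<^sup>2 \<partial>M) = 1 / e\<^sup>2"
    using zero by (simp add: prob_space)
  finally show ?thesis by (simp add: X_def)
qed

text \<open>Fatou's lemma turns the bound uniform in the mesh into an almost surely finite
  \<open>liminf\<close> of the numbers of moves up to time \<open>K\<close>, whose grid index is
  \<open>K * 2 ^ n\<close>. An oscillation along the dyadics is present on all sufficiently fine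
  grids, so its length cannot exceed this \<open>liminf\<close>.\<close>

lemma AE_regular_cond_exp:
  assumes W: "W \<in> borel_measurable M" "AE \<omega> in M. \<bar>W \<omega>\<bar> \<le> 1"
  shows "AE \<omega> in M. regular (\<lambda>t. clamped_cond_exp W t \<omega>)"
  unfolding regular_def AE_all_countable
proof (intro allI)
  fix K j :: nat
  define e where "e = 1 / real (Suc j)"
  have e: "0 < e" by (simp add: e_def)
  define c where "c n \<omega> = ennreal (real (moves e (\<lambda>k. clamped_cond_exp W (real k / 2 ^ n) \<omega>) (K * 2 ^ n)))" for n \<omega>
  have X: "clamped_cond_exp W (real k / 2 ^ n) \<in> borel_measurable M" for k n
    by (rule measurable_F_M[OF clamped_cond_exp_measurable]) simp
  have c[measurable]: "c n \<in> borel_measurable M" for n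
    unfolding c_def by (rule measurable_compose[OF moves_measurable[OF X] measurable_ennreal])
  have "(\<integral>\<^sup>+\<omega>. liminf (\<lambda>n. c n \<omega>) \<partial>M) \<le> liminf (\<lambda>n. \<integral>\<^sup>+\<omega>. c n \<omega> \<partial>M)"
    by (rule nn_integral_liminf) measurable
  also have "\<dots> \<le> liminf (\<lambda>n::nat. ennreal (1 / e\<^sup>2))"
    using nn_integral_moves[OF W e] unfolding c_def by (intro Liminf_mono always_eventually allI)
  also have "\<dots> = ennreal (1 / e\<^sup>2)" by (simp add: Liminf_const)
  finally have "(\<integral>\<^sup>+\<omega>. liminf (\<lambda>n. c n \<omega>) \<partial>M) \<noteq> \<infinity>" by (auto simp: top_unique)
  then have "AE \<omega> in M. liminf (\<lambda>n. c n \<omega>) \<noteq> \<infinity>" by (intro nn_integral_PInf_AE) measurable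
  then show "AE \<omega> in M. \<exists>m. \<not> oscillates (2 * (1 / Suc j)) (\<lambda>t. clamped_cond_exp W t \<omega>) dyadics m 0 (real K)"
  proof eventually_elim
    case (elim \<omega>)
    let ?f = "\<lambda>t. clamped_cond_exp W t \<omega>"
    obtain r where r: "0 \<le> r" "liminf (\<lambda>n. c n \<omega>) = ennreal r" using elim by (cases "liminf (\<lambda>n. c n \<omega>)") auto
    obtain m :: nat where m: "r < real m" using reals_Archimedean2 by blast
    have "\<not> oscillates (2 * e) ?f dyadics m 0 (real K)"
    proof
      assume "oscillates (2 * e) ?f dyadics m 0 (real K)"
      then obtain n0 where n0: "oscillates (2 * e) ?f (dyadics_at n0) m 0 (real K)"
        unfolding dyadics_def using oscillates_UN[OF incseq_dyadics_at] by blast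
      have "ennreal (real m) \<le> c n \<omega>" if "n0 \<le> n" for n
      proof -
        have "dyadics_at n0 \<subseteq> dyadics_at n" using incseq_dyadics_at that by (simp add: incseq_def)
        then have "oscillates (2 * e) ?f (dyadics_at n) m 0 (real K)"
          by (intro oscillates_mono[OF n0]) auto
        then have "m + moves e (\<lambda>k. ?f (real k / 2 ^ n)) 0 \<le> moves e (\<lambda>k. ?f (real k / 2 ^ n)) (K * 2 ^ n)"
          by (intro oscillates_moves[OF e, where a=0]) auto
        then show ?thesis unfolding c_def by (intro ennreal_leI) simp
      qed
      then have "ennreal (real m) \<le> liminf (\<lambda>n. c n \<omega>)"
        by (intro Liminf_bounded) (auto simp: eventually_sequentially)
      then show False using r m by simp
    qed
    then show ?case by (auto simp: e_def)
  qed
qed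

text \<open>The version consists of right limits along the dyadics, put to 0 on the null set of
  irregular paths, which belongs to every \<open>F t\<close>. A right limit uses times after
  \<open>t\<close>; it is nevertheless measurable for \<open>F t\<close> because the filtration is
  right continuous.\<close>

theorem cadlag_version_cond_exp:
  assumes W: "W \<in> borel_measurable M" "AE \<omega> in M. \<bar>W \<omega>\<bar> \<le> 1"
  obtains N where "cadlag_martingale M F N" "\<And>t. 0 \<le> t \<Longrightarrow> AE \<omega> in M. N t \<omega> = real_cond_exp M (F t) W \<omega>"
proof -
  define Y where "Y = clamped_cond_exp W"
  define \<Omega>0 where "\<Omega>0 = {\<omega>\<in>space M. regular (\<lambda>t. Y t \<omega>)}"
  define N where "N t \<omega> = (if \<omega> \<in> \<Omega>0 then right_limit (\<lambda>t. Y t \<omega>) t else 0)" for t \<omega>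
  have AE_reg: "AE \<omega> in M. regular (\<lambda>t. Y t \<omega>)" unfolding Y_def by (rule AE_regular_cond_exp[OF W])
  then have "space M - \<Omega>0 \<in> null_sets M"
    unfolding AE_iff_null_sets \<Omega>0_def by (simp add: set_diff_eq cong: conj_cong)
  then have "space M - \<Omega>0 \<in> sets (F t)" if "0 \<le> t" for t using null_sets_in_F that by blast
  then have \<Omega>0F: "\<Omega>0 \<in> sets (F t)" if "0 \<le> t" for t
    using sets.compl_sets[of "space M - \<Omega>0" "F t"] that by (simp add: space_F double_diff \<Omega>0_def)
  have lim: "(\<lambda>n. Y (dyadic_above n t) \<omega>) \<longlonglongrightarrow> N t \<omega>" if "0 \<le> t" "\<omega> \<in> \<Omega>0" for t \<omega>
    using filterlim_compose[OF regular_tendsto_right_limit filterlim_dyadic_above[OF that(1)], of "\<lambda>t. Y t \<omega>"] that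
    by (simp add: N_def \<Omega>0_def)
  have YM: "Y t \<in> borel_measurable M" if "0 \<le> t" for t
    unfolding Y_def using that by (rule measurable_F_M[OF clamped_cond_exp_measurable])
  have NF: "N t \<in> borel_measurable (F t)" if t: "0 \<le> t" for t
  proof (rule measurable_F_right[OF t])
    fix u assume u: "t < u"
    have "eventually (\<lambda>n. dyadic_above n t < u) sequentially"
      using dyadic_above_tendsto[OF t] u by (rule order_tendstoD)
    then obtain n0 where n0: "\<And>n. n0 \<le> n \<Longrightarrow> dyadic_above n t < u" by (auto simp: eventually_sequentially)
    show "N t \<in> borel_measurable (F u)"
    proof (rule borel_measurable_LIMSEQ_real)
      show "(\<lambda>\<omega>. if \<omega> \<in> \<Omega>0 then Y (dyadic_above (n + n0) t) \<omega> else 0) \<in> borel_measurable (F u)" for n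
      proof -
        have "Y (dyadic_above (n + n0) t) \<in> borel_measurable (F u)"
          unfolding Y_def using n0[of "n + n0"] dyadic_above_gt[of t "n + n0"] t
          by (intro measurable_F_mono[OF clamped_cond_exp_measurable]) auto
        then show ?thesis using \<Omega>0F[of u] t u by (intro measurable_If_set) auto
      qed
      show "(\<lambda>n. if \<omega> \<in> \<Omega>0 then Y (dyadic_above (n + n0) t) \<omega> else 0) \<longlonglongrightarrow> N t \<omega>" for \<omega>
        using LIMSEQ_ignore_initial_segment[OF lim[OF t], of \<omega> n0] by (simp add: N_def)
    qed
  qed
  have NM[measurable]: "N t \<in> borel_measurable M" if "0 \<le> t" for t using NF[OF that] that by (rule measurable_F_M)
  have N_int: "(\<integral>\<omega>. indicator A \<omega> * N t \<omega> \<partial>M) = (\<integral>\<omega>. indicator A \<omega> * W \<omega> \<partial>M)" "integrable M (N t)"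
    if t: "0 \<le> t" and A: "A \<in> sets (F t)" for t A
  proof -
    have [measurable]: "A \<in> sets M" "N t \<in> borel_measurable M" using A t sets_F_subset NM by auto
    have YM'[measurable]: "Y (dyadic_above n t) \<in> borel_measurable M" for n
      by (rule YM) (use dyadic_above_gt[of t n] t in auto)
    have lim_AE: "AE \<omega> in M. (\<lambda>n. Y (dyadic_above n t) \<omega>) \<longlonglongrightarrow> N t \<omega>"
      using AE_reg AE_space by eventually_elim (auto intro!: lim[OF t] simp: \<Omega>0_def)
    have Y1: "AE \<omega> in M. norm (Y (dyadic_above n t) \<omega>) \<le> 1" for n
      by (simp add: Y_def abs_clamped_cond_exp)
    have w: "integrable M (\<lambda>_. 1::real)" by simp
    show "integrable M (N t)"
      by (rule integrable_dominated_convergence[OF _ _ w lim_AE Y1]) measurable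
    have "(\<lambda>n. \<integral>\<omega>. indicator A \<omega> * Y (dyadic_above n t) \<omega> \<partial>M) \<longlonglongrightarrow> (\<integral>\<omega>. indicator A \<omega> * N t \<omega> \<partial>M)"
    proof (rule integral_dominated_convergence[OF _ _ w])
      show "AE \<omega> in M. (\<lambda>n. indicator A \<omega> * Y (dyadic_above n t) \<omega>) \<longlonglongrightarrow> indicator A \<omega> * N t \<omega>"
        using lim_AE by eventually_elim (rule tendsto_mult_left)
      show "AE \<omega> in M. norm (indicator A \<omega> * Y (dyadic_above n t) \<omega>) \<le> 1" for n
        using Y1[of n] by eventually_elim (auto simp: abs_mult split: split_indicator)
    qed measurable
    \<comment> \<open>The event \<open>A\<close> also belongs to the sigma-algebra at each later
      time, so these integrals are constant in \<open>n\<close> and determine the integral of the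
      limit.\<close>
    moreover have "(\<integral>\<omega>. indicator A \<omega> * Y (dyadic_above n t) \<omega> \<partial>M) = (\<integral>\<omega>. indicator A \<omega> * W \<omega> \<partial>M)" for n
    proof -
      have "A \<in> sets (F (dyadic_above n t))" using A t dyadic_above_gt[of t n] by (auto intro: sets_F_mono')
      then show ?thesis unfolding Y_def using t dyadic_above_gt[of t n]
        by (intro integral_clamped_cond_exp(1)[OF W, where C=1]) (auto split: split_indicator)
    qed
    ultimately show "(\<integral>\<omega>. indicator A \<omega> * N t \<omega> \<partial>M) = (\<integral>\<omega>. indicator A \<omega> * W \<omega> \<partial>M)"
      by (simp add: LIMSEQ_const_iff)
  qed
  have W_int: "integrable M W" by (rule integrable_const_bound[where B=1]) (use W in auto)
  have N_ce: "AE \<omega> in M. real_cond_exp M (F s) U \<omega> = N s \<omega>"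
    if s: "0 \<le> s" and U: "integrable M U" "\<And>A. A \<in> sets (F s) \<Longrightarrow> (\<integral>\<omega>. indicator A \<omega> * U \<omega> \<partial>M) = (\<integral>\<omega>. indicator A \<omega> * W \<omega> \<partial>M)" for s U
  proof -
    interpret sigma_finite_subalgebra M "F s" by (rule sigma_finite_subalgebra_F[OF s])
    show ?thesis
      by (rule real_cond_exp_charact[OF _ U(1) N_int(2)[OF s sets.top] NF[OF s]])
        (simp add: set_lebesgue_integral_def U(2) N_int(1)[OF s])
  qed
  show thesis
  proof (rule that)
    show "AE \<omega> in M. N t \<omega> = real_cond_exp M (F t) W \<omega>" if "0 \<le> t" for t
      using N_ce[OF that W_int] by (auto simp: eq_commute)
    show "cadlag_martingale M F N"
      unfolding cadlag_martingale_def
    proof (intro conjI allI impI ballI)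
      show "adapted F N" using NF by (simp add: adapted_def)
      show "cadlag (\<lambda>t. N t \<omega>)" for \<omega>
      proof (cases "\<omega> \<in> \<Omega>0")
        case True
        then have "cadlag (right_limit (\<lambda>t. Y t \<omega>))" unfolding \<Omega>0_def by (intro cadlag_right_limit) auto
        moreover have "(\<lambda>t. N t \<omega>) = right_limit (\<lambda>t. Y t \<omega>)" using True by (simp add: N_def fun_eq_iff)
        ultimately show ?thesis by simp
      qed (auto simp: N_def cadlag_def)
      show "integrable M (N t)" if "0 \<le> t" for t using N_int(2)[OF that sets.top] .
      show "AE \<omega> in M. real_cond_exp M (F s) (N t) \<omega> = N s \<omega>" if st: "0 \<le> s" "s \<le> t" for s t
      proof (rule N_ce[OF st(1)])
        have t: "0 \<le> t" using st by simp
        show "integrable M (N t)" using N_int(2)[OF t sets.top] .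
        show "(\<integral>\<omega>. indicator A \<omega> * N t \<omega> \<partial>M) = (\<integral>\<omega>. indicator A \<omega> * W \<omega> \<partial>M)" if "A \<in> sets (F s)" for A
          by (rule N_int(1)[OF t sets_F_mono'[OF that st]])
      qed
    qed
  qed
qed

end

section \<open>Predictability of stopping times\<close>

lemma (in complete_measure) measurable_AE_LIMSEQ:
  fixes f :: "nat \<Rightarrow> 'a \<Rightarrow> real"
  assumes f: "\<And>n. f n \<in> borel_measurable M" and lim: "AE \<omega> in M. (\<lambda>n. f n \<omega>) \<longlonglongrightarrow> g \<omega>"
  shows "g \<in> borel_measurable M"
proof (rule measurable_AE_cong)
  show "(\<lambda>\<omega>. lim (\<lambda>n. f n \<omega>)) \<in> borel_measurable M" by (rule borel_measurable_lim_metric[OF f])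
  show "AE \<omega> in M. lim (\<lambda>n. f n \<omega>) = g \<omega>" using lim by eventually_elim (rule limI)
qed simp

definition left_limit :: "(real \<Rightarrow> real) \<Rightarrow> real \<Rightarrow> real" where
  "left_limit f t = Lim (at_left t) f"

lemma cadlag_left_limit: "cadlag f \<Longrightarrow> 0 < t \<Longrightarrow> (f \<longlongrightarrow> left_limit f t) (at_left t)"
  unfolding left_limit_def cadlag_def using tendsto_Lim trivial_limit_at_left_real by metis

lemma cadlag_left_limit_seq:
  assumes "cadlag f" "0 < t" "s \<longlonglongrightarrow> t" "\<And>n. s n < t"
  shows "(\<lambda>n. f (s n)) \<longlonglongrightarrow> left_limit f t"
proof (rule filterlim_compose[OF cadlag_left_limit[OF assms(1,2)]])
  show "filterlim s (at_left t) sequentially"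
    unfolding filterlim_at using assms(3,4) by (auto intro!: always_eventually simp: less_imp_neq)
qed

lemma cadlag_continuous_on:
  assumes f: "cadlag f" and eq: "\<And>t. 0 < t \<Longrightarrow> f t = left_limit f t"
  shows "continuous_on {0..} f"
  unfolding continuous_on_eq_continuous_within
proof
  fix t :: real assume t: "t \<in> {0..}"
  show "continuous (at t within {0..}) f"
  proof (cases "t = 0")
    case True
    have "{0..} - {0} = {0<..} - {0::real}" by auto
    then have "at 0 within {0..} = at_right (0::real)" by (simp add: at_within_def)
    then show ?thesis using cadlag_right_continuous[OF f] True by simp
  next
    case False
    then have "0 < t" using t by simp
    then have "continuous (at_left t) f"
      unfolding continuous_within using cadlag_left_limit[OF f] eq by simp
    moreover have "continuous (at_right t) f" using cadlag_right_continuous[OF f] t by simp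
    ultimately have "continuous (at t) f" by (simp add: continuous_at_split)
    then show ?thesis by (rule continuous_at_imp_continuous_at_within)
  qed
qed

text \<open>Just after \<open>t\<close> all values are within \<open>e / 3\<close> of
  \<open>f t\<close>, hence so are the left limits. Jumps of size \<open>e\<close> therefore do not
  accumulate at \<open>t\<close> from the right, and the debut of a set of such jumps is
  attained.\<close>

lemma cadlag_no_jump_right:
  assumes f: "cadlag f" and t: "0 \<le> t" and e: "0 < e"
  shows "\<exists>d>0. \<forall>s. t < s \<and> s < t + d \<longrightarrow> \<bar>f s - left_limit f s\<bar> < e"
proof -
  have "eventually (\<lambda>s. dist (f s) (f t) < e / 3) (at_right t)"
    using cadlag_right_continuous[OF f t] e unfolding continuous_within by (intro tendstoD) auto
  then obtain b where b: "t < b" "\<And>s. t < s \<Longrightarrow> s < b \<Longrightarrow> \<bar>f s - f t\<bar> < e / 3"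
    unfolding eventually_at_right_field by (auto simp: dist_real_def)
  have "\<bar>f s - left_limit f s\<bar> < e" if s: "t < s" "s < b" for s
  proof -
    have "left_limit f s \<in> cball (f t) (e / 3)"
    proof (rule Lim_in_closed_set[OF closed_cball _ _ cadlag_left_limit[OF f]])
      show "eventually (\<lambda>x. f x \<in> cball (f t) (e / 3)) (at_left s)"
        unfolding eventually_at_left_field
      proof (intro exI[of _ t] conjI allI impI)
        fix y assume "t < y" "y < s"
        then show "f y \<in> cball (f t) (e / 3)"
          using b(2)[of y] s by (simp add: dist_real_def abs_minus_commute)
      qed (use s in auto)
    qed (use s t in auto)
    then have "\<bar>left_limit f s - f t\<bar> \<le> e / 3" by (simp add: dist_real_def abs_minus_commute)
    then show ?thesis using b(2)[OF s] e by linarith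
  qed
  then show ?thesis using b(1) by (intro exI[of _ "b - t"]) auto
qed

context usual_filtered_prob_space
begin

text \<open>The predicate may depend on the horizon \<open>u\<close> and has to describe
  \<open>G\<close> only up to \<open>u\<close>. It is applied with processes frozen at time
  \<open>u\<close>, which are jointly measurable for \<open>F u\<close>.\<close>

lemma progressiveI:
  assumes "\<And>u. 0 \<le> u \<Longrightarrow> Measurable.pred (borel \<Otimes>\<^sub>M F u) (Q u)"
    and "\<And>u s \<omega>. 0 \<le> s \<Longrightarrow> s \<le> u \<Longrightarrow> \<omega> \<in> space M \<Longrightarrow> (s, \<omega>) \<in> G \<longleftrightarrow> Q u (s, \<omega>)"
  shows "progressive M F G"
  unfolding progressive_def
proof (intro allI impI)
  fix u :: real assume u: "0 \<le> u"
  have Q: "{x \<in> space (borel \<Otimes>\<^sub>M F u). Q u x} \<in> sets (borel \<Otimes>\<^sub>M F u)"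
    using assms(1)[OF u] by (simp add: pred_def)
  have "{0..u} \<times> space (F u) \<in> sets (borel \<Otimes>\<^sub>M F u)" by (intro pair_measureI) auto
  then have "({0..u} \<times> space (F u)) \<inter> {x \<in> space (borel \<Otimes>\<^sub>M F u). Q u x} \<in> sets (borel \<Otimes>\<^sub>M F u)"
    using Q by (rule sets.Int)
  also have "({0..u} \<times> space (F u)) \<inter> {x \<in> space (borel \<Otimes>\<^sub>M F u). Q u x} = ({0..u} \<times> space M) \<inter> G"
    using assms(2)[of _ u] u by (auto simp: space_pair_measure space_F)
  finally show "({0..u} \<times> space M) \<inter> G \<in> sets (borel \<Otimes>\<^sub>M F u)" .
qed

section \<open>Operations on stopping times and their measurability\<close>

lemma ext_stopping_time_const: "ext_stopping_time F (\<lambda>_. c)"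
  unfolding ext_stopping_time_def by simp

lemma ext_stopping_time_SUP:
  assumes "\<And>n::nat. ext_stopping_time F (T n)"
  shows "ext_stopping_time F (\<lambda>\<omega>. SUP n. T n \<omega>)"
  unfolding ext_stopping_time_iff
proof (intro allI impI)
  fix t :: real assume t: "0 \<le> t"
  have "{\<omega>\<in>space M. (SUP n. T n \<omega>) \<le> ennreal t} = (\<Inter>n. {\<omega>\<in>space M. T n \<omega> \<le> ennreal t})"
    by (auto simp: SUP_le_iff)
  moreover have "{\<omega>\<in>space M. T n \<omega> \<le> ennreal t} \<in> sets (F t)" for n
    using assms t unfolding ext_stopping_time_iff by blast
  ultimately show "{\<omega>\<in>space M. (SUP n. T n \<omega>) \<le> ennreal t} \<in> sets (F t)" by auto
qed

lemma ext_stopping_time_measurable: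
  assumes T: "ext_stopping_time F T"
  shows "T \<in> borel_measurable M"
proof (rule borel_measurableI_le)
  fix y :: ennreal
  show "{\<omega>\<in>space M. T \<omega> \<le> y} \<in> sets M"
  proof (cases y)
    case (real r)
    then have "{\<omega>\<in>space M. T \<omega> \<le> y} \<in> sets (F r)" using T by (simp add: ext_stopping_time_iff)
    then show ?thesis by (rule sets_F_subset[rotated]) (use real in simp)
  qed auto
qed

lemma ext_stopping_time_min_measurable:
  assumes T: "ext_stopping_time F T" and t: "0 \<le> t"
  shows "(\<lambda>\<omega>. min (T \<omega>) (ennreal t)) \<in> borel_measurable (F t)"
proof (rule borel_measurableI_le)
  fix y :: ennreal
  show "{\<omega>\<in>space (F t). min (T \<omega>) (ennreal t) \<le> y} \<in> sets (F t)"
  proof (cases "ennreal t \<le> y")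
    case True
    then have "{\<omega>\<in>space (F t). min (T \<omega>) (ennreal t) \<le> y} = space (F t)" by (auto simp: min_le_iff_disj)
    then show ?thesis by simp
  next
    case False
    then obtain r where r: "y = ennreal r" "0 \<le> r" "r \<le> t" by (cases y) auto
    have "{\<omega>\<in>space (F t). min (T \<omega>) (ennreal t) \<le> y} = {\<omega>\<in>space M. T \<omega> \<le> ennreal r}"
      using False r t by (auto simp: min_le_iff_disj space_F)
    moreover have "{\<omega>\<in>space M. T \<omega> \<le> ennreal r} \<in> sets (F t)"
      using T r by (intro sets_F_mono'[OF _ r(2,3)]) (simp add: ext_stopping_time_iff)
    ultimately show ?thesis by simp
  qed
qed

text \<open>The stopping time \<open>T\<close> is measured through the bounded variable \<open>exp (- T)\<close>, where
  \<open>exp (- \<infinity>) = 0\<close>.\<close>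

definition discount :: "ennreal \<Rightarrow> real" where
  "discount x = (if x = \<infinity> then 0 else exp (- enn2real x))"

lemma discount_measurable[measurable]: "discount \<in> borel_measurable borel"
  unfolding discount_def by measurable

lemma discount_range: "0 \<le> discount x" "discount x \<le> 1"
  by (auto simp: discount_def)

lemma discount_ennreal[simp]: "0 \<le> t \<Longrightarrow> discount (ennreal t) = exp (- t)"
  by (simp add: discount_def)

text \<open>Once \<open>T\<close> has occurred by time \<open>t\<close>, the value
  \<open>exp (- T)\<close> is known at \<open>t\<close>, so the martingale equals it. The identity
  holds almost surely at all dyadic times after \<open>T\<close> simultaneously and reaches
  \<open>T\<close> by right continuity.\<close>

lemma martingale_discount_at:
  assumes T: "ext_stopping_time F T" and cad: "\<And>\<omega>. \<omega> \<in> space M \<Longrightarrow> cadlag (\<lambda>t. N t \<omega>)"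
    and N: "\<And>t. 0 \<le> t \<Longrightarrow> AE \<omega> in M. N t \<omega> = real_cond_exp M (F t) (\<lambda>\<omega>. discount (T \<omega>)) \<omega>"
  shows "AE \<omega> in M. T \<omega> < \<infinity> \<longrightarrow> N (enn2real (T \<omega>)) \<omega> = discount (T \<omega>)"
proof -
  note [measurable] = ext_stopping_time_measurable[OF T]
  have grid: "AE \<omega> in M. T \<omega> \<le> ennreal t \<longrightarrow> N t \<omega> = discount (T \<omega>)" if t: "0 \<le> t" for t
  proof -
    interpret sigma_finite_subalgebra M "F t" by (rule sigma_finite_subalgebra_F[OF t])
    define A where "A = {\<omega>\<in>space M. T \<omega> \<le> ennreal t}"
    have A: "A \<in> sets (F t)" unfolding A_def using T t unfolding ext_stopping_time_iff by simp
    have [measurable]: "A \<in> sets M" using A t sets_F_subset by simp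
    have eq: "indicator A \<omega> * discount (T \<omega>) = indicator A \<omega> * discount (min (T \<omega>) (ennreal t))" for \<omega>
      by (auto simp: A_def min_def split: split_indicator)
    have "(\<lambda>\<omega>. discount (min (T \<omega>) (ennreal t))) \<in> borel_measurable (F t)"
      by (rule measurable_compose[OF ext_stopping_time_min_measurable[OF T t] discount_measurable])
    then have m: "(\<lambda>\<omega>. indicator A \<omega> * discount (T \<omega>)) \<in> borel_measurable (F t)"
      unfolding eq using A by (intro borel_measurable_times borel_measurable_indicator)
    have int: "integrable M (\<lambda>\<omega>. indicator A \<omega> * discount (T \<omega>))"
      by (rule integrable_const_bound[where B=1]) (auto simp: discount_range split: split_indicator)
    have "AE \<omega> in M. real_cond_exp M (F t) (\<lambda>\<omega>. indicator A \<omega> * discount (T \<omega>)) \<omega> =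
        indicator A \<omega> * real_cond_exp M (F t) (\<lambda>\<omega>. discount (T \<omega>)) \<omega>"
      using A int by (intro real_cond_exp_mult) auto
    with real_cond_exp_F_meas[OF int m] N[OF t] AE_space show ?thesis
      by eventually_elim (auto simp: A_def)
  qed
  have "AE \<omega> in M. \<forall>n i::nat. T \<omega> \<le> ennreal (real i / 2 ^ n) \<longrightarrow> N (real i / 2 ^ n) \<omega> = discount (T \<omega>)"
    unfolding AE_all_countable using grid by simp
  then show ?thesis
    using AE_space
  proof eventually_elim
    case (elim \<omega>)
    show ?case
    proof
      assume "T \<omega> < \<infinity>"
      then obtain t where t: "T \<omega> = ennreal t" "0 \<le> t" by (cases "T \<omega>") auto
      have "N (dyadic_ceiling n t) \<omega> = discount (T \<omega>)" for n
      proof -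
        have "T \<omega> \<le> ennreal (dyadic_ceiling n t)" by (simp add: t dyadic_ceiling_ge ennreal_leI)
        then show ?thesis using elim(1) unfolding dyadic_ceiling_def by blast
      qed
      moreover have "(\<lambda>n. N (dyadic_ceiling n t) \<omega>) \<longlonglongrightarrow> N t \<omega>"
        using cadlag_dyadic_ceiling[OF cad t(2)] elim by simp
      ultimately show "N (enn2real (T \<omega>)) \<omega> = discount (T \<omega>)" using t by (simp add: LIMSEQ_const_iff)
    qed
  qed
qed

text \<open>If all martingales are continuous then every stopping time is predictable: it is announced by
  the times \<open>S n\<close> at which \<open>exp (- t)\<close> comes within \<open>1 / (n + 1)\<close> of \<open>E[exp (- T) | F\<^sub>t]\<close>.\<close>

lemma announcing_sequence:
  assumes cont: "\<And>X. cadlag_martingale M F X \<Longrightarrow> AE \<omega> in M. continuous_on {0..} (\<lambda>t. X t \<omega>)"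
    and T: "ext_stopping_time F T" and T_pos: "\<And>\<omega>. \<omega> \<in> space M \<Longrightarrow> 0 < T \<omega>"
  shows "\<exists>S. (\<forall>n. ext_stopping_time F (S n)) \<and>
    (AE \<omega> in M. (\<lambda>n. S n \<omega>) \<longlonglongrightarrow> T \<omega> \<and> (\<forall>n. T \<omega> < \<infinity> \<longrightarrow> S n \<omega> < T \<omega>))"
proof -
  note [measurable] = ext_stopping_time_measurable[OF T]
  have W: "(\<lambda>\<omega>. discount (T \<omega>)) \<in> borel_measurable M" "AE \<omega> in M. \<bar>discount (T \<omega>)\<bar> \<le> 1"
    by (auto simp: discount_range)
  obtain N where N: "cadlag_martingale M F N"
      "\<And>t. 0 \<le> t \<Longrightarrow> AE \<omega> in M. N t \<omega> = real_cond_exp M (F t) (\<lambda>\<omega>. discount (T \<omega>)) \<omega>"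
    using cadlag_version_cond_exp[OF W] by blast
  have N_ad: "adapted F N" and N_cad: "\<And>\<omega>. \<omega> \<in> space M \<Longrightarrow> cadlag (\<lambda>t. N t \<omega>)"
    using N(1) by (auto simp: cadlag_martingale_def)
  define G where "G n = {(t, \<omega>). exp (- t) - N t \<omega> \<le> 1 / Suc n}" for n
  define S where "S n = debut (G n)" for n
  have "progressive M F (G n)" for n
  proof (rule progressiveI)
    fix u :: real assume "0 \<le> u"
    from progressive_process[OF N_ad N_cad this]
    have [measurable]: "(\<lambda>x. N (max 0 (min (fst x) u)) (snd x)) \<in> borel_measurable (borel \<Otimes>\<^sub>M F u)"
      by (simp add: case_prod_beta)
    show "Measurable.pred (borel \<Otimes>\<^sub>M F u)
        (\<lambda>x. exp (- fst x) - N (max 0 (min (fst x) u)) (snd x) \<le> 1 / Suc n)" by measurable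
  qed (auto simp: G_def)
  then have S_st: "ext_stopping_time F (S n)" for n unfolding S_def by (rule ext_stopping_time_debut)
  define S' where "S' \<omega> = (SUP n. S n \<omega>)" for \<omega>
  have S'_st: "ext_stopping_time F S'" unfolding S'_def by (rule ext_stopping_time_SUP[OF S_st])
  note [measurable] = ext_stopping_time_measurable[OF S'_st]
  have S_inc: "S n \<omega> \<le> S m \<omega>" if "n \<le> m" for n m \<omega>
  proof -
    have "1 / real (Suc m) \<le> 1 / real (Suc n)" using that by (intro divide_left_mono) auto
    then have "G m \<subseteq> G n" unfolding G_def by auto
    then show ?thesis unfolding S_def debut_def by (intro INF_superset_mono) auto
  qed
  have S_lim: "(\<lambda>n. S n \<omega>) \<longlonglongrightarrow> S' \<omega>" for \<omega>
    unfolding S'_def by (rule LIMSEQ_SUP) (auto simp: incseq_def S_inc)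
  have S_at: "exp (- s) - N s \<omega> \<le> 1 / Suc n" if "S n \<omega> = ennreal s" "0 \<le> s" "\<omega> \<in> space M" for n s \<omega>
  proof -
    have "debut (G n) \<omega> < \<infinity>" using that by (simp add: S_def)
    from debut_finite[OF this] obtain t where "0 \<le> t \<and> debut (G n) \<omega> = ennreal t \<and>
      (\<forall>e>0. \<exists>s\<ge>t. s < t + e \<and> (s, \<omega>) \<in> G n)" ..
    then have t: "0 \<le> t" "debut (G n) \<omega> = ennreal t" "\<forall>e>0. \<exists>s\<ge>t. s < t + e \<and> (s, \<omega>) \<in> G n" by simp_all
    have "t = s" using t(1,2) that by (simp add: S_def)
    have "continuous (at_right s) (\<lambda>t. exp (- t) - N t \<omega>)"
      using cadlag_right_continuous[OF N_cad[OF that(3)] that(2)] by (intro continuous_intros)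
    then show ?thesis by (rule right_continuous_le) (use t(3) \<open>t = s\<close> in \<open>simp add: G_def\<close>)
  qed
  have N_T: "AE \<omega> in M. T \<omega> < \<infinity> \<longrightarrow> N (enn2real (T \<omega>)) \<omega> = discount (T \<omega>)"
    by (rule martingale_discount_at[OF T N_cad N(2)])
  \<comment> \<open>Continuity of \<open>N\<close> acts twice. At \<open>T\<close>, where
    \<open>N\<close> equals \<open>exp (- T)\<close>, it makes \<open>exp (- t) - N t\<close> small
    already before \<open>T\<close>, so every level \<open>1 / Suc n\<close> is met strictly before
    \<open>T\<close>. At \<open>S'\<close> it lets the bounds valid at the times \<open>S n\<close>
    pass to the limit.\<close>
  have below: "AE \<omega> in M. (T \<omega> < \<infinity> \<longrightarrow> (\<forall>n. S n \<omega> < T \<omega>)) \<and> (S' \<omega> < \<infinity> \<longrightarrow> discount (S' \<omega>) \<le> N (enn2real (S' \<omega>)) \<omega>)"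
    using cont[OF N(1)] N_T AE_space
  proof eventually_elim
    case (elim \<omega>)
    have conv: "(\<lambda>n. N (r n) \<omega>) \<longlonglongrightarrow> N s \<omega>" if "r \<longlonglongrightarrow> s" "\<And>n. 0 \<le> r n" "0 \<le> s" for r s
      by (rule continuous_on_tendsto_compose[OF elim(1) that(1)]) (use that in auto)
    show ?case
    proof (intro conjI impI allI)
      fix n assume "T \<omega> < \<infinity>"
      then obtain t where t: "T \<omega> = ennreal t" "0 \<le> t" by (cases "T \<omega>") auto
      have "0 < t" using T_pos[OF elim(3)] t by simp
      have Nt: "N t \<omega> = exp (- t)" using elim(2) t by simp
      have "((\<lambda>u. exp (- u) - N u \<omega>) \<longlongrightarrow> exp (- t) - N t \<omega>) (at_left t)"
        by (intro tendsto_intros continuous_on_tendsto_left elim(1) \<open>0 < t\<close>)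
      then have "eventually (\<lambda>u. exp (- u) - N u \<omega> < 1 / Suc n) (at_left t)"
        by (rule order_tendstoD) (simp add: Nt)
      moreover have "eventually (\<lambda>u. 0 < u \<and> u < t) (at_left t)"
        using \<open>0 < t\<close> unfolding eventually_at_left_field by auto
      ultimately have "eventually (\<lambda>u. exp (- u) - N u \<omega> < 1 / Suc n \<and> 0 < u \<and> u < t) (at_left t)"
        by eventually_elim simp
      then obtain u where u: "exp (- u) - N u \<omega> < 1 / Suc n" "0 < u" "u < t"
        using eventually_happens'[OF trivial_limit_at_left_real] by auto
      then have "S n \<omega> \<le> ennreal u"
        unfolding S_def G_def by (intro debut_le) (auto intro: less_imp_le)
      also have "ennreal u < T \<omega>" using u t by (simp add: ennreal_less_iff)
      finally show "S n \<omega> < T \<omega>" .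
    next
      assume "S' \<omega> < \<infinity>"
      then obtain s where s: "S' \<omega> = ennreal s" "0 \<le> s" by (cases "S' \<omega>") auto
      have fin: "S n \<omega> < \<infinity>" for n
        using \<open>S' \<omega> < \<infinity>\<close> unfolding S'_def by (metis SUP_lessD UNIV_I)
      define r where "r n = enn2real (S n \<omega>)" for n
      have r: "S n \<omega> = ennreal (r n)" "0 \<le> r n" for n using fin[of n] by (auto simp: r_def)
      have "r \<longlonglongrightarrow> s"
        using S_lim[of \<omega>] unfolding r(1) s(1) by (simp add: r s)
      have "(\<lambda>n. exp (- r n) - N (r n) \<omega>) \<longlonglongrightarrow> exp (- s) - N s \<omega>"
        by (intro tendsto_intros conv \<open>r \<longlonglongrightarrow> s\<close>) (use r s in auto)
      moreover have "(\<lambda>n. 1 / real (Suc n)) \<longlonglongrightarrow> 0" by (rule LIMSEQ_Suc[OF lim_const_over_n])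
      ultimately have "exp (- s) - N s \<omega> \<le> 0"
        by (rule LIMSEQ_le) (use S_at[OF r(1,2) elim(3)] in auto)
      then show "discount (S' \<omega>) \<le> N (enn2real (S' \<omega>)) \<omega>" using s by simp
    qed
  qed
  have S'_le: "AE \<omega> in M. S' \<omega> \<le> T \<omega>"
    using below
  proof eventually_elim
    case (elim \<omega>)
    have "S n \<omega> \<le> T \<omega>" for n
      using elim by (cases "T \<omega> < \<infinity>") (simp_all add: less_imp_le less_top[symmetric])
    then show ?case unfolding S'_def by (rule SUP_least)
  qed
  \<comment> \<open>Sampling at \<open>S'\<close> gives
    \<open>E[exp (- S'); S' \<le> K] \<le> E[exp (- T); S' \<le> K]\<close>, whereas
    \<open>S' \<le> T\<close> gives the reverse inequality pointwise. Hence both variables agree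
    almost surely on the event, and \<open>exp\<close> is injective.\<close>
  have eq_K: "AE \<omega> in M. S' \<omega> \<le> ennreal (real K) \<longrightarrow> S' \<omega> = T \<omega>" for K :: nat
  proof -
    let ?A = "{\<omega>. S' \<omega> \<le> ennreal (real K)}"
    let ?d = "\<lambda>\<omega>. indicator ?A \<omega> * discount (S' \<omega>) - indicator ?A \<omega> * discount (T \<omega>)"
    have samp: "(\<integral>\<omega>. indicator ?A \<omega> * N (enn2real (S' \<omega>)) \<omega> \<partial>M) = (\<integral>\<omega>. indicator ?A \<omega> * discount (T \<omega>) \<partial>M)"
        "integrable M (\<lambda>\<omega>. indicator ?A \<omega> * N (enn2real (S' \<omega>)) \<omega>)"
      by (rule optional_sampling[OF N_ad N_cad, where B=1 and W="\<lambda>_ \<omega>. discount (T \<omega>)"];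
          use W N(2) S'_st in \<open>auto simp: discount_range\<close>)+
    have [measurable]: "Measurable.pred M (\<lambda>\<omega>. S' \<omega> \<le> ennreal (real K))" by measurable
    have int: "integrable M (\<lambda>\<omega>. indicator ?A \<omega> * discount (S' \<omega>))" "integrable M (\<lambda>\<omega>. indicator ?A \<omega> * discount (T \<omega>))"
      by (rule integrable_const_bound[where B=1]; auto simp: discount_range indicator_def intro!: measurable_If)+
    have "(\<integral>\<omega>. indicator ?A \<omega> * discount (S' \<omega>) \<partial>M) \<le> (\<integral>\<omega>. indicator ?A \<omega> * N (enn2real (S' \<omega>)) \<omega> \<partial>M)"
    proof (rule integral_mono_AE[OF int(1) samp(2)])
      show "AE \<omega> in M. indicator ?A \<omega> * discount (S' \<omega>) \<le> indicator ?A \<omega> * N (enn2real (S' \<omega>)) \<omega>"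
        using below by eventually_elim (auto split: split_indicator simp: le_less_trans[OF _ ennreal_less_top])
    qed
    then have le0: "(\<integral>\<omega>. ?d \<omega> \<partial>M) \<le> 0" using samp(1) int by simp
    have nonneg: "AE \<omega> in M. 0 \<le> ?d \<omega>"
      using S'_le
    proof eventually_elim
      case (elim \<omega>)
      then show ?case
        by (cases "T \<omega>"; cases "S' \<omega>") (auto simp: discount_def top_unique split: split_indicator)
    qed
    have "0 \<le> (\<integral>\<omega>. ?d \<omega> \<partial>M)" by (rule integral_nonneg_AE[OF nonneg])
    then have "(\<integral>\<omega>. ?d \<omega> \<partial>M) = 0" using le0 by simp
    then have "AE \<omega> in M. ?d \<omega> = 0"
      using integral_nonneg_eq_0_iff_AE[OF _ nonneg] int by simp
    with S'_le show ?thesis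
    proof eventually_elim
      case (elim \<omega>)
      show ?case
      proof
        assume le: "S' \<omega> \<le> ennreal (real K)"
        then have "discount (S' \<omega>) = discount (T \<omega>)" using elim by simp
        moreover obtain s where "S' \<omega> = ennreal s" "0 \<le> s" using le by (cases "S' \<omega>") (auto simp: top_unique)
        ultimately show "S' \<omega> = T \<omega>" by (cases "T \<omega>") (auto simp: discount_def)
      qed
    qed
  qed
  then have "AE \<omega> in M. \<forall>K::nat. S' \<omega> \<le> ennreal (real K) \<longrightarrow> S' \<omega> = T \<omega>" unfolding AE_all_countable by simp
  with S'_le have S'_eq: "AE \<omega> in M. S' \<omega> = T \<omega>"
  proof eventually_elim
    case (elim \<omega>)
    show ?case
    proof (cases "S' \<omega>")
      case (real s)
      obtain K :: nat where "s \<le> real K" using real_arch_simple by blast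
      then have "S' \<omega> \<le> ennreal (real K)" using real by (simp add: ennreal_leI)
      then show ?thesis using elim by blast
    qed (use elim in \<open>auto simp: top_unique\<close>)
  qed
  show ?thesis
  proof (intro exI[of _ S] conjI allI S_st)
    show "AE \<omega> in M. (\<lambda>n. S n \<omega>) \<longlonglongrightarrow> T \<omega> \<and> (\<forall>n. T \<omega> < \<infinity> \<longrightarrow> S n \<omega> < T \<omega>)"
      using S'_eq below
    proof eventually_elim
      case (elim \<omega>)
      then show ?case using S_lim[of \<omega>] by auto
    qed
  qed
qed

lemma azema_range:
  assumes J: "azema_supermartingale M F \<rho> J" and \<rho>[measurable]: "\<rho> \<in> borel_measurable M"
  shows "AE \<omega> in M. \<forall>t\<ge>0. 0 \<le> J t \<omega> \<and> J t \<omega> \<le> 1"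
proof -
  have "AE \<omega> in M. J t \<omega> \<in> {0..1}" if t: "0 \<le> t" for t
  proof -
    interpret sigma_finite_subalgebra M "F t" by (rule sigma_finite_subalgebra_F[OF t])
    let ?W = "indicator {\<omega>\<in>space M. ennreal t < \<rho> \<omega>} :: 'a \<Rightarrow> real"
    have int: "integrable M ?W" by (rule integrable_const_bound[where B=1]) (auto split: split_indicator)
    have "AE \<omega> in M. real_cond_exp M (F t) ?W \<omega> \<le> 1" by (rule real_cond_exp_le_c[OF int]) (auto split: split_indicator)
    moreover have "AE \<omega> in M. real_cond_exp M (F t) ?W \<omega> \<ge> 0" by (rule real_cond_exp_ge_c[OF int]) auto
    moreover have "AE \<omega> in M. J t \<omega> = real_cond_exp M (F t) ?W \<omega>"
      using J t unfolding azema_supermartingale_def by simp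
    ultimately show ?thesis by eventually_elim auto
  qed
  then have "AE \<omega> in M. \<forall>t\<ge>0. J t \<omega> \<in> {0..1}"
    using J by (intro AE_cadlag_closed) (auto simp: azema_supermartingale_def)
  then show ?thesis by simp
qed

end

section \<open>Continuity of the Azema supermartingale\<close>

text \<open>Honest times are ends of optional sets; here the set is predictable. It is a parameter
  of its own, because the debuts of its parts after given times, and not only \<open>L\<close>,
  enter the proof of \<open>Z = 1\<close> at \<open>L\<close>.\<close>

locale honest_time = usual_filtered_prob_space +
  fixes L :: "'a \<Rightarrow> ennreal" and Z :: "real \<Rightarrow> 'a \<Rightarrow> real" and \<Gamma> :: "(real \<times> 'a) set"
  assumes continuous_martingales:
      "\<And>X. cadlag_martingale M F X \<Longrightarrow> AE \<omega> in M. continuous_on {0..} (\<lambda>t. X t \<omega>)"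
    and predictable: "\<Gamma> \<in> sets (predictable_sigma M F)"
    and end_of_\<Gamma>: "\<And>\<omega>. \<omega> \<in> space M \<Longrightarrow> L \<omega> = end_of \<Gamma> \<omega>"
    and avoids: "\<And>T. ext_stopping_time F T \<Longrightarrow> {\<omega>\<in>space M. L \<omega> = T \<omega>} \<in> null_sets M"
    and azema: "azema_supermartingale M F L Z"
begin

lemma progressive_\<Gamma>: "progressive M F \<Gamma>"
  using predictable by (rule predictable_progressive)

lemma less_L_iff: "\<omega> \<in> space M \<Longrightarrow> x < L \<omega> \<longleftrightarrow> (\<exists>t\<ge>0. (t, \<omega>) \<in> \<Gamma> \<and> x < ennreal t)"
  unfolding end_of_\<Gamma> end_of_def less_SUP_iff by auto

text \<open>\<open>L\<close> exceeds \<open>r\<close> exactly if \<open>\<Gamma>\<close> has a point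
  after \<open>r\<close>, which is a projection. As \<open>\<Gamma>\<close> is jointly measurable
  only up to finite horizons, the projection is taken up to each \<open>n\<close>.\<close>

lemma L_measurable[measurable]: "L \<in> borel_measurable M"
proof (rule borel_measurableI_greater)
  fix y :: ennreal
  show "{\<omega>\<in>space M. y < L \<omega>} \<in> sets M"
  proof (cases y)
    case (real r)
    define P where "P n = {\<omega>\<in>space M. \<exists>s. (s, \<omega>) \<in> ({0..real n} \<times> space M) \<inter> \<Gamma> \<inter> ({r<..} \<times> space M)}" for n
    have "P n \<in> sets M" for n
    proof -
      have n: "0 \<le> real n" by simp
      have "({0..real n} \<times> space M) \<inter> \<Gamma> \<in> sets (borel \<Otimes>\<^sub>M F (real n))"
        using progressive_\<Gamma> n unfolding progressive_def by simp
      moreover have "{r<..} \<times> space (F (real n)) \<in> sets (borel \<Otimes>\<^sub>M F (real n))" by (intro pair_measureI) auto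
      ultimately have "({0..real n} \<times> space M) \<inter> \<Gamma> \<inter> ({r<..} \<times> space M) \<in> sets (borel \<Otimes>\<^sub>M F (real n))"
        unfolding space_F[OF n] by (rule sets.Int)
      then have "P n \<in> sets (F (real n))" unfolding P_def by (rule projection_F[OF n])
      then show ?thesis by (rule sets_F_subset[OF n])
    qed
    moreover have "{\<omega>\<in>space M. y < L \<omega>} = (\<Union>n. P n)"
    proof (intro equalityI subsetI)
      fix \<omega> assume "\<omega> \<in> {\<omega>\<in>space M. y < L \<omega>}"
      then have \<omega>: "\<omega> \<in> space M" "y < L \<omega>" by simp_all
      then obtain t where t: "0 \<le> t" "(t, \<omega>) \<in> \<Gamma>" "y < ennreal t" using less_L_iff by auto
      have "r < t" using t(3) real by (simp add: ennreal_less_iff)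
      moreover obtain n :: nat where "t \<le> real n" using real_arch_simple by auto
      ultimately have "\<omega> \<in> P n" unfolding P_def using t \<omega> by auto
      then show "\<omega> \<in> (\<Union>n. P n)" by auto
    next
      fix \<omega> assume "\<omega> \<in> (\<Union>n. P n)"
      then obtain s where s: "\<omega> \<in> space M" "0 \<le> s" "(s, \<omega>) \<in> \<Gamma>" "r < s" unfolding P_def by auto
      then have "y < ennreal s" using real by (simp add: ennreal_less_iff)
      then show "\<omega> \<in> {\<omega>\<in>space M. y < L \<omega>}" using s by (auto simp: less_L_iff)
    qed
    ultimately show ?thesis by auto
  qed simp
qed

lemma AE_avoids: "ext_stopping_time F T \<Longrightarrow> AE \<omega> in M. L \<omega> \<noteq> T \<omega>"
  unfolding AE_iff_null_sets using avoids by simp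

text \<open>Constants, including 0 and \<open>\<infinity>\<close>, are stopping times and are
  therefore avoided by \<open>L\<close>.\<close>

lemma AE_L: "AE \<omega> in M. 0 < L \<omega> \<and> L \<omega> < \<infinity>"
  using AE_avoids[OF ext_stopping_time_const[of 0]] AE_avoids[OF ext_stopping_time_const[of \<infinity>]]
  by eventually_elim (auto simp: zero_less_iff_neq_zero less_top)

lemma Z_adapted: "adapted F Z"
  and Z_cadlag: "\<And>\<omega>. \<omega> \<in> space M \<Longrightarrow> cadlag (\<lambda>t. Z t \<omega>)"
  and Z_cond_exp: "\<And>t. 0 \<le> t \<Longrightarrow> AE \<omega> in M. Z t \<omega> = real_cond_exp M (F t) (indicator {\<omega>\<in>space M. ennreal t < L \<omega>}) \<omega>"
  using azema unfolding azema_supermartingale_def by auto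

lemma Z_measurable: "0 \<le> t \<Longrightarrow> Z t \<in> borel_measurable M"
  using Z_adapted unfolding adapted_def by (auto intro: measurable_F_M)

lemma AE_Z_range: "AE \<omega> in M. \<forall>t\<ge>0. 0 \<le> Z t \<omega> \<and> Z t \<omega> \<le> 1"
  by (rule azema_range[OF azema L_measurable])

text \<open>The strict inequality \<open>t < L\<close> is what makes the path right continuous in
  \<open>t\<close>, as sampling along times rounded up requires.\<close>

lemma indicator_right_continuous:
  "continuous (at_right t) (\<lambda>t. indicator {\<omega>\<in>space M. ennreal t < L \<omega>} \<omega> :: real)" if t: "0 \<le> t" and \<omega>: "\<omega> \<in> space M"
proof (cases "ennreal t < L \<omega>")
  case True
  then obtain b where b: "t < b" "ennreal b \<le> L \<omega>"
  proof (cases "L \<omega>")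
    case (real l)
    then show thesis using True t by (intro that[of l]) (simp_all add: ennreal_less_iff)
  qed (use that[of "t + 1"] in simp)
  have "eventually (\<lambda>s. indicator {\<omega>\<in>space M. ennreal s < L \<omega>} \<omega> = (1::real)) (at_right t)"
    unfolding eventually_at_right_field
  proof (intro exI[of _ b] conjI allI impI)
    fix s assume "t < s" "s < b"
    then have "ennreal s < ennreal b" using t by (simp add: ennreal_less_iff)
    then show "indicator {\<omega>\<in>space M. ennreal s < L \<omega>} \<omega> = (1::real)" using b \<omega> by (auto intro: less_le_trans)
  qed (use b in simp)
  then show ?thesis unfolding continuous_within using True \<omega>
    by (intro tendsto_eventually) simp
next
  case False
  have "eventually (\<lambda>s. indicator {\<omega>\<in>space M. ennreal s < L \<omega>} \<omega> = (0::real)) (at_right t)"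
    unfolding eventually_at_right_field
  proof (intro exI[of _ "t + 1"] conjI allI impI)
    fix s assume "t < s" "s < t + 1"
    then have "ennreal t \<le> ennreal s" by (intro ennreal_leI) simp
    then have "\<not> ennreal s < L \<omega>" using False by auto
    then show "indicator {\<omega>\<in>space M. ennreal s < L \<omega>} \<omega> = (0::real)" by simp
  qed simp
  then show ?thesis unfolding continuous_within using False \<omega>
    by (intro tendsto_eventually) simp
qed

lemma Z_sampling:
  assumes T: "ext_stopping_time F T" and K: "0 \<le> K"
  shows "(\<integral>\<omega>. stopped Z T K \<omega> \<partial>M) =
      prob {\<omega>\<in>space M. T \<omega> \<le> ennreal K \<and> T \<omega> < L \<omega>}"
    and "integrable M (stopped Z T K)"
proof -
  note [measurable] = ext_stopping_time_measurable[OF T]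
  define W :: "real \<Rightarrow> 'a \<Rightarrow> real" where "W t = indicator {\<omega>\<in>space M. ennreal t < L \<omega>}" for t
  have W: "W t \<in> borel_measurable M" for t unfolding W_def by measurable
  have Wc: "continuous (at_right t) (\<lambda>t. W t \<omega>)" if "0 \<le> t" "\<omega> \<in> space M" for t \<omega>
    unfolding W_def by (rule indicator_right_continuous[OF that])
  have W1: "\<bar>W t \<omega>\<bar> \<le> 1" for t \<omega> by (simp add: W_def split: split_indicator)
  have WZ: "AE \<omega> in M. Z t \<omega> = real_cond_exp M (F t) (W t) \<omega>" if "0 \<le> t" for t
    unfolding W_def by (rule Z_cond_exp[OF that])
  have "(\<integral>\<omega>. stopped W T K \<omega> \<partial>M) =
      (\<integral>\<omega>. indicator {\<omega>\<in>space M. T \<omega> \<le> ennreal K \<and> T \<omega> < L \<omega>} \<omega> \<partial>M)"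
  proof (rule Bochner_Integration.integral_cong[OF refl])
    fix \<omega> assume "\<omega> \<in> space M"
    then show "stopped W T K \<omega> =
        indicator {\<omega>\<in>space M. T \<omega> \<le> ennreal K \<and> T \<omega> < L \<omega>} \<omega>"
      by (cases "T \<omega>") (auto simp: W_def top_unique split: split_indicator)
  qed
  then show "(\<integral>\<omega>. stopped Z T K \<omega> \<partial>M) =
      prob {\<omega>\<in>space M. T \<omega> \<le> ennreal K \<and> T \<omega> < L \<omega>}"
    using optional_sampling(1)[OF Z_adapted Z_cadlag W Wc W1 WZ T K] by simp
  show "integrable M (stopped Z T K)"
    using optional_sampling(2)[OF Z_adapted Z_cadlag W Wc W1 WZ T K] by simp
qed

text \<open>Along an announcing sequence both sides of \<open>E[Z\<^sub>S] = P[S < L]\<close> converge, so that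
  \<open>E[Z\<^bsub>T-\<^esub>] = P[T \<le> L]\<close>. This equals \<open>P[T < L] = E[Z\<^sub>T]\<close> since \<open>L\<close> avoids \<open>T\<close>.\<close>

lemma Z_left_limit_integral:
  assumes T: "ext_stopping_time F T" and T_pos: "\<And>\<omega>. \<omega> \<in> space M \<Longrightarrow> 0 < T \<omega>" and K: "0 \<le> K"
  shows "(\<integral>\<omega>. indicator {\<omega>. T \<omega> \<le> ennreal K} \<omega> * left_limit (\<lambda>t. Z t \<omega>) (enn2real (T \<omega>)) \<partial>M) =
      (\<integral>\<omega>. stopped Z T K \<omega> \<partial>M)"
    and "integrable M (\<lambda>\<omega>. indicator {\<omega>. T \<omega> \<le> ennreal K} \<omega> * left_limit (\<lambda>t. Z t \<omega>) (enn2real (T \<omega>)))"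
proof -
  note [measurable] = ext_stopping_time_measurable[OF T]
  have "\<exists>S. (\<forall>n. ext_stopping_time F (S n)) \<and>
      (AE \<omega> in M. (\<lambda>n. S n \<omega>) \<longlonglongrightarrow> T \<omega> \<and> (\<forall>n. T \<omega> < \<infinity> \<longrightarrow> S n \<omega> < T \<omega>))"
    by (rule announcing_sequence[OF continuous_martingales T T_pos])
  then obtain S where S: "\<And>n. ext_stopping_time F (S n)"
    and S_T: "AE \<omega> in M. (\<lambda>n. S n \<omega>) \<longlonglongrightarrow> T \<omega> \<and> (\<forall>n. T \<omega> < \<infinity> \<longrightarrow> S n \<omega> < T \<omega>)"
    by auto
  note [measurable] = ext_stopping_time_measurable[OF S]
  define f where "f n \<omega> = stopped Z (S n) K \<omega>" for n \<omega>
  define g where "g \<omega> = indicator {\<omega>. T \<omega> \<le> ennreal K} \<omega> * left_limit (\<lambda>t. Z t \<omega>) (enn2real (T \<omega>))" for \<omega>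
  define h :: "nat \<Rightarrow> 'a \<Rightarrow> real" where "h n = indicator {\<omega>\<in>space M. S n \<omega> \<le> ennreal K \<and> S n \<omega> < L \<omega>}" for n
  define k :: "'a \<Rightarrow> real" where "k = indicator {\<omega>\<in>space M. T \<omega> \<le> ennreal K \<and> T \<omega> < L \<omega>}"
  have fh: "(\<integral>\<omega>. f n \<omega> \<partial>M) = (\<integral>\<omega>. h n \<omega> \<partial>M)" "integrable M (f n)" for n
    using Z_sampling[OF S K] by (simp_all add: f_def[abs_def] h_def)
  have f_meas: "f n \<in> borel_measurable M" for n using fh(2) by simp
  have limits: "AE \<omega> in M. ((\<lambda>n. f n \<omega>) \<longlonglongrightarrow> g \<omega>) \<and> ((\<lambda>n. h n \<omega>) \<longlonglongrightarrow> k \<omega>)"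
    using S_T AE_avoids[OF T] AE_space
  proof eventually_elim
    case (elim \<omega>)
    then have lim: "(\<lambda>n. S n \<omega>) \<longlonglongrightarrow> T \<omega>" and less: "T \<omega> < \<infinity> \<Longrightarrow> S n \<omega> < T \<omega>" for n by auto
    show ?case
    proof (cases "T \<omega> \<le> ennreal K")
      case True
      then obtain t where t: "T \<omega> = ennreal t" "0 \<le> t" by (cases "T \<omega>") (auto simp: top_unique)
      have "0 < t" using T_pos[OF elim(3)] t by simp
      define r where "r n = enn2real (S n \<omega>)" for n
      have r: "S n \<omega> = ennreal (r n)" "0 \<le> r n" "r n < t" for n
      proof -
        have "S n \<omega> < ennreal t" using less[of n] t by simp
        then show "S n \<omega> = ennreal (r n)" "0 \<le> r n" "r n < t"
          by (cases "S n \<omega>"; simp add: r_def ennreal_less_iff)+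
      qed
      have S_le: "S n \<omega> \<le> ennreal K" for n using less[of n] True t by (auto intro: less_imp_le less_le_trans)
      have "r \<longlonglongrightarrow> t" using lim unfolding r(1) t(1) by (simp add: r(2) t(2))
      have "(\<lambda>n. Z (r n) \<omega>) \<longlonglongrightarrow> left_limit (\<lambda>t. Z t \<omega>) t"
        by (rule cadlag_left_limit_seq[OF Z_cadlag[OF elim(3)] \<open>0 < t\<close> \<open>r \<longlonglongrightarrow> t\<close> r(3)])
      moreover have "f n \<omega> = Z (r n) \<omega>" for n using S_le[of n] by (simp add: f_def r_def)
      moreover have "g \<omega> = left_limit (\<lambda>t. Z t \<omega>) t" using True t by (simp add: g_def)
      ultimately have f_lim: "(\<lambda>n. f n \<omega>) \<longlonglongrightarrow> g \<omega>" by simp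
      \<comment> \<open>If \<open>T < L\<close>, all \<open>S n\<close> are below \<open>L\<close>;
        if \<open>L < T\<close>, they eventually exceed \<open>L\<close>. In the tie
        \<open>L = T\<close> the indicators would be 1 along the sequence and 0 in the limit, and
        this case is excluded almost surely.\<close>
      have "(\<lambda>n. h n \<omega>) \<longlonglongrightarrow> k \<omega>"
      proof (cases "T \<omega> < L \<omega>")
        case lt: True
        have "S n \<omega> < L \<omega>" for n using less[of n] lt t by (auto intro: less_trans)
        then have "h n \<omega> = k \<omega>" for n using S_le[of n] True lt elim(3) by (simp add: h_def k_def)
        then show ?thesis by simp
      next
        case False
        then have "L \<omega> < T \<omega>" using elim(2) by simp
        then have "eventually (\<lambda>n. L \<omega> < S n \<omega>) sequentially" by (rule order_tendstoD(1)[OF lim])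
        then have "eventually (\<lambda>n. h n \<omega> = k \<omega>) sequentially"
          by eventually_elim (use False in \<open>auto simp: h_def k_def split: split_indicator\<close>)
        then show ?thesis by (rule tendsto_eventually)
      qed
      with f_lim show ?thesis by simp
    next
      case False
      then have "ennreal K < T \<omega>" by simp
      then have "eventually (\<lambda>n. ennreal K < S n \<omega>) sequentially" by (rule order_tendstoD(1)[OF lim])
      then have "eventually (\<lambda>n. f n \<omega> = g \<omega>) sequentially" "eventually (\<lambda>n. h n \<omega> = k \<omega>) sequentially"
        by (eventually_elim, use False in \<open>auto simp: f_def g_def h_def k_def split: split_indicator\<close>)+
      then show ?thesis by (auto intro: tendsto_eventually)
    qed
  qed
  then have f_lim: "AE \<omega> in M. (\<lambda>n. f n \<omega>) \<longlonglongrightarrow> g \<omega>" and h_lim: "AE \<omega> in M. (\<lambda>n. h n \<omega>) \<longlonglongrightarrow> k \<omega>" by auto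
  have f_bound: "AE \<omega> in M. norm (f n \<omega>) \<le> 1" for n
    using AE_Z_range by eventually_elim (auto simp: f_def split: split_indicator)
  have w: "integrable M (\<lambda>_. 1::real)" by simp
  have g_meas: "g \<in> borel_measurable M" by (rule measurable_AE_LIMSEQ[OF f_meas f_lim])
  have h_meas: "h n \<in> borel_measurable M" for n unfolding h_def by measurable
  have k_meas: "k \<in> borel_measurable M" unfolding k_def by measurable
  have "(\<lambda>n. \<integral>\<omega>. f n \<omega> \<partial>M) \<longlonglongrightarrow> (\<integral>\<omega>. g \<omega> \<partial>M)"
    by (rule integral_dominated_convergence[OF g_meas f_meas w f_lim f_bound])
  moreover have "(\<lambda>n. \<integral>\<omega>. h n \<omega> \<partial>M) \<longlonglongrightarrow> (\<integral>\<omega>. k \<omega> \<partial>M)"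
    by (rule integral_dominated_convergence[OF k_meas h_meas w h_lim]) (auto simp: h_def split: split_indicator)
  ultimately have "(\<integral>\<omega>. g \<omega> \<partial>M) = (\<integral>\<omega>. k \<omega> \<partial>M)"
    unfolding fh(1) by (rule LIMSEQ_unique)
  then show "(\<integral>\<omega>. indicator {\<omega>. T \<omega> \<le> ennreal K} \<omega> * left_limit (\<lambda>t. Z t \<omega>) (enn2real (T \<omega>)) \<partial>M) =
      (\<integral>\<omega>. stopped Z T K \<omega> \<partial>M)"
    using Z_sampling(1)[OF T K] by (simp add: g_def k_def)
  have "integrable M g" by (rule integrable_dominated_convergence[OF g_meas f_meas w f_lim f_bound])
  then show "integrable M (\<lambda>\<omega>. indicator {\<omega>. T \<omega> \<le> ennreal K} \<omega> * left_limit (\<lambda>t. Z t \<omega>) (enn2real (T \<omega>)))"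
    by (simp add: g_def[abs_def])
qed

text \<open>At the first jump of size at least \<open>e\<close> in the direction
  \<open>\<sigma>\<close> the quantity \<open>\<sigma> * (Z - Z_left)\<close>, with
  \<open>Z_left\<close> the left limit, is at least \<open>e\<close>, while its integral over
  \<open>T \<le> K\<close> is 0. The two directions are treated separately, as upward and downward
  jumps could cancel in the integral.\<close>

lemma AE_no_jumps:
  fixes \<sigma> e :: real
  assumes \<sigma>: "\<bar>\<sigma>\<bar> = 1" and e: "0 < e"
  shows "AE \<omega> in M. \<forall>t>0. \<sigma> * (Z t \<omega> - left_limit (\<lambda>t. Z t \<omega>) t) < e"
proof -
  define J where "J = {(t, \<omega>). \<omega> \<in> space M \<and> 0 < t \<and> e \<le> \<sigma> * (Z t \<omega> - left_limit (\<lambda>t. Z t \<omega>) t)}"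
  define T where "T = debut J"
  have "progressive M F J"
  proof (rule progressiveI)
    fix u :: real assume u: "0 \<le> u"
    have Zu: "(\<lambda>x. Z (max 0 (min (fst x) u)) (snd x)) \<in> borel_measurable (borel \<Otimes>\<^sub>M F u)"
      using progressive_process[OF Z_adapted Z_cadlag u] by (simp add: case_prod_beta)
    \<comment> \<open>The left limit at \<open>s > 0\<close> is taken along the times
      \<open>s * (1 - 1 / (n + 2))\<close>, which lie strictly between 0 and \<open>s\<close>. Only
      values before the horizon are read, so the left limit is jointly measurable for
      \<open>F u\<close>.\<close>
    have Zn: "(\<lambda>x. Z (max 0 (min (fst x * (1 - 1 / Suc (Suc n))) u)) (snd x)) \<in> borel_measurable (borel \<Otimes>\<^sub>M F u)" for n
    proof -
      have "(\<lambda>x. (fst x * (1 - 1 / Suc (Suc n)), snd x)) \<in> measurable (borel \<Otimes>\<^sub>M F u) (borel \<Otimes>\<^sub>M F u)" by measurable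
      from measurable_compose[OF this Zu] show ?thesis by simp
    qed
    have [measurable]: "(\<lambda>x. lim (\<lambda>n. Z (max 0 (min (fst x * (1 - 1 / Suc (Suc n))) u)) (snd x))) \<in> borel_measurable (borel \<Otimes>\<^sub>M F u)"
      by (rule borel_measurable_lim_metric[OF Zn])
    note Zu[measurable]
    show "Measurable.pred (borel \<Otimes>\<^sub>M F u) (\<lambda>x. 0 < fst x \<and> e \<le> \<sigma> * (Z (max 0 (min (fst x) u)) (snd x) -
        lim (\<lambda>n. Z (max 0 (min (fst x * (1 - 1 / Suc (Suc n))) u)) (snd x))))" by measurable
  next
    fix u s :: real and \<omega> assume s: "0 \<le> s" "s \<le> u" "\<omega> \<in> space M"
    have "lim (\<lambda>n. Z (max 0 (min (s * (1 - 1 / Suc (Suc n))) u)) \<omega>) = left_limit (\<lambda>t. Z t \<omega>) s" if "0 < s"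
    proof (rule limI)
      define r where "r n = s * (1 - 1 / Suc (Suc n))" for n
      have "(\<lambda>n. 1 / real (Suc (Suc n))) \<longlonglongrightarrow> 0" by (intro LIMSEQ_Suc lim_const_over_n)
      then have "(\<lambda>n. s * (1 - 1 / Suc (Suc n))) \<longlonglongrightarrow> s * (1 - 0)" by (intro tendsto_intros)
      then have "r \<longlonglongrightarrow> s" by (simp add: r_def[abs_def])
      have r: "0 \<le> r n" "r n < s" for n using that by (auto simp: r_def field_simps)
      have "max 0 (min (r n) u) = r n" for n using r[of n] s by simp
      then show "(\<lambda>n. Z (max 0 (min (s * (1 - 1 / Suc (Suc n))) u)) \<omega>) \<longlonglongrightarrow> left_limit (\<lambda>t. Z t \<omega>) s"
        using cadlag_left_limit_seq[OF Z_cadlag[OF s(3)] that \<open>r \<longlonglongrightarrow> s\<close> r(2)] by (simp add: r_def)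
    qed
    then show "(s, \<omega>) \<in> J \<longleftrightarrow> 0 < fst (s, \<omega>) \<and> e \<le> \<sigma> * (Z (max 0 (min (fst (s, \<omega>)) u)) (snd (s, \<omega>)) -
        lim (\<lambda>n. Z (max 0 (min (fst (s, \<omega>) * (1 - 1 / Suc (Suc n))) u)) (snd (s, \<omega>))))"
      using s by (auto simp: J_def)
  qed
  then have T: "ext_stopping_time F T" unfolding T_def by (rule ext_stopping_time_debut)
  note [measurable] = ext_stopping_time_measurable[OF T]
  have attained: "\<exists>t. T \<omega> = ennreal t \<and> (t, \<omega>) \<in> J" if \<omega>: "\<omega> \<in> space M" and fin: "T \<omega> < \<infinity>" for \<omega>
  proof -
    from debut_finite[of J \<omega>] fin obtain t where "0 \<le> t \<and> debut J \<omega> = ennreal t \<and>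
      (\<forall>e>0. \<exists>s\<ge>t. s < t + e \<and> (s, \<omega>) \<in> J)" unfolding T_def by auto
    then have t: "0 \<le> t" "T \<omega> = ennreal t" "\<forall>e>0. \<exists>s\<ge>t. s < t + e \<and> (s, \<omega>) \<in> J" by (simp_all add: T_def)
    obtain d where d: "0 < d" "\<forall>s. t < s \<and> s < t + d \<longrightarrow> \<bar>Z s \<omega> - left_limit (\<lambda>t. Z t \<omega>) s\<bar> < e"
      using cadlag_no_jump_right[OF Z_cadlag[OF \<omega>] t(1) e] by auto
    obtain s where s: "t \<le> s" "s < t + d" "(s, \<omega>) \<in> J" using t(3) d(1) by auto
    have "e \<le> \<bar>\<sigma> * (Z s \<omega> - left_limit (\<lambda>t. Z t \<omega>) s)\<bar>" using s(3) by (auto simp: J_def)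
    then have "\<not> \<bar>Z s \<omega> - left_limit (\<lambda>t. Z t \<omega>) s\<bar> < e" using \<sigma> by (simp add: abs_mult)
    then have "s = t" using d(2)[rule_format, of s] s(1,2) by (cases "t < s") auto
    then show ?thesis using s(3) t(2) by auto
  qed
  have T_pos: "0 < T \<omega>" if \<omega>: "\<omega> \<in> space M" for \<omega>
  proof (cases "T \<omega> < \<infinity>")
    case True
    then obtain t where "T \<omega> = ennreal t" "(t, \<omega>) \<in> J" using attained[OF \<omega>] by auto
    then show ?thesis by (simp add: J_def)
  qed (auto simp: less_top[symmetric])
  have "AE \<omega> in M. \<not> T \<omega> \<le> ennreal (real K)" for K :: nat
  proof -
    let ?A = "{\<omega>. T \<omega> \<le> ennreal (real K)}"
    let ?z = "\<lambda>\<omega>. indicator ?A \<omega> * Z (enn2real (T \<omega>)) \<omega>"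
    let ?l = "\<lambda>\<omega>. indicator ?A \<omega> * left_limit (\<lambda>t. Z t \<omega>) (enn2real (T \<omega>))"
    have K: "0 \<le> real K" by simp
    have l: "(\<integral>\<omega>. ?l \<omega> \<partial>M) = (\<integral>\<omega>. ?z \<omega> \<partial>M)" "integrable M ?l"
      by (rule Z_left_limit_integral[OF T T_pos K]; assumption)+
    note z = Z_sampling(2)[OF T K]
    have zero: "(\<integral>\<omega>. \<sigma> * (?z \<omega> - ?l \<omega>) \<partial>M) = 0" using l z by simp
    have ge: "e * indicator {\<omega>\<in>space M. T \<omega> \<le> ennreal (real K)} \<omega> \<le> \<sigma> * (?z \<omega> - ?l \<omega>)" if \<omega>: "\<omega> \<in> space M" for \<omega>
    proof (cases "\<omega> \<in> ?A")
      case True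
      then have "T \<omega> < \<infinity>" by (auto simp: less_top[symmetric] top_unique)
      then obtain t where t: "T \<omega> = ennreal t" "(t, \<omega>) \<in> J" using attained[OF \<omega>] by auto
      then show ?thesis using True \<omega> by (simp add: J_def)
    qed simp
    have le: "(\<integral>\<omega>. e * indicator {\<omega>\<in>space M. T \<omega> \<le> ennreal (real K)} \<omega> \<partial>M) \<le> (\<integral>\<omega>. \<sigma> * (?z \<omega> - ?l \<omega>) \<partial>M)"
    proof (rule integral_mono)
      show "integrable M (\<lambda>\<omega>. e * indicator {\<omega>\<in>space M. T \<omega> \<le> ennreal (real K)} \<omega>)"
        by (rule integrable_const_bound[where B=e]) (use e in \<open>auto split: split_indicator\<close>)
      show "integrable M (\<lambda>\<omega>. \<sigma> * (?z \<omega> - ?l \<omega>))" using l(2) z by (intro integrable_mult_right Bochner_Integration.integrable_diff)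
    qed (rule ge)
    have "e * prob {\<omega>\<in>space M. T \<omega> \<le> ennreal (real K)} \<le> 0" using le unfolding zero by simp
    then have "prob {\<omega>\<in>space M. T \<omega> \<le> ennreal (real K)} = 0"
      using e measure_nonneg[of M "{\<omega>\<in>space M. T \<omega> \<le> ennreal (real K)}"] by (simp add: mult_le_0_iff)
    then show ?thesis by (subst (asm) prob_eq_0) (auto elim: eventually_mono)
  qed
  then have "AE \<omega> in M. \<forall>K::nat. \<not> T \<omega> \<le> ennreal (real K)" unfolding AE_all_countable by simp
  then show ?thesis
    using AE_space
  proof eventually_elim
    case (elim \<omega>)
    show ?case
    proof (intro allI impI, rule ccontr)
      fix t :: real assume t: "0 < t" "\<not> \<sigma> * (Z t \<omega> - left_limit (\<lambda>t. Z t \<omega>) t) < e"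
      then have "(t, \<omega>) \<in> J" using elim by (simp add: J_def)
      then have "T \<omega> \<le> ennreal t" unfolding T_def using t by (intro debut_le) auto
      moreover obtain K :: nat where "t \<le> real K" using real_arch_simple by auto
      ultimately have "T \<omega> \<le> ennreal (real K)" by (auto intro: order_trans ennreal_leI)
      then show False using elim by simp
    qed
  qed
qed

theorem AE_continuous_Z: "AE \<omega> in M. continuous_on {0..} (\<lambda>t. Z t \<omega>)"
proof -
  have "AE \<omega> in M. \<forall>k::nat. (\<forall>t>0. 1 * (Z t \<omega> - left_limit (\<lambda>t. Z t \<omega>) t) < 1 / Suc k) \<and>
      (\<forall>t>0. -1 * (Z t \<omega> - left_limit (\<lambda>t. Z t \<omega>) t) < 1 / Suc k)"
    unfolding AE_all_countable
  proof
    fix k :: nat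
    have "0 < 1 / real (Suc k)" by simp
    from AE_no_jumps[OF _ this, of 1] AE_no_jumps[OF _ this, of "-1"]
    show "AE \<omega> in M. (\<forall>t>0. 1 * (Z t \<omega> - left_limit (\<lambda>t. Z t \<omega>) t) < 1 / Suc k) \<and>
        (\<forall>t>0. -1 * (Z t \<omega> - left_limit (\<lambda>t. Z t \<omega>) t) < 1 / Suc k)" by auto
  qed
  then show ?thesis
    using AE_space
  proof eventually_elim
    case (elim \<omega>)
    show ?case
    proof (rule cadlag_continuous_on[OF Z_cadlag[OF elim(2)]], rule ccontr)
      fix t :: real assume t: "0 < t" "Z t \<omega> \<noteq> left_limit (\<lambda>t. Z t \<omega>) t"
      let ?d = "Z t \<omega> - left_limit (\<lambda>t. Z t \<omega>) t"
      have "0 < \<bar>?d\<bar>" using t by simp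
      then obtain k :: nat where "1 / Suc k < \<bar>?d\<bar>" using nat_approx_posE by metis
      moreover have "1 * ?d < 1 / Suc k" "-1 * ?d < 1 / Suc k" using elim(1) t(1) by auto
      then have "\<bar>?d\<bar> < 1 / Suc k" by (simp only: abs_less_iff mult_1 mult_minus1 simp_thms)
      ultimately show False by (simp only: less_asym)
    qed
  qed
qed

theorem AE_Z_L: "AE \<omega> in M. Z (enn2real (L \<omega>)) \<omega> = 1"
proof -
  define G where "G q = \<Gamma> \<inter> {(s, \<omega>). q < s}" for q :: real
  have prog: "progressive M F (G q)" for q
    unfolding progressive_def
  proof (intro allI impI)
    fix t :: real assume t: "0 \<le> t"
    have "({0..t} \<times> space M) \<inter> \<Gamma> \<in> sets (borel \<Otimes>\<^sub>M F t)" using progressive_\<Gamma> t unfolding progressive_def by simp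
    moreover have "{q<..} \<times> space (F t) \<in> sets (borel \<Otimes>\<^sub>M F t)" by (intro pair_measureI) auto
    ultimately have "(({0..t} \<times> space M) \<inter> \<Gamma>) \<inter> ({q<..} \<times> space (F t)) \<in> sets (borel \<Otimes>\<^sub>M F t)" by (rule sets.Int)
    also have "(({0..t} \<times> space M) \<inter> \<Gamma>) \<inter> ({q<..} \<times> space (F t)) = ({0..t} \<times> space M) \<inter> G q"
      unfolding G_def space_F[OF t] by auto
    finally show "({0..t} \<times> space M) \<inter> G q \<in> sets (borel \<Otimes>\<^sub>M F t)" .
  qed
  define D where "D q = debut (G q)" for q
  have D: "ext_stopping_time F (D q)" for q unfolding D_def by (rule ext_stopping_time_debut[OF prog])
  have D_le: "D q \<omega> \<le> L \<omega>" if "D q \<omega> < \<infinity>" "\<omega> \<in> space M" for q \<omega>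
  proof (rule ccontr)
    assume not_le: "\<not> D q \<omega> \<le> L \<omega>"
    from debut_finite[of "G q" \<omega>] that obtain t where t: "0 \<le> t" "D q \<omega> = ennreal t" "\<exists>s\<ge>t. s < t + 1 \<and> (s, \<omega>) \<in> G q"
      unfolding D_def by (auto dest: spec[of _ 1])
    then obtain s where s: "t \<le> s" "(s, \<omega>) \<in> \<Gamma>" by (auto simp: G_def)
    have "ennreal s \<le> L \<omega>"
      unfolding end_of_\<Gamma>[OF that(2)] end_of_def using s t(1) by (intro SUP_upper) auto
    moreover have "D q \<omega> \<le> ennreal s" unfolding t(2) using s(1) by (rule ennreal_leI)
    ultimately show False using not_le order_trans by auto
  qed
  have one: "AE \<omega> in M. D q \<omega> \<le> ennreal (real K) \<longrightarrow> Z (enn2real (D q \<omega>)) \<omega> = 1" for q and K :: nat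
  proof -
    let ?A = "{\<omega>. D q \<omega> \<le> ennreal (real K)}"
    note [measurable] = ext_stopping_time_measurable[OF D[of q]]
    have K: "0 \<le> real K" by simp
    have "prob {\<omega>\<in>space M. D q \<omega> \<le> ennreal (real K) \<and> D q \<omega> < L \<omega>} = prob {\<omega>\<in>space M. D q \<omega> \<le> ennreal (real K)}"
    proof (rule finite_measure_eq_AE)
      show "AE \<omega> in M. \<omega> \<in> {\<omega>\<in>space M. D q \<omega> \<le> ennreal (real K) \<and> D q \<omega> < L \<omega>} \<longleftrightarrow>
          \<omega> \<in> {\<omega>\<in>space M. D q \<omega> \<le> ennreal (real K)}"
        using AE_avoids[OF D[of q]] AE_space
      proof eventually_elim
        case (elim \<omega>)
        have "D q \<omega> < L \<omega>" if "D q \<omega> \<le> ennreal (real K)"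
        proof -
          have "D q \<omega> < \<infinity>" using that by (auto simp: less_top[symmetric] top_unique)
          then show ?thesis using D_le[of q \<omega>] elim by (auto simp: less_le)
        qed
        then show ?case by auto
      qed
    qed measurable
    then have "(\<integral>\<omega>. indicator ?A \<omega> * Z (enn2real (D q \<omega>)) \<omega> \<partial>M) = (\<integral>\<omega>. indicator {\<omega>\<in>space M. D q \<omega> \<le> ennreal (real K)} \<omega> \<partial>M)"
      using Z_sampling(1)[OF D[of q] K] by simp
    also have "\<dots> = (\<integral>\<omega>. indicator ?A \<omega> \<partial>M)"
      by (rule Bochner_Integration.integral_cong[OF refl]) (auto split: split_indicator)
    finally have eq: "(\<integral>\<omega>. indicator ?A \<omega> * Z (enn2real (D q \<omega>)) \<omega> \<partial>M) = (\<integral>\<omega>. indicator ?A \<omega> \<partial>M)" .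
    have int1: "integrable M (\<lambda>\<omega>. indicator ?A \<omega> :: real)"
      by (rule integrable_const_bound[where B=1]) (auto split: split_indicator)
    note int2 = Z_sampling(2)[OF D[of q] K]
    \<comment> \<open>As \<open>Z \<le> 1\<close>, the difference is nonnegative, so that its
      vanishing integral forces \<open>Z = 1\<close> at \<open>D q\<close> wherever
      \<open>D q \<le> K\<close>.\<close>
    let ?d = "\<lambda>\<omega>. indicator ?A \<omega> - indicator ?A \<omega> * Z (enn2real (D q \<omega>)) \<omega>"
    have nonneg: "AE \<omega> in M. 0 \<le> ?d \<omega>"
      using AE_Z_range by eventually_elim (auto split: split_indicator)
    have "(\<integral>\<omega>. ?d \<omega> \<partial>M) = 0" using eq int1 int2 by simp
    then have "AE \<omega> in M. ?d \<omega> = 0"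
      using integral_nonneg_eq_0_iff_AE[OF _ nonneg] int1 int2 by simp
    then show ?thesis by eventually_elim (auto split: split_indicator_asm)
  qed
  have "AE \<omega> in M. \<forall>(r::rat) (K::nat). D (of_rat r) \<omega> \<le> ennreal (real K) \<longrightarrow> Z (enn2real (D (of_rat r) \<omega>)) \<omega> = 1"
    unfolding AE_all_countable using one by simp
  then show ?thesis
    using AE_Z_range AE_continuous_Z AE_L AE_space
  proof eventually_elim
    case (elim \<omega>)
    then obtain l where l: "L \<omega> = ennreal l" "0 < l" by (cases "L \<omega>") auto
    show ?case
    proof (rule ccontr)
      assume "Z (enn2real (L \<omega>)) \<omega> \<noteq> 1"
      then have "0 < 1 - Z l \<omega>" using elim(2) l by (auto simp: less_le)
      then obtain d where d: "0 < d" "\<And>s. 0 \<le> s \<Longrightarrow> \<bar>s - l\<bar> < d \<Longrightarrow> \<bar>Z s \<omega> - Z l \<omega>\<bar> < 1 - Z l \<omega>"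
        using elim(3) l unfolding continuous_on_iff by (fastforce simp: dist_real_def)
      \<comment> \<open>If \<open>Z\<close> were below 1 at \<open>l\<close>, it would be so on the
        interval of radius \<open>d\<close> around \<open>l\<close>. The debut after a rational time
        in \<open>(l - d, l)\<close> falls between that time and \<open>l\<close>, and there
        \<open>Z = 1\<close>.\<close>
      obtain r :: rat where r: "max 0 (l - d) < of_rat r" "of_rat r < l"
        using of_rat_dense[of "max 0 (l - d)" l] l d by auto
      define q :: real where "q = of_rat r"
      have q: "0 \<le> q" "l - d < q" "q < l" using r by (simp_all add: q_def)
      have "ennreal q < L \<omega>" using q l by (simp add: ennreal_less_iff)
      then obtain t where t: "0 \<le> t" "(t, \<omega>) \<in> \<Gamma>" "ennreal q < ennreal t"
        using less_L_iff[OF elim(5)] by auto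
      then have "(t, \<omega>) \<in> G q" using q by (simp add: G_def ennreal_less_iff)
      then have "D q \<omega> \<le> ennreal t" unfolding D_def using t(1) by (intro debut_le)
      then have fin: "D q \<omega> < \<infinity>" by (auto simp: less_top[symmetric] top_unique)
      then obtain s where s: "0 \<le> s" "D q \<omega> = ennreal s" by (cases "D q \<omega>") auto
      have "ennreal q \<le> D q \<omega>"
        unfolding D_def debut_def G_def by (intro INF_greatest) (auto intro!: ennreal_leI)
      then have "q \<le> s" using s by simp
      have "s \<le> l" using D_le[OF fin elim(5)] s l by simp
      obtain K :: nat where "s \<le> real K" using real_arch_simple by auto
      then have "D (of_rat r) \<omega> \<le> ennreal (real K)" using s by (simp add: q_def ennreal_leI)
      then have "Z (enn2real (D (of_rat r) \<omega>)) \<omega> = 1" using elim(1) by blast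
      then have "Z s \<omega> = 1" using s unfolding q_def by simp
      moreover have "\<bar>Z s \<omega> - Z l \<omega>\<bar> < 1 - Z l \<omega>"
        using \<open>q \<le> s\<close> \<open>s \<le> l\<close> q by (intro d(2)[OF s(1)]) auto
      ultimately show False by simp
    qed
  qed
qed

end

section \<open>Random times with a decreasing Azema supermartingale\<close>

text \<open>One-sided limits bound the path from below near each point, and bisection extends this
  to the whole interval. The guard \<open>0 \<le> a\<close> in \<open>P\<close> is due to the fact
  that nothing is known about the path at negative times.\<close>

lemma cadlag_bdd_below:
  assumes f: "cadlag f" and t: "0 \<le> t"
  shows "bdd_below (f ` {0..t})"
proof -
  define P where "P a b \<longleftrightarrow> (0 \<le> a \<longrightarrow> bdd_below (f ` {a..b}))" for a b
  have "P 0 t"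
    using t
  proof (induction rule: Bolzano)
    case (trans a b c)
    then have "f ` {a..c} = f ` {a..b} \<union> f ` {b..c}" by (metis image_Un ivl_disj_un_two_touch(4))
    then show ?case using trans by (auto simp: P_def)
  next
    case (local x)
    have "eventually (\<lambda>u. f x - 1 < f u) (at_right x)"
      using cadlag_right_continuous[OF f local(1)] unfolding continuous_within by (rule order_tendstoD) simp
    then obtain b' where b': "x < b'" "\<And>u. x < u \<Longrightarrow> u < b' \<Longrightarrow> f x - 1 < f u"
      unfolding eventually_at_right_field by auto
    have "\<exists>a' c. a' < x \<and> (\<forall>u. 0 \<le> u \<and> a' < u \<and> u < x \<longrightarrow> c < f u)"
    proof (cases "x = 0")
      case True
      then show ?thesis by (intro exI[of _ "-1"]) auto
    next
      case False
      then have "0 < x" using local(1) by simp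
      then have "eventually (\<lambda>u. left_limit f x - 1 < f u) (at_left x)"
        by (intro order_tendstoD(1)[OF cadlag_left_limit[OF f]]) auto
      then show ?thesis unfolding eventually_at_left_field by auto
    qed
    then obtain a' c where a': "a' < x" "\<And>u. 0 \<le> u \<Longrightarrow> a' < u \<Longrightarrow> u < x \<Longrightarrow> c < f u" by auto
    show ?case
    proof (intro exI[of _ "min (b' - x) (x - a')"] conjI allI impI)
      fix a b assume ab: "a \<le> x \<and> x \<le> b \<and> b - a < min (b' - x) (x - a')"
      have "min (f x - 1) c \<le> f u" if "0 \<le> a" "a \<le> u" "u \<le> b" for u
      proof -
        consider "u < x" | "u = x" | "x < u" by linarith
        then show ?thesis
        proof cases
          case 1 then show ?thesis using a'(2)[of u] that ab by auto
        next
          case 3 then show ?thesis using b'(2)[of u] that ab by auto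
        qed auto
      qed
      then show "P a b" unfolding P_def by (auto intro!: bdd_belowI[of _ "min (f x - 1) c"])
    qed (use b' a' in auto)
  qed
  then show ?thesis by (simp add: P_def)
qed

lemma running_inf_le: "cadlag f \<Longrightarrow> 0 \<le> u \<Longrightarrow> u \<le> t \<Longrightarrow> (INF u\<in>{0..t}. f u) \<le> f u" for f :: "real \<Rightarrow> real"
  by (intro cINF_lower cadlag_bdd_below) auto

lemma running_inf_antimono:
  assumes "cadlag f" "0 \<le> s" "s \<le> t"
  shows "(INF u\<in>{0..t}. f u) \<le> (INF u\<in>{0..s}. f u)"
  by (rule cINF_superset_mono) (use assms in \<open>auto intro: cadlag_bdd_below\<close>)

text \<open>Just after \<open>t\<close> the path stays above \<open>f t - e / 2\<close>, so the
  infimum cannot drop by more than \<open>e / 2\<close>. Left limits exist by monotonicity.\<close>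

lemma cadlag_running_inf:
  assumes f: "cadlag f"
  shows "cadlag (\<lambda>t. INF u\<in>{0..t}. f u)"
  unfolding cadlag_def
proof (intro conjI allI impI)
  fix t :: real assume t: "0 \<le> t"
  let ?g = "\<lambda>t. INF u\<in>{0..t}. f u"
  show "continuous (at_right t) ?g"
    unfolding continuous_within
  proof (rule tendstoI)
    fix e :: real assume e: "0 < e"
    have "eventually (\<lambda>u. f t - e / 2 < f u) (at_right t)"
      using cadlag_right_continuous[OF f t] unfolding continuous_within by (rule order_tendstoD) (use e in simp)
    then obtain b where b: "t < b" "\<And>u. t < u \<Longrightarrow> u < b \<Longrightarrow> f t - e / 2 < f u"
      unfolding eventually_at_right_field by auto
    have "dist (?g s) (?g t) < e" if s: "t < s" "s < b" for s
    proof -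
      have "?g t - e / 2 \<le> ?g s"
      proof (rule cINF_greatest)
        fix u assume u: "u \<in> {0..s}"
        show "?g t - e / 2 \<le> f u"
        proof (cases "u \<le> t")
          case True
          then show ?thesis using running_inf_le[OF f, of u t] u e by simp
        next
          case False
          then show ?thesis using running_inf_le[OF f, of t t] b(2)[of u] u s t by simp
        qed
      qed (use s t in auto)
      moreover have "?g s \<le> ?g t" using s t by (intro running_inf_antimono f) auto
      ultimately show ?thesis using e by (simp add: dist_real_def)
    qed
    then show "eventually (\<lambda>s. dist (?g s) (?g t) < e) (at_right t)"
      unfolding eventually_at_right_field using b(1) by auto
  qed
next
  fix t :: real assume t: "0 < t"
  let ?g = "\<lambda>t. INF u\<in>{0..t}. f u"
  define l where "l = (INF s\<in>{0..<t}. ?g s)"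
  have bdd: "bdd_below (?g ` {0..<t})"
    using running_inf_antimono[OF f, of _ t] by (intro bdd_belowI[of _ "?g t"]) auto
  have "(?g \<longlongrightarrow> l) (at_left t)"
  proof (rule tendstoI)
    fix e :: real assume e: "0 < e"
    have "l < l + e" using e by simp
    then obtain s0 where s0: "0 \<le> s0" "s0 < t" "?g s0 < l + e"
      using t unfolding l_def by (subst (asm) cINF_less_iff[OF _ bdd]) auto
    have "dist (?g s) l < e" if s: "s0 < s" "s < t" for s
    proof -
      have "?g s \<le> ?g s0" using s s0 by (intro running_inf_antimono f) auto
      moreover have "l \<le> ?g s" unfolding l_def using s s0 by (intro cINF_lower[OF bdd]) auto
      ultimately show ?thesis using s0 by (simp add: dist_real_def)
    qed
    then show "eventually (\<lambda>s. dist (?g s) l < e) (at_left t)"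
      unfolding eventually_at_left_field using s0 by auto
  qed
  then show "\<exists>l. (?g \<longlongrightarrow> l) (at_left t)" ..
qed

text \<open>A Stieltjes estimate: the decrements of \<open>a\<close> are nonnegative weights with
  total \<open>a 0 - a n\<close>. The bound on \<open>y\<close> is demanded only where
  \<open>a\<close> actually decreases, which for the indicator of \<open>t < \<rho>\<close> is the
  single mesh interval that contains \<open>\<rho>\<close>.\<close>

lemma abs_sum_decrements_le:
  fixes a y :: "nat \<Rightarrow> real"
  assumes "\<And>k. k < n \<Longrightarrow> a (Suc k) \<le> a k"
    and "\<And>k. k < n \<Longrightarrow> a k \<noteq> a (Suc k) \<Longrightarrow> \<bar>y k\<bar> \<le> e"
  shows "\<bar>\<Sum>k<n. y k * (a k - a (Suc k))\<bar> \<le> e * (a 0 - a n)"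
proof -
  have "\<bar>\<Sum>k<n. y k * (a k - a (Suc k))\<bar> \<le> (\<Sum>k<n. \<bar>y k * (a k - a (Suc k))\<bar>)" by (rule sum_abs)
  also have "\<dots> \<le> (\<Sum>k<n. e * (a k - a (Suc k)))"
  proof (rule sum_mono)
    fix k assume "k \<in> {..<n}"
    then show "\<bar>y k * (a k - a (Suc k))\<bar> \<le> e * (a k - a (Suc k))"
      using assms[of k] by (cases "a k = a (Suc k)") (auto simp: abs_mult intro: mult_right_mono)
  qed
  also have "\<dots> = e * (a 0 - a n)" by (simp add: sum_distrib_left[symmetric] sum_lessThan_telescope')
  finally show ?thesis .
qed

context usual_filtered_prob_space
begin

text \<open>That the infimum over \<open>[0, t]\<close> is below \<open>y\<close> means that some
  value is, and this is the projection of a set measurable for \<open>F t\<close>.\<close>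

lemma running_inf_measurable:
  assumes Z: "adapted F Z" "\<And>\<omega>. \<omega> \<in> space M \<Longrightarrow> cadlag (\<lambda>t. Z t \<omega>)" and t: "0 \<le> t"
  shows "(\<lambda>\<omega>. INF u\<in>{0..t}. Z u \<omega>) \<in> borel_measurable (F t)"
proof (rule borel_measurableI_less)
  fix y :: real
  have Zt: "(\<lambda>x. Z (max 0 (min (fst x) t)) (snd x)) \<in> borel_measurable (borel \<Otimes>\<^sub>M F t)"
    using progressive_process[OF Z t] by (simp add: case_prod_beta)
  define A where "A = {x \<in> space (borel \<Otimes>\<^sub>M F t). Z (max 0 (min (fst x) t)) (snd x) < y}"
  have "A \<in> sets (borel \<Otimes>\<^sub>M F t)" unfolding A_def using Zt by measurable
  then have "{\<omega>\<in>space M. \<exists>s. (s, \<omega>) \<in> A} \<in> sets (F t)" by (rule projection_F[OF t])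
  moreover have "(INF u\<in>{0..t}. Z u \<omega>) < y \<longleftrightarrow> (\<exists>s. (s, \<omega>) \<in> A)" if \<omega>: "\<omega> \<in> space M" for \<omega>
  proof -
    have "(INF u\<in>{0..t}. Z u \<omega>) < y \<longleftrightarrow> (\<exists>u\<in>{0..t}. Z u \<omega> < y)"
      using t by (intro cINF_less_iff cadlag_bdd_below Z(2) \<omega>) auto
    also have "\<dots> \<longleftrightarrow> (\<exists>s. Z (max 0 (min s t)) \<omega> < y)"
    proof
      assume "\<exists>u\<in>{0..t}. Z u \<omega> < y"
      then obtain u where "0 \<le> u" "u \<le> t" "Z u \<omega> < y" by auto
      then show "\<exists>s. Z (max 0 (min s t)) \<omega> < y" by (intro exI[of _ u]) (simp add: min_absorb1 max_absorb2)
    next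
      assume "\<exists>s. Z (max 0 (min s t)) \<omega> < y"
      then obtain s where "Z (max 0 (min s t)) \<omega> < y" ..
      then show "\<exists>u\<in>{0..t}. Z u \<omega> < y" using t by (intro bexI[of _ "max 0 (min s t)"]) auto
    qed
    also have "\<dots> \<longleftrightarrow> (\<exists>s. (s, \<omega>) \<in> A)" using \<omega> t by (simp add: A_def space_pair_measure space_F)
    finally show ?thesis .
  qed
  ultimately show "{\<omega> \<in> space (F t). (INF u\<in>{0..t}. Z u \<omega>) < y} \<in> sets (F t)"
    using t by (simp add: space_F cong: conj_cong)
qed

text \<open>The supremum over dyadic times is measurable as a countable supremum, has a finite
  integral by the \<open>H1\<close> condition, and dominates the entire path by right
  continuity.\<close>

lemma H1_martingale_dominated:
  assumes X: "H1_martingale M F X"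
  shows "\<exists>w. integrable M w \<and> (AE \<omega> in M. \<forall>t\<ge>0. \<bar>X t \<omega>\<bar> \<le> w \<omega>)"
proof -
  define s where "s \<omega> = (SUP p::nat \<times> nat. ennreal \<bar>X (real (fst p) / 2 ^ snd p) \<omega>\<bar>)" for \<omega>
  have cm: "cadlag_martingale M F X" using X by (simp add: H1_martingale_def)
  have XM: "X t \<in> borel_measurable M" if "0 \<le> t" for t
    using cm that by (auto simp: cadlag_martingale_def)
  have s_meas[measurable]: "s \<in> borel_measurable M"
    unfolding s_def by (intro borel_measurable_SUP measurable_compose[OF _ measurable_ennreal] borel_measurable_abs XM) auto
  have "(\<integral>\<^sup>+\<omega>. s \<omega> \<partial>M) \<le> (\<integral>\<^sup>+\<omega>. (SUP t\<in>{0..}. ennreal \<bar>X t \<omega>\<bar>) \<partial>M)"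
    unfolding s_def by (intro nn_integral_mono SUP_least SUP_upper) auto
  also have "\<dots> < \<infinity>" using X by (simp add: H1_martingale_def)
  finally have fin: "(\<integral>\<^sup>+\<omega>. s \<omega> \<partial>M) < \<infinity>" .
  then have AE_fin: "AE \<omega> in M. s \<omega> \<noteq> \<infinity>" by (intro nn_integral_PInf_AE) auto
  define w where "w \<omega> = enn2real (s \<omega>)" for \<omega>
  have [measurable]: "w \<in> borel_measurable M" unfolding w_def[abs_def] by measurable
  have "integrable M w"
  proof (rule integrableI_nonneg)
    have "(\<integral>\<^sup>+\<omega>. ennreal (w \<omega>) \<partial>M) = (\<integral>\<^sup>+\<omega>. s \<omega> \<partial>M)"
      using AE_fin by (intro nn_integral_cong_AE) (auto simp: w_def less_top elim: eventually_mono)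
    then show "(\<integral>\<^sup>+\<omega>. ennreal (w \<omega>) \<partial>M) < \<infinity>" using fin by simp
  qed (auto simp: w_def)
  moreover have "AE \<omega> in M. \<forall>t\<ge>0. \<bar>X t \<omega>\<bar> \<le> w \<omega>"
    using AE_fin AE_space
  proof eventually_elim
    case (elim \<omega>)
    have grid: "\<bar>X (real i / 2 ^ n) \<omega>\<bar> \<le> w \<omega>" for i n
    proof -
      have "ennreal \<bar>X (real i / 2 ^ n) \<omega>\<bar> \<le> s \<omega>"
        unfolding s_def by (rule SUP_upper2[of "(i, n)"]) auto
      also have "s \<omega> = ennreal (w \<omega>)" using elim(1) by (simp add: w_def less_top)
      finally show ?thesis by (simp add: w_def)
    qed
    have cad: "cadlag (\<lambda>t. X t \<omega>)" using cm elim(2) by (simp add: cadlag_martingale_def)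
    show ?case
    proof (intro allI impI)
      fix t :: real assume t: "0 \<le> t"
      have "(\<lambda>n. X (dyadic_ceiling n t) \<omega>) \<longlonglongrightarrow> X t \<omega>"
        by (rule cadlag_dyadic_ceiling[OF cad t])
      then have "(\<lambda>n. \<bar>X (dyadic_ceiling n t) \<omega>\<bar>) \<longlonglongrightarrow> \<bar>X t \<omega>\<bar>" by (rule tendsto_rabs)
      then show "\<bar>X t \<omega>\<bar> \<le> w \<omega>"
        by (rule LIMSEQ_le_const2) (use grid in \<open>auto simp: dyadic_ceiling_def\<close>)
    qed
  qed
  ultimately show ?thesis by auto
qed

text \<open>The discretisation \<open>f n\<close> of \<open>X\<close> at \<open>\<rho>\<close> uses the left end points of the mesh, because
  \<open>J\<close> is only known to be the conditional probability with respect to the past. Its expectation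
  differs from that of the telescoping sum by the covariation sum \<open>g n\<close>, which vanishes in the
  limit as \<open>X\<close> is continuous and \<open>J\<close> decreasing.\<close>

lemma stopped_expectation:
  assumes X: "H1_martingale M F X" "AE \<omega> in M. continuous_on {0..} (\<lambda>t. X t \<omega>)"
    and J: "azema_supermartingale M F \<rho> J"
      "AE \<omega> in M. \<forall>s t. 0 \<le> s \<longrightarrow> s \<le> t \<longrightarrow> J t \<omega> \<le> J s \<omega>"
    and \<rho>[measurable]: "\<rho> \<in> borel_measurable M" and \<rho>_pos: "AE \<omega> in M. 0 < \<rho> \<omega>"
    and w: "integrable M w" "AE \<omega> in M. \<forall>t\<ge>0. \<bar>X t \<omega>\<bar> \<le> w \<omega>"
    and K: "0 < K"
  shows "(\<integral>\<omega>. X (enn2real (min (\<rho> \<omega>) (ennreal K))) \<omega> \<partial>M) = (\<integral>\<omega>. X 0 \<omega> \<partial>M)"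
    and "(\<lambda>\<omega>. X (enn2real (min (\<rho> \<omega>) (ennreal K))) \<omega>) \<in> borel_measurable M"
proof -
  have cm: "cadlag_martingale M F X" using X by (simp add: H1_martingale_def)
  have XF: "X t \<in> borel_measurable (F t)" and X_int: "integrable M (X t)" if "0 \<le> t" for t
    using cm that by (auto simp: cadlag_martingale_def adapted_def)
  have X_ce: "AE \<omega> in M. real_cond_exp M (F s) (X t) \<omega> = X s \<omega>" if "0 \<le> s" "s \<le> t" for s t
    using cm that by (auto simp: cadlag_martingale_def)
  have JF: "J t \<in> borel_measurable (F t)" if "0 \<le> t" for t
    using J(1) that by (auto simp: azema_supermartingale_def adapted_def)
  have J_range: "AE \<omega> in M. \<forall>t\<ge>0. 0 \<le> J t \<omega> \<and> J t \<omega> \<le> 1" by (rule azema_range[OF J(1) \<rho>])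
  define a :: "real \<Rightarrow> 'a \<Rightarrow> real" where "a t = indicator {\<omega>\<in>space M. ennreal t < \<rho> \<omega>}" for t
  have a_meas[measurable]: "a t \<in> borel_measurable M" for t unfolding a_def by measurable
  have J_ce: "AE \<omega> in M. J t \<omega> = real_cond_exp M (F t) (a t) \<omega>" if "0 \<le> t" for t
    using J(1) that by (auto simp: azema_supermartingale_def a_def)
  have JM: "J t \<in> borel_measurable M" if "0 \<le> t" for t using JF[OF that] that by (rule measurable_F_M)
  have XJ_int: "integrable M (\<lambda>\<omega>. X s \<omega> * J t \<omega>)" if "0 \<le> s" "0 \<le> t" for s t
  proof (rule Bochner_Integration.integrable_bound[OF X_int[OF that(1)]])
    show "(\<lambda>\<omega>. X s \<omega> * J t \<omega>) \<in> borel_measurable M"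
      using X_int[OF that(1)] JM[OF that(2)] by auto
    show "AE \<omega> in M. norm (X s \<omega> * J t \<omega>) \<le> norm (X s \<omega>)"
      using J_range
    proof eventually_elim
      case (elim \<omega>)
      then have "0 \<le> J t \<omega>" "J t \<omega> \<le> 1" using that by simp_all
      then show ?case by (simp add: abs_mult mult_left_le)
    qed
  qed
  have Xa_int: "integrable M (\<lambda>\<omega>. X s \<omega> * a t \<omega>)" if "0 \<le> s" for s t
  proof (rule Bochner_Integration.integrable_bound[OF X_int[OF that]])
    show "(\<lambda>\<omega>. X s \<omega> * a t \<omega>) \<in> borel_measurable M" using X_int[OF that] by auto
  qed (auto simp: a_def split: split_indicator)
  \<comment> \<open>Two rules move between the processes.
    \<open>E[X\<^sub>s; t < \<rho>] = E[X\<^sub>s J\<^sub>t]\<close> requires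
    \<open>X\<^sub>s\<close> to be known at \<open>t\<close>, and
    \<open>E[X\<^sub>t J\<^sub>s] = E[X\<^sub>s J\<^sub>s]\<close> is the martingale property tested
    with \<open>J\<^sub>s\<close>; both are valid for \<open>s \<le> t\<close>.\<close>
  have Xa: "(\<integral>\<omega>. X s \<omega> * a t \<omega> \<partial>M) = (\<integral>\<omega>. X s \<omega> * J t \<omega> \<partial>M)" if "0 \<le> s" "s \<le> t" for s t
  proof -
    have t: "0 \<le> t" using that by simp
    interpret sigma_finite_subalgebra M "F t" by (rule sigma_finite_subalgebra_F[OF t])
    have "(\<integral>\<omega>. X s \<omega> * real_cond_exp M (F t) (a t) \<omega> \<partial>M) = (\<integral>\<omega>. X s \<omega> * a t \<omega> \<partial>M)"
      by (rule real_cond_exp_intg(2)[OF Xa_int[OF that(1)] measurable_F_mono[OF XF[OF that(1)] that] a_meas])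
    moreover have "(\<integral>\<omega>. X s \<omega> * real_cond_exp M (F t) (a t) \<omega> \<partial>M) = (\<integral>\<omega>. X s \<omega> * J t \<omega> \<partial>M)"
    proof (rule integral_cong_AE)
      show "(\<lambda>\<omega>. X s \<omega> * real_cond_exp M (F t) (a t) \<omega>) \<in> borel_measurable M"
        using X_int[OF that(1)] by auto
      show "(\<lambda>\<omega>. X s \<omega> * J t \<omega>) \<in> borel_measurable M" using XJ_int[OF that(1) t] by simp
    qed (use J_ce[OF t] in auto)
    ultimately show ?thesis by simp
  qed
  have XJ: "(\<integral>\<omega>. X t \<omega> * J s \<omega> \<partial>M) = (\<integral>\<omega>. X s \<omega> * J s \<omega> \<partial>M)" if st: "0 \<le> s" "s \<le> t" for s t
  proof -
    have t: "0 \<le> t" using st by simp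
    interpret sigma_finite_subalgebra M "F s" by (rule sigma_finite_subalgebra_F[OF st(1)])
    have XtM: "X t \<in> borel_measurable M" using X_int[OF t] by simp
    have "integrable M (\<lambda>\<omega>. J s \<omega> * X t \<omega>)" using XJ_int[OF t st(1)] by (simp add: mult.commute)
    from real_cond_exp_intg(2)[OF this JF[OF st(1)] XtM]
    have "(\<integral>\<omega>. J s \<omega> * real_cond_exp M (F s) (X t) \<omega> \<partial>M) = (\<integral>\<omega>. J s \<omega> * X t \<omega> \<partial>M)" .
    moreover have "(\<integral>\<omega>. J s \<omega> * real_cond_exp M (F s) (X t) \<omega> \<partial>M) = (\<integral>\<omega>. J s \<omega> * X s \<omega> \<partial>M)"
    proof (rule integral_cong_AE)
      show "(\<lambda>\<omega>. J s \<omega> * real_cond_exp M (F s) (X t) \<omega>) \<in> borel_measurable M"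
        using JM[OF st(1)] by auto
      show "(\<lambda>\<omega>. J s \<omega> * X s \<omega>) \<in> borel_measurable M" using JM[OF st(1)] X_int[OF st(1)] by auto
    qed (use X_ce[OF st] in auto)
    ultimately show ?thesis by (simp add: mult.commute)
  qed
  define \<tau> where "\<tau> n k = real k * K / real (Suc n)" for n k
  have \<tau>_Suc: "\<tau> n (Suc k) = \<tau> n k + K / real (Suc n)" for n k
    by (simp add: \<tau>_def distrib_right add_divide_distrib)
  have \<tau>: "0 \<le> \<tau> n k" "\<tau> n k \<le> \<tau> n (Suc k)" "\<tau> n 0 = 0" "\<tau> n (Suc n) = K" for n k
  proof -
    show "\<tau> n k \<le> \<tau> n (Suc k)" using K by (simp add: \<tau>_Suc)
  qed (use K in \<open>simp_all add: \<tau>_def\<close>)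
  have \<tau>_le: "\<tau> n k \<le> K" if "k \<le> Suc n" for n k
    using lift_Suc_mono_le[of "\<tau> n", OF \<tau>(2) that] \<tau>(4) by simp
  \<comment> \<open>The last summand \<open>X K * a K\<close> accounts for
    \<open>\<rho> > K\<close>, where the truncated time is \<open>K\<close>.\<close>
  define f where "f n \<omega> = (\<Sum>k<Suc n. X (\<tau> n k) \<omega> * (a (\<tau> n k) \<omega> - a (\<tau> n (Suc k)) \<omega>)) + X K \<omega> * a K \<omega>" for n \<omega>
  define g where "g n \<omega> = (\<Sum>k<Suc n. (X (\<tau> n (Suc k)) \<omega> - X (\<tau> n k) \<omega>) * (J (\<tau> n k) \<omega> - J (\<tau> n (Suc k)) \<omega>))" for n \<omega>
  define v where "v \<omega> = X (enn2real (min (\<rho> \<omega>) (ennreal K))) \<omega>" for \<omega>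
  let ?E = "\<lambda>s t. \<integral>\<omega>. X s \<omega> * J t \<omega> \<partial>M"
  have f_int: "integrable M (f n)" for n
    unfolding f_def right_diff_distrib using K by (intro Bochner_Integration.integrable_add
      Bochner_Integration.integrable_sum Bochner_Integration.integrable_diff Xa_int \<tau>) auto
  have g_int: "integrable M (g n)" for n
    unfolding g_def right_diff_distrib left_diff_distrib
    by (intro Bochner_Integration.integrable_sum Bochner_Integration.integrable_diff XJ_int \<tau>)
  have Ef: "(\<integral>\<omega>. f n \<omega> \<partial>M) = (\<Sum>k<Suc n. ?E (\<tau> n k) (\<tau> n k) - ?E (\<tau> n k) (\<tau> n (Suc k))) + ?E K K" for n
  proof -
    have "(\<integral>\<omega>. f n \<omega> \<partial>M) = (\<Sum>k<Suc n. (\<integral>\<omega>. X (\<tau> n k) \<omega> * a (\<tau> n k) \<omega> \<partial>M) - (\<integral>\<omega>. X (\<tau> n k) \<omega> * a (\<tau> n (Suc k)) \<omega> \<partial>M))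
        + (\<integral>\<omega>. X K \<omega> * a K \<omega> \<partial>M)"
      unfolding f_def right_diff_distrib using K
      by (simp only: Bochner_Integration.integral_add Bochner_Integration.integral_sum Bochner_Integration.integral_diff
        Bochner_Integration.integrable_add Bochner_Integration.integrable_sum Bochner_Integration.integrable_diff
        Xa_int \<tau> less_imp_le)
    also have "\<dots> = (\<Sum>k<Suc n. ?E (\<tau> n k) (\<tau> n k) - ?E (\<tau> n k) (\<tau> n (Suc k))) + ?E K K"
      using K by (simp only: Xa \<tau> order_refl less_imp_le)
    finally show ?thesis .
  qed
  have Eg: "(\<integral>\<omega>. g n \<omega> \<partial>M) = (\<Sum>k<Suc n. ?E (\<tau> n k) (\<tau> n (Suc k)) - ?E (\<tau> n (Suc k)) (\<tau> n (Suc k)))" for n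
  proof -
    have "(\<integral>\<omega>. g n \<omega> \<partial>M) = (\<Sum>k<Suc n. ?E (\<tau> n (Suc k)) (\<tau> n k) - ?E (\<tau> n k) (\<tau> n k) -
        (?E (\<tau> n (Suc k)) (\<tau> n (Suc k)) - ?E (\<tau> n k) (\<tau> n (Suc k))))"
      unfolding g_def right_diff_distrib left_diff_distrib
      by (simp only: Bochner_Integration.integral_sum Bochner_Integration.integral_diff
        Bochner_Integration.integrable_sum Bochner_Integration.integrable_diff XJ_int \<tau>)
    also have "\<dots> = (\<Sum>k<Suc n. ?E (\<tau> n k) (\<tau> n (Suc k)) - ?E (\<tau> n (Suc k)) (\<tau> n (Suc k)))"
      by (rule sum.cong[OF refl]) (simp add: XJ[OF \<tau>(1) \<tau>(2)])
    finally show ?thesis .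
  qed
  \<comment> \<open>Adding \<open>g n\<close> turns the mixed terms
    \<open>?E (\<tau> n k) (\<tau> n (Suc k))\<close> of \<open>f n\<close> into diagonal ones. The
    sum then telescopes to \<open>?E 0 0\<close>, which is \<open>E[X\<^sub>0]\<close> because
    \<open>\<rho> > 0\<close> almost surely.\<close>
  have "(\<integral>\<omega>. f n \<omega> \<partial>M) + (\<integral>\<omega>. g n \<omega> \<partial>M) = (\<integral>\<omega>. X 0 \<omega> \<partial>M)" for n
  proof -
    have "(\<integral>\<omega>. f n \<omega> \<partial>M) + (\<integral>\<omega>. g n \<omega> \<partial>M) =
        (\<Sum>k<Suc n. ?E (\<tau> n k) (\<tau> n k) - ?E (\<tau> n (Suc k)) (\<tau> n (Suc k))) + ?E K K"
      unfolding Ef Eg by (simp add: sum_subtractf del: sum.lessThan_Suc)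
    also have "\<dots> = ?E 0 0"
      using sum_lessThan_telescope'[of "\<lambda>k. ?E (\<tau> n k) (\<tau> n k)" "Suc n"] by (simp add: \<tau> del: sum.lessThan_Suc)
    also have "\<dots> = (\<integral>\<omega>. X 0 \<omega> * a 0 \<omega> \<partial>M)" by (simp add: Xa)
    also have "\<dots> = (\<integral>\<omega>. X 0 \<omega> \<partial>M)"
    proof (rule integral_cong_AE)
      show "AE \<omega> in M. X 0 \<omega> * a 0 \<omega> = X 0 \<omega>"
        using \<rho>_pos AE_space by eventually_elim (simp add: a_def)
    qed (use X_int[of 0] Xa_int[of 0] in auto)
    finally show ?thesis .
  qed
  moreover have limits: "AE \<omega> in M. ((\<lambda>n. f n \<omega>) \<longlonglongrightarrow> v \<omega>) \<and> ((\<lambda>n. g n \<omega>) \<longlonglongrightarrow> 0)"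
    using X(2) J(2) J_range \<rho>_pos AE_space
  proof eventually_elim
    case (elim \<omega>)
    have a_dec: "a (\<tau> n (Suc k)) \<omega> \<le> a (\<tau> n k) \<omega>" for n k
      using \<tau>(1,2)[of n k] by (auto simp: a_def split: split_indicator intro: le_less_trans[OF ennreal_leI])
    have a0: "a 0 \<omega> = 1" using elim by (simp add: a_def)
    have a_range: "0 \<le> a t \<omega>" "a t \<omega> \<le> 1" for t by (auto simp: a_def split: split_indicator)
    have J_dec: "J (\<tau> n (Suc k)) \<omega> \<le> J (\<tau> n k) \<omega>" for n k using elim(2) \<tau>(1,2) by blast
    have unif: "\<exists>n0. \<forall>n\<ge>n0. \<forall>s\<in>{0..K}. \<forall>t\<in>{0..K}. \<bar>s - t\<bar> \<le> K / real (Suc n) \<longrightarrow> \<bar>X s \<omega> - X t \<omega>\<bar> < e" if e: "0 < e" for e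
    proof -
      have "uniformly_continuous_on {0..K} (\<lambda>t. X t \<omega>)"
        by (intro compact_uniformly_continuous continuous_on_subset[OF elim(1)]) auto
      then obtain d where d: "0 < d" "\<forall>s\<in>{0..K}. \<forall>t\<in>{0..K}. dist t s < d \<longrightarrow> dist (X t \<omega>) (X s \<omega>) < e"
        unfolding uniformly_continuous_on_def using e by auto
      have "(\<lambda>n. K / real (Suc n)) \<longlonglongrightarrow> 0" by (rule LIMSEQ_Suc[OF lim_const_over_n])
      then have "eventually (\<lambda>n. K / real (Suc n) < d) sequentially" using d(1) by (rule order_tendstoD)
      then obtain n0 where n0: "\<And>n. n0 \<le> n \<Longrightarrow> K / real (Suc n) < d" unfolding eventually_sequentially by auto
      have "\<bar>X s \<omega> - X t \<omega>\<bar> < e" if "n0 \<le> n" "s \<in> {0..K}" "t \<in> {0..K}" "\<bar>s - t\<bar> \<le> K / real (Suc n)" for n s t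
        using d(2) that n0[OF that(1)] by (auto simp: dist_real_def)
      then show ?thesis by blast
    qed
    have "(\<lambda>n. f n \<omega>) \<longlonglongrightarrow> v \<omega>"
    proof (rule LIMSEQ_I)
      fix e :: real assume e: "0 < e"
      then obtain n0 where n0: "\<forall>n\<ge>n0. \<forall>s\<in>{0..K}. \<forall>t\<in>{0..K}. \<bar>s - t\<bar> \<le> K / real (Suc n) \<longrightarrow> \<bar>X s \<omega> - X t \<omega>\<bar> < e / 2"
        using unif[of "e / 2"] by auto
      have "norm (f n \<omega> - v \<omega>) < e" if n: "n0 \<le> n" for n
      proof -
        have tel: "(\<Sum>k<Suc n. a (\<tau> n k) \<omega> - a (\<tau> n (Suc k)) \<omega>) = 1 - a K \<omega>"
          using sum_lessThan_telescope'[of "\<lambda>k. a (\<tau> n k) \<omega>" "Suc n"] by (simp add: \<tau> a0 del: sum.lessThan_Suc)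
        have vK: "X K \<omega> * a K \<omega> = v \<omega> * a K \<omega>"
        proof (cases "ennreal K < \<rho> \<omega>")
          case True
          then have "min (\<rho> \<omega>) (ennreal K) = ennreal K" by (intro min_absorb2 less_imp_le)
          then show ?thesis using K by (simp add: v_def)
        qed (simp add: a_def)
        define D where "D k = a (\<tau> n k) \<omega> - a (\<tau> n (Suc k)) \<omega>" for k
        have "(\<Sum>k<Suc n. (X (\<tau> n k) \<omega> - v \<omega>) * D k) = (\<Sum>k<Suc n. X (\<tau> n k) \<omega> * D k) - v \<omega> * (\<Sum>k<Suc n. D k)"
          by (simp add: left_diff_distrib sum_subtractf sum_distrib_left del: sum.lessThan_Suc)
        also have "(\<Sum>k<Suc n. D k) = 1 - a K \<omega>" using tel by (simp add: D_def del: sum.lessThan_Suc)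
        also have "(\<Sum>k<Suc n. X (\<tau> n k) \<omega> * D k) = f n \<omega> - v \<omega> * a K \<omega>"
          unfolding f_def vK D_def by simp
        finally have "f n \<omega> - v \<omega> = (\<Sum>k<Suc n. (X (\<tau> n k) \<omega> - v \<omega>) * (a (\<tau> n k) \<omega> - a (\<tau> n (Suc k)) \<omega>))"
          unfolding D_def by (simp add: algebra_simps del: sum.lessThan_Suc)
        \<comment> \<open>Only the mesh interval in which \<open>\<rho>\<close> falls contributes.
          Its left end point is within one mesh width of \<open>\<rho>\<close>, so uniform
          continuity on \<open>[0, K]\<close> bounds the difference of the values.\<close>
        also have "\<bar>\<dots>\<bar> \<le> e / 2 * (a (\<tau> n 0) \<omega> - a (\<tau> n (Suc n)) \<omega>)"
        proof (rule abs_sum_decrements_le)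
          show "a (\<tau> n (Suc k)) \<omega> \<le> a (\<tau> n k) \<omega>" for k by (rule a_dec)
        next
          fix k assume k: "k < Suc n" "a (\<tau> n k) \<omega> \<noteq> a (\<tau> n (Suc k)) \<omega>"
          then have "ennreal (\<tau> n k) < \<rho> \<omega>" "\<not> ennreal (\<tau> n (Suc k)) < \<rho> \<omega>"
            using a_dec[of n k] elim(5) by (auto simp: a_def split: split_indicator_asm)
          then obtain r where r: "\<rho> \<omega> = ennreal r" "0 \<le> r" "\<tau> n k < r" "r \<le> \<tau> n (Suc k)"
            using \<tau>(1) by (cases "\<rho> \<omega>") (auto simp: ennreal_less_iff)
          have "r \<le> K" using r(4) \<tau>_le[of "Suc k" n] k by simp
          then have "v \<omega> = X r \<omega>" using r by (simp add: v_def min_absorb1)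
          moreover have "\<bar>\<tau> n k - r\<bar> \<le> K / real (Suc n)" using r \<tau>_Suc[of n k] by simp
          moreover have "\<tau> n k \<in> {0..K}" "r \<in> {0..K}" using \<tau>(1)[of n k] r \<open>r \<le> K\<close> by auto
          ultimately show "\<bar>X (\<tau> n k) \<omega> - v \<omega>\<bar> \<le> e / 2" using n0 n by (auto intro: less_imp_le)
        qed
        also have "\<dots> \<le> e / 2 * 1"
          using a_range[of "\<tau> n 0"] a_range[of "\<tau> n (Suc n)"] e by (intro mult_left_mono) auto
        also have "\<dots> < e" using e by simp
        finally show ?thesis by simp
      qed
      then show "\<exists>n0. \<forall>n\<ge>n0. norm (f n \<omega> - v \<omega>) < e" by blast
    qed
    moreover have "(\<lambda>n. g n \<omega>) \<longlonglongrightarrow> 0"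
    proof (rule LIMSEQ_I)
      fix e :: real assume e: "0 < e"
      then obtain n0 where n0: "\<forall>n\<ge>n0. \<forall>s\<in>{0..K}. \<forall>t\<in>{0..K}. \<bar>s - t\<bar> \<le> K / real (Suc n) \<longrightarrow> \<bar>X s \<omega> - X t \<omega>\<bar> < e / 2"
        using unif[of "e / 2"] by auto
      have "norm (g n \<omega> - 0) < e" if n: "n0 \<le> n" for n
      proof -
        have "\<bar>g n \<omega>\<bar> \<le> e / 2 * (J (\<tau> n 0) \<omega> - J (\<tau> n (Suc n)) \<omega>)"
          unfolding g_def
        proof (rule abs_sum_decrements_le)
          show "J (\<tau> n (Suc k)) \<omega> \<le> J (\<tau> n k) \<omega>" for k by (rule J_dec)
        next
          fix k assume k: "k < Suc n"
          have "\<bar>\<tau> n (Suc k) - \<tau> n k\<bar> \<le> K / real (Suc n)" using \<tau>_Suc[of n k] K by simp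
          moreover have "\<tau> n k \<in> {0..K}" "\<tau> n (Suc k) \<in> {0..K}" using \<tau>(1)[of n] \<tau>_le[of _ n] k by auto
          ultimately show "\<bar>X (\<tau> n (Suc k)) \<omega> - X (\<tau> n k) \<omega>\<bar> \<le> e / 2" using n0 n by (auto intro: less_imp_le)
        qed
        also have "\<dots> \<le> e / 2 * 1"
          using elim(3) \<tau>(1)[of n 0] \<tau>(1)[of n "Suc n"] e by (intro mult_left_mono) (auto simp: diff_le_eq intro: add_increasing2)
        also have "\<dots> < e" using e by simp
        finally show ?thesis by simp
      qed
      then show "\<exists>n0. \<forall>n\<ge>n0. norm (g n \<omega> - 0) < e" by blast
    qed
    ultimately show ?case by simp
  qed
  then have f_lim: "AE \<omega> in M. (\<lambda>n. f n \<omega>) \<longlonglongrightarrow> v \<omega>" and g_lim: "AE \<omega> in M. (\<lambda>n. g n \<omega>) \<longlonglongrightarrow> 0" by auto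
  have f_meas: "f n \<in> borel_measurable M" and g_meas: "g n \<in> borel_measurable M" for n
    using f_int g_int by simp_all
  have v_meas: "v \<in> borel_measurable M" by (rule measurable_AE_LIMSEQ[OF f_meas f_lim])
  have bounds: "AE \<omega> in M. norm (f n \<omega>) \<le> w \<omega> \<and> norm (g n \<omega>) \<le> 2 * w \<omega>" for n
    using w(2) J(2) J_range
  proof eventually_elim
    case (elim \<omega>)
    have Xw: "\<bar>X t \<omega>\<bar> \<le> w \<omega>" if "0 \<le> t" for t using elim(1) that by simp
    have w0: "0 \<le> w \<omega>" using Xw[of 0] by simp
    have a_dec: "a (\<tau> n (Suc k)) \<omega> \<le> a (\<tau> n k) \<omega>" for k
      using \<tau>(1,2)[of n k] by (auto simp: a_def split: split_indicator intro: le_less_trans[OF ennreal_leI])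
    have J_dec: "J (\<tau> n (Suc k)) \<omega> \<le> J (\<tau> n k) \<omega>" for k using elim(2) \<tau>(1,2) by blast
    have a_range: "0 \<le> a t \<omega>" "a t \<omega> \<le> 1" for t by (auto simp: a_def split: split_indicator)
    have "\<bar>\<Sum>k<Suc n. X (\<tau> n k) \<omega> * (a (\<tau> n k) \<omega> - a (\<tau> n (Suc k)) \<omega>)\<bar> \<le> w \<omega> * (a (\<tau> n 0) \<omega> - a (\<tau> n (Suc n)) \<omega>)"
      by (rule abs_sum_decrements_le) (rule a_dec, rule Xw[OF \<tau>(1)])
    moreover have "\<bar>X K \<omega> * a K \<omega>\<bar> \<le> w \<omega> * a K \<omega>"
      using Xw[of K] K a_range[of K] by (auto simp: abs_mult intro!: mult_right_mono)
    ultimately have "\<bar>f n \<omega>\<bar> \<le> w \<omega> * (a 0 \<omega> - a K \<omega>) + w \<omega> * a K \<omega>"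
      unfolding f_def \<tau>(3,4) by (rule order_trans[OF abs_triangle_ineq add_mono])
    also have "\<dots> = w \<omega> * a 0 \<omega>" by (simp add: algebra_simps)
    also have "\<dots> \<le> w \<omega> * 1" using a_range w0 by (intro mult_left_mono)
    finally have "norm (f n \<omega>) \<le> w \<omega>" by simp
    moreover have "\<bar>g n \<omega>\<bar> \<le> 2 * w \<omega> * (J (\<tau> n 0) \<omega> - J (\<tau> n (Suc n)) \<omega>)"
      unfolding g_def
    proof (rule abs_sum_decrements_le)
      show "J (\<tau> n (Suc k)) \<omega> \<le> J (\<tau> n k) \<omega>" for k by (rule J_dec)
    next
      show "\<bar>X (\<tau> n (Suc k)) \<omega> - X (\<tau> n k) \<omega>\<bar> \<le> 2 * w \<omega>" for k
        using Xw[OF \<tau>(1), of n k] Xw[OF \<tau>(1), of n "Suc k"] by linarith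
    qed
    moreover have "2 * w \<omega> * (J (\<tau> n 0) \<omega> - J (\<tau> n (Suc n)) \<omega>) \<le> 2 * w \<omega> * 1"
      using elim(3) \<tau>(1)[of n 0] \<tau>(1)[of n "Suc n"] w0
      by (intro mult_left_mono) (auto simp: diff_le_eq intro: add_increasing2)
    ultimately show ?case by simp
  qed
  have w2: "integrable M (\<lambda>\<omega>. 2 * w \<omega>)" using w(1) by simp
  have f_bound: "AE \<omega> in M. norm (f n \<omega>) \<le> w \<omega>" and g_bound: "AE \<omega> in M. norm (g n \<omega>) \<le> 2 * w \<omega>" for n
    using bounds[of n] by auto
  have "(\<lambda>n. \<integral>\<omega>. f n \<omega> \<partial>M) \<longlonglongrightarrow> (\<integral>\<omega>. v \<omega> \<partial>M)"
    by (rule integral_dominated_convergence[OF v_meas f_meas w(1) f_lim f_bound])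
  moreover have "(\<lambda>n. \<integral>\<omega>. g n \<omega> \<partial>M) \<longlonglongrightarrow> (\<integral>\<omega>. 0 \<partial>M)"
    by (rule integral_dominated_convergence[OF _ g_meas w2 g_lim g_bound]) simp
  ultimately have "(\<lambda>n. (\<integral>\<omega>. f n \<omega> \<partial>M) + (\<integral>\<omega>. g n \<omega> \<partial>M)) \<longlonglongrightarrow> (\<integral>\<omega>. v \<omega> \<partial>M) + (\<integral>\<omega>. 0 \<partial>M)"
    by (intro tendsto_add)
  then have "(\<integral>\<omega>. v \<omega> \<partial>M) = (\<integral>\<omega>. X 0 \<omega> \<partial>M)"
    using \<open>\<And>n. (\<integral>\<omega>. f n \<omega> \<partial>M) + (\<integral>\<omega>. g n \<omega> \<partial>M) = (\<integral>\<omega>. X 0 \<omega> \<partial>M)\<close> by (simp add: LIMSEQ_const_iff)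
  then show "(\<integral>\<omega>. X (enn2real (min (\<rho> \<omega>) (ennreal K))) \<omega> \<partial>M) = (\<integral>\<omega>. X 0 \<omega> \<partial>M)"
    by (simp add: v_def)
  show "(\<lambda>\<omega>. X (enn2real (min (\<rho> \<omega>) (ennreal K))) \<omega>) \<in> borel_measurable M"
    using v_meas by (simp add: v_def[abs_def])
qed

text \<open>Since \<open>\<rho>\<close> is finite almost surely, truncation at \<open>n + 1\<close>
  eventually has no effect on the value of \<open>X\<close>, and the integrable bound on the whole
  path allows the horizon to be removed.\<close>

theorem pseudo_stopping_time_decreasing_azema:
  assumes cont: "\<And>X. cadlag_martingale M F X \<Longrightarrow> AE \<omega> in M. continuous_on {0..} (\<lambda>t. X t \<omega>)"
    and J: "azema_supermartingale M F \<rho> J"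
      "AE \<omega> in M. \<forall>s t. 0 \<le> s \<longrightarrow> s \<le> t \<longrightarrow> J t \<omega> \<le> J s \<omega>"
    and \<rho>: "\<rho> \<in> borel_measurable M" "AE \<omega> in M. 0 < \<rho> \<omega> \<and> \<rho> \<omega> < \<infinity>"
  shows "pseudo_stopping_time M F \<rho>"
  unfolding pseudo_stopping_time_def
proof (intro conjI allI impI \<rho>(1))
  fix X assume X: "H1_martingale M F X"
  have X_cont: "AE \<omega> in M. continuous_on {0..} (\<lambda>t. X t \<omega>)" using X by (intro cont) (simp add: H1_martingale_def)
  obtain w where w: "integrable M w" "AE \<omega> in M. \<forall>t\<ge>0. \<bar>X t \<omega>\<bar> \<le> w \<omega>"
    using H1_martingale_dominated[OF X] by auto
  have \<rho>_pos: "AE \<omega> in M. 0 < \<rho> \<omega>" using \<rho>(2) by auto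
  define v where "v n \<omega> = X (enn2real (min (\<rho> \<omega>) (ennreal (real (Suc n))))) \<omega>" for n \<omega>
  have v: "(\<integral>\<omega>. v n \<omega> \<partial>M) = (\<integral>\<omega>. X 0 \<omega> \<partial>M)" "v n \<in> borel_measurable M" for n
    unfolding v_def using stopped_expectation[OF X X_cont J \<rho>(1) \<rho>_pos w, of "real (Suc n)"] by simp_all
  have lim: "AE \<omega> in M. (\<lambda>n. v n \<omega>) \<longlonglongrightarrow> process_at X \<rho> \<omega>"
    using \<rho>(2)
  proof eventually_elim
    case (elim \<omega>)
    then obtain r where r: "\<rho> \<omega> = ennreal r" "0 \<le> r" by (cases "\<rho> \<omega>") auto
    obtain n0 :: nat where n0: "r \<le> real n0" using real_arch_simple by auto
    have "v n \<omega> = process_at X \<rho> \<omega>" if "n0 \<le> n" for n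
    proof -
      have "min (\<rho> \<omega>) (ennreal (real (Suc n))) = ennreal r"
        unfolding r(1) using n0 that by (intro min_absorb1 ennreal_leI) simp
      then show ?thesis using r by (simp add: v_def process_at_def)
    qed
    then have "eventually (\<lambda>n. v n \<omega> = process_at X \<rho> \<omega>) sequentially"
      unfolding eventually_sequentially by blast
    then show ?case by (rule tendsto_eventually)
  qed
  have bound: "AE \<omega> in M. norm (v n \<omega>) \<le> w \<omega>" for n
    using w(2) by eventually_elim (simp add: v_def)
  have "(\<lambda>n. \<integral>\<omega>. v n \<omega> \<partial>M) \<longlonglongrightarrow> (\<integral>\<omega>. process_at X \<rho> \<omega> \<partial>M)"
    by (rule integral_dominated_convergence[OF measurable_AE_LIMSEQ[OF v(2) lim] v(2) w(1) lim bound])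
  then show "(\<integral>\<omega>. process_at X \<rho> \<omega> \<partial>M) = (\<integral>\<omega>. X 0 \<omega> \<partial>M)" by (simp add: v(1) LIMSEQ_const_iff)
qed

end

section \<open>The minimum before the honest time\<close>

context honest_time
begin

section \<open>The range of \<open>Z\<close>, and stopping times at which it reaches a given
  level\<close>

lemma AE_Z_0: "AE \<omega> in M. Z 0 \<omega> = 1"
proof -
  interpret sigma_finite_subalgebra M "F 0" by (rule sigma_finite_subalgebra_F) simp
  let ?W = "indicator {\<omega>\<in>space M. ennreal 0 < L \<omega>} :: 'a \<Rightarrow> real"
  have eq: "AE \<omega> in M. ?W \<omega> = 1" using AE_L AE_space by eventually_elim auto
  have "AE \<omega> in M. real_cond_exp M (F 0) ?W \<omega> = real_cond_exp M (F 0) (\<lambda>_. 1) \<omega>"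
    by (rule real_cond_exp_cong[OF eq]) auto
  moreover have "AE \<omega> in M. real_cond_exp M (F 0) (\<lambda>_. 1::real) \<omega> = 1" by (rule real_cond_exp_F_meas) auto
  moreover have "AE \<omega> in M. Z 0 \<omega> = real_cond_exp M (F 0) ?W \<omega>" by (rule Z_cond_exp) simp
  ultimately show ?thesis by eventually_elim simp
qed

text \<open>The means \<open>E[Z\<^sub>n] = P[n < L]\<close> tend to 0 because \<open>L\<close> is
  finite, so \<open>Z\<close> cannot stay above \<open>e\<close> at all integers with positive
  probability. Positive levels are therefore reached in finite time.\<close>

lemma AE_inf_Z: "AE \<omega> in M. \<forall>e>0. \<exists>t\<ge>0. Z t \<omega> < e"
proof -
  have "AE \<omega> in M. \<exists>n::nat. Z (real n) \<omega> < e" if e: "0 < e" for e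
  proof -
    have ZM[measurable]: "Z (real n) \<in> borel_measurable M" for n by (rule Z_measurable) simp
    define A where "A = {\<omega>\<in>space M. \<forall>n::nat. e \<le> Z (real n) \<omega>}"
    have A[measurable]: "A \<in> sets M" unfolding A_def by measurable
    have bound: "e * prob A \<le> prob {\<omega>\<in>space M. ennreal (real n) < L \<omega>}" for n
    proof -
      interpret sigma_finite_subalgebra M "F (real n)" by (rule sigma_finite_subalgebra_F) simp
      let ?W = "indicator {\<omega>\<in>space M. ennreal (real n) < L \<omega>} :: 'a \<Rightarrow> real"
      have W: "integrable M ?W" by (rule integrable_const_bound[where B=1]) (auto split: split_indicator)
      have Z_eq: "AE \<omega> in M. Z (real n) \<omega> = real_cond_exp M (F (real n)) ?W \<omega>" by (rule Z_cond_exp) simp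
      have int: "integrable M (Z (real n))"
        using real_cond_exp_int(1)[OF W] Z_eq by (subst integrable_cong_AE[OF ZM _ Z_eq]) auto
      have "e * prob A = (\<integral>\<omega>. e * indicator A \<omega> \<partial>M)" by simp
      also have "\<dots> \<le> (\<integral>\<omega>. Z (real n) \<omega> \<partial>M)"
      proof (rule integral_mono_AE[OF _ int])
        show "integrable M (\<lambda>\<omega>. e * indicator A \<omega>)"
          by (rule integrable_const_bound[where B=e]) (use e in \<open>auto split: split_indicator\<close>)
        show "AE \<omega> in M. e * indicator A \<omega> \<le> Z (real n) \<omega>"
          using AE_Z_range by eventually_elim (auto simp: A_def split: split_indicator)
      qed
      also have "\<dots> = (\<integral>\<omega>. real_cond_exp M (F (real n)) ?W \<omega> \<partial>M)" using Z_eq by (intro integral_cong_AE) auto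
      also have "\<dots> = (\<integral>\<omega>. ?W \<omega> \<partial>M)" by (rule real_cond_exp_int(2)[OF W])
      finally show ?thesis by simp
    qed
    have "(\<lambda>n. prob {\<omega>\<in>space M. ennreal (real n) < L \<omega>}) \<longlonglongrightarrow> prob (\<Inter>n. {\<omega>\<in>space M. ennreal (real n) < L \<omega>})"
    proof (rule finite_Lim_measure_decseq)
      show "decseq (\<lambda>n. {\<omega>\<in>space M. ennreal (real n) < L \<omega>})"
        unfolding decseq_def
      proof (intro allI impI subsetI)
        fix m n \<omega> assume "m \<le> n" "\<omega> \<in> {\<omega>\<in>space M. ennreal (real n) < L \<omega>}"
        then show "\<omega> \<in> {\<omega>\<in>space M. ennreal (real m) < L \<omega>}"
          using le_less_trans[of "ennreal (real m)" "ennreal (real n)" "L \<omega>"] by (simp add: ennreal_leI)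
      qed
    qed auto
    moreover have "prob (\<Inter>n. {\<omega>\<in>space M. ennreal (real n) < L \<omega>}) = 0"
    proof (rule prob_eq_0[THEN iffD2])
      show "AE \<omega> in M. \<omega> \<notin> (\<Inter>n. {\<omega>\<in>space M. ennreal (real n) < L \<omega>})"
        using AE_L
      proof eventually_elim
        case (elim \<omega>)
        then obtain l where l: "L \<omega> = ennreal l" by (cases "L \<omega>") auto
        obtain n :: nat where "l \<le> real n" using real_arch_simple by auto
        then have "\<not> ennreal (real n) < L \<omega>" unfolding l by (simp add: not_less ennreal_leI)
        then show ?case by auto
      qed
    qed auto
    ultimately have "e * prob A \<le> 0" using bound by (intro LIMSEQ_le_const) auto
    then have "prob A = 0" using e measure_nonneg[of M A] by (simp add: mult_le_0_iff)
    then have "AE \<omega> in M. \<omega> \<notin> A" using prob_eq_0[OF A] by simp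
    then show ?thesis using AE_space by eventually_elim (auto simp: A_def not_le)
  qed
  then have "AE \<omega> in M. \<forall>k. \<exists>n::nat. Z (real n) \<omega> < 1 / real (Suc k)" unfolding AE_all_countable by simp
  then show ?thesis
  proof eventually_elim
    case (elim \<omega>)
    show ?case
    proof (intro allI impI)
      fix e :: real assume "0 < e"
      then obtain k where k: "1 / real (Suc k) < e" using nat_approx_posE by auto
      obtain n :: nat where "Z (real n) \<omega> < 1 / real (Suc k)" using elim by auto
      then show "\<exists>t\<ge>0. Z t \<omega> < e" using k by (intro exI[of _ "real n"]) auto
    qed
  qed
qed

definition hitting_time :: "real \<Rightarrow> 'a set \<Rightarrow> ('a \<Rightarrow> real) \<Rightarrow> 'a \<Rightarrow> ennreal" where
  "hitting_time t A Y = debut {(u, \<omega>). t < u \<and> \<omega> \<in> A \<and> Z u \<omega> \<le> Y \<omega>}"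

lemma hitting_time_less_iff:
  assumes "0 \<le> t"
  shows "hitting_time t A Y \<omega> < ennreal l \<longleftrightarrow> \<omega> \<in> A \<and> (\<exists>u. t < u \<and> u < l \<and> Z u \<omega> \<le> Y \<omega>)"
proof -
  have "0 \<le> u" if "t < u" for u using assms that by simp
  then show ?thesis unfolding hitting_time_def debut_less_iff by fastforce
qed

lemma ext_stopping_time_hitting_time:
  assumes t: "0 \<le> t" and A: "A \<in> sets (F t)" and Y: "Y \<in> borel_measurable (F t)"
  shows "ext_stopping_time F (hitting_time t A Y)"
  unfolding hitting_time_def
proof (rule ext_stopping_time_debut, rule progressiveI)
  fix u :: real assume u: "0 \<le> u"
  have Zu[measurable]: "(\<lambda>x. Z (max 0 (min (fst x) u)) (snd x)) \<in> borel_measurable (borel \<Otimes>\<^sub>M F u)"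
    using progressive_process[OF Z_adapted Z_cadlag u] by (simp add: case_prod_beta)
  \<comment> \<open>The conjunct \<open>t < u\<close> follows from \<open>t < s\<close> and
    \<open>s \<le> u\<close>. It empties the set for horizons up to \<open>t\<close>, at which
    \<open>A\<close> and \<open>Y\<close> need not be measurable.\<close>
  show "Measurable.pred (borel \<Otimes>\<^sub>M F u)
      (\<lambda>x. t < u \<and> t < fst x \<and> snd x \<in> A \<and> Z (max 0 (min (fst x) u)) (snd x) \<le> Y (snd x))"
  proof (cases "t < u")
    case True
    have [measurable]: "A \<in> sets (F u)" by (rule sets_F_mono'[OF A t]) (use True in simp)
    have "Y \<in> borel_measurable (F u)" by (rule measurable_F_mono[OF Y t]) (use True in simp)
    then have [measurable]: "(\<lambda>x. Y (snd x)) \<in> borel_measurable (borel \<Otimes>\<^sub>M F u)"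
      by (rule measurable_compose[OF measurable_snd])
    show ?thesis by measurable
  qed simp
qed auto

text \<open>By continuity \<open>Z = Y\<close> at the hitting time \<open>S\<close> of \<open>Y\<close> after \<open>t\<close>, and \<open>S = \<infinity>\<close> only if
  \<open>Y = 0\<close>. Hence \<open>P[S < L] = E[Z\<^sub>S] = E[Y]\<close>.\<close>

lemma prob_hitting_time_less_L:
  assumes t: "0 \<le> t" and A: "A \<in> sets (F t)" and Y: "Y \<in> borel_measurable (F t)"
    and Y_le: "AE \<omega> in M. 0 \<le> Y \<omega> \<and> (\<forall>s. 0 \<le> s \<longrightarrow> s \<le> t \<longrightarrow> Y \<omega> \<le> Z s \<omega>)"
  shows "prob {\<omega>\<in>space M. hitting_time t A Y \<omega> < L \<omega>} = (\<integral>\<omega>. indicator A \<omega> * Y \<omega> \<partial>M)"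
proof -
  define S where "S = hitting_time t A Y"
  have S: "ext_stopping_time F S" unfolding S_def by (rule ext_stopping_time_hitting_time[OF t A Y])
  note [measurable] = ext_stopping_time_measurable[OF S]
  have at_S: "AE \<omega> in M. (S \<omega> < \<infinity> \<longrightarrow> \<omega> \<in> A \<and> Z (enn2real (S \<omega>)) \<omega> = Y \<omega>) \<and> (S \<omega> = \<infinity> \<longrightarrow> \<omega> \<in> A \<longrightarrow> Y \<omega> = 0)"
    using Y_le AE_continuous_Z AE_inf_Z AE_space
  proof eventually_elim
    case (elim \<omega>)
    have Y_le_Z: "0 \<le> Y \<omega>" "\<And>s. 0 \<le> s \<Longrightarrow> s \<le> t \<Longrightarrow> Y \<omega> \<le> Z s \<omega>" using elim(1) by auto
    show ?case
    proof (intro conjI impI)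
      assume "S \<omega> < \<infinity>"
      then have "debut {(u, \<omega>). t < u \<and> \<omega> \<in> A \<and> Z u \<omega> \<le> Y \<omega>} \<omega> < \<infinity>" by (simp add: S_def hitting_time_def)
      from debut_finite[OF this] obtain s where "0 \<le> s \<and> S \<omega> = ennreal s \<and>
          (\<forall>e>0. \<exists>u\<ge>s. u < s + e \<and> t < u \<and> \<omega> \<in> A \<and> Z u \<omega> \<le> Y \<omega>)"
        by (auto simp: S_def hitting_time_def)
      then have s: "0 \<le> s" "S \<omega> = ennreal s" "\<And>e. 0 < e \<Longrightarrow> \<exists>u\<ge>s. u < s + e \<and> t < u \<and> \<omega> \<in> A \<and> Z u \<omega> \<le> Y \<omega>"
        by simp_all
      show "\<omega> \<in> A" using s(3)[of 1] by auto
      have before: "Y \<omega> < Z u \<omega>" if "t < u" "u < s" for u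
      proof (rule ccontr)
        assume "\<not> Y \<omega> < Z u \<omega>"
        then have "S \<omega> < ennreal s"
          unfolding S_def using that t \<open>\<omega> \<in> A\<close> by (subst hitting_time_less_iff) auto
        then show False using s(2) by simp
      qed
      have "t \<le> s"
      proof (rule ccontr)
        assume "\<not> t \<le> s"
        then show False using s(3)[of "t - s"] by auto
      qed
      have "Z s \<omega> \<le> Y \<omega>"
        by (rule right_continuous_le[OF cadlag_right_continuous[OF Z_cadlag[OF elim(4)] s(1)]]) (use s(3) in auto)
      \<comment> \<open>If \<open>s = t\<close>, the level is still a lower bound by assumption. If
        \<open>s > t\<close>, the values before \<open>s\<close> exceed the level and left
        continuity preserves the weak inequality.\<close>
      moreover have "Y \<omega> \<le> Z s \<omega>"
      proof (cases "s = t")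
        case True
        then show ?thesis using Y_le_Z(2)[of t] t by simp
      next
        case False
        then have "t < s" using \<open>t \<le> s\<close> by simp
        then have "0 < s" using t by simp
        show ?thesis
        proof (rule tendsto_lowerbound[OF continuous_on_tendsto_left[OF elim(2) \<open>0 < s\<close>]])
          show "eventually (\<lambda>u. Y \<omega> \<le> Z u \<omega>) (at_left s)"
            unfolding eventually_at_left_field using \<open>t < s\<close> before by (auto intro!: exI[of _ t] less_imp_le)
        qed simp
      qed
      ultimately show "Z (enn2real (S \<omega>)) \<omega> = Y \<omega>" using s(1,2) by simp
    next
      assume inf: "S \<omega> = \<infinity>" "\<omega> \<in> A"
      show "Y \<omega> = 0"
      proof (rule ccontr)
        assume "Y \<omega> \<noteq> 0"
        then have "0 < Y \<omega>" using Y_le_Z(1) by simp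
        then obtain u where u: "0 \<le> u" "Z u \<omega> < Y \<omega>" using elim(3) by auto
        have "t < u"
        proof (rule ccontr)
          assume "\<not> t < u"
          then show False using Y_le_Z(2)[of u] u by simp
        qed
        then have "S \<omega> < ennreal (u + 1)"
          unfolding S_def using inf(2) u t by (subst hitting_time_less_iff) (auto intro!: exI[of _ u])
        then show False using inf(1) by simp
      qed
    qed
  qed
  have AM[measurable]: "A \<in> sets M" using A t sets_F_subset by auto
  have YM[measurable]: "Y \<in> borel_measurable M" by (rule measurable_F_M[OF Y t])
  define f where "f K \<omega> = stopped Z S (real K) \<omega>" for K :: nat and \<omega>
  define h :: "nat \<Rightarrow> 'a \<Rightarrow> real" where "h K = indicator {\<omega>\<in>space M. S \<omega> \<le> ennreal (real K) \<and> S \<omega> < L \<omega>}" for K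
  define k :: "'a \<Rightarrow> real" where "k = indicator {\<omega>\<in>space M. S \<omega> < L \<omega>}"
  have h_meas: "h K \<in> borel_measurable M" and k_meas: "k \<in> borel_measurable M" for K
    unfolding h_def k_def by measurable
  have fh: "(\<integral>\<omega>. f K \<omega> \<partial>M) = (\<integral>\<omega>. h K \<omega> \<partial>M)" "f K \<in> borel_measurable M" for K
    using Z_sampling[OF S, of "real K"] by (simp_all add: f_def[abs_def] h_def)
  have eventually_le: "eventually (\<lambda>K. S \<omega> \<le> ennreal (real K)) sequentially" if fin: "S \<omega> < \<infinity>" for \<omega>
  proof -
    obtain s where s: "S \<omega> = ennreal s" using fin by (cases "S \<omega>") auto
    obtain K0 :: nat where "s \<le> real K0" using real_arch_simple by auto
    then show ?thesis unfolding eventually_sequentially s by (intro exI[of _ K0]) (auto intro!: ennreal_leI)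
  qed
  have f_lim: "AE \<omega> in M. (\<lambda>K. f K \<omega>) \<longlonglongrightarrow> indicator A \<omega> * Y \<omega>"
    using at_S
  proof eventually_elim
    case (elim \<omega>)
    show ?case
    proof (cases "S \<omega> < \<infinity>")
      case True
      then have Z_S: "Z (enn2real (S \<omega>)) \<omega> = indicator A \<omega> * Y \<omega>" using elim by simp
      from eventually_le[OF True] have "eventually (\<lambda>K. f K \<omega> = indicator A \<omega> * Y \<omega>) sequentially"
        by eventually_elim (simp add: f_def Z_S)
      then show ?thesis by (rule tendsto_eventually)
    next
      case False
      then have "S \<omega> = \<infinity>" by (simp add: less_top[symmetric])
      then have "f K \<omega> = indicator A \<omega> * Y \<omega>" for K using elim by (auto simp: f_def top_unique split: split_indicator)
      then show ?thesis by simp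
    qed
  qed
  have h_lim: "AE \<omega> in M. (\<lambda>K. h K \<omega>) \<longlonglongrightarrow> k \<omega>"
  proof (rule AE_I2)
    fix \<omega> assume "\<omega> \<in> space M"
    show "(\<lambda>K. h K \<omega>) \<longlonglongrightarrow> k \<omega>"
    proof (cases "S \<omega> < L \<omega>")
      case True
      then have "S \<omega> < \<infinity>" using less_le_trans[of "S \<omega>" "L \<omega>" \<infinity>] by simp
      from eventually_le[OF this] have "eventually (\<lambda>K. h K \<omega> = k \<omega>) sequentially"
        by eventually_elim (simp add: h_def k_def indicator_def)
      then show ?thesis by (rule tendsto_eventually)
    qed (simp add: h_def k_def)
  qed
  have w: "integrable M (\<lambda>_. 1::real)" by simp
  have f_bound: "AE \<omega> in M. norm (f K \<omega>) \<le> 1" for K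
    using AE_Z_range by eventually_elim (auto simp: f_def split: split_indicator)
  have "(\<lambda>K. \<integral>\<omega>. f K \<omega> \<partial>M) \<longlonglongrightarrow> (\<integral>\<omega>. indicator A \<omega> * Y \<omega> \<partial>M)"
    by (rule integral_dominated_convergence[OF _ fh(2) w f_lim f_bound]) measurable
  moreover have "(\<lambda>K. \<integral>\<omega>. h K \<omega> \<partial>M) \<longlonglongrightarrow> (\<integral>\<omega>. k \<omega> \<partial>M)"
    by (rule integral_dominated_convergence[OF k_meas h_meas w h_lim]) (auto simp: h_def split: split_indicator)
  ultimately have "(\<integral>\<omega>. indicator A \<omega> * Y \<omega> \<partial>M) = (\<integral>\<omega>. k \<omega> \<partial>M)"
    unfolding fh(1) by (rule LIMSEQ_unique)
  moreover have "{\<omega>\<in>space M. S \<omega> < L \<omega>} \<inter> space M = {\<omega>\<in>space M. S \<omega> < L \<omega>}" by auto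
  ultimately show ?thesis by (simp add: k_def S_def)
qed

end

locale honest_time_minimum = honest_time +
  fixes I :: "'a \<Rightarrow> real" and \<rho> :: "'a \<Rightarrow> ennreal"
  assumes I_def: "\<And>\<omega>. \<omega> \<in> space M \<Longrightarrow> I \<omega> = (INF u\<in>{u. 0 \<le> u \<and> ennreal u \<le> L \<omega>}. Z u \<omega>)"
    and \<rho>_def: "\<And>\<omega>. \<omega> \<in> space M \<Longrightarrow>
      \<rho> \<omega> = (SUP t\<in>{t. 0 \<le> t \<and> ennreal t < L \<omega> \<and> Z t \<omega> = I \<omega>}. ennreal t)"
begin

text \<open>All path properties are collected on one almost sure event, so that the later arguments
  about the place of the minimum are deterministic. The minimum is attained by compactness of
  \<open>[0, L]\<close> and continuity.\<close>

lemma AE_minimum: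
  "AE \<omega> in M. \<exists>l>0. L \<omega> = ennreal l \<and> Z 0 \<omega> = 1 \<and> Z l \<omega> = 1 \<and>
     (\<forall>u. 0 \<le> u \<longrightarrow> u \<le> l \<longrightarrow> I \<omega> \<le> Z u \<omega>) \<and> (\<exists>m. 0 \<le> m \<and> m \<le> l \<and> Z m \<omega> = I \<omega>) \<and>
     (\<forall>x. x < \<rho> \<omega> \<longleftrightarrow> (\<exists>u. 0 \<le> u \<and> u < l \<and> Z u \<omega> = I \<omega> \<and> x < ennreal u))"
  using AE_L AE_Z_0 AE_Z_L AE_continuous_Z AE_space
proof eventually_elim
  case (elim \<omega>)
  obtain l where l: "0 < l" "L \<omega> = ennreal l" using elim(1) by (cases "L \<omega>") auto
  have I: "I \<omega> = (INF u\<in>{0..l}. Z u \<omega>)"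
  proof -
    have "{u. 0 \<le> u \<and> ennreal u \<le> L \<omega>} = {0..l}" using l by auto
    then show ?thesis using I_def[OF elim(5)] by simp
  qed
  have le: "I \<omega> \<le> Z u \<omega>" if "0 \<le> u" "u \<le> l" for u
    unfolding I by (rule running_inf_le[OF Z_cadlag[OF elim(5)] that])
  have cont: "continuous_on {0..l} (\<lambda>t. Z t \<omega>)" by (rule continuous_on_subset[OF elim(4)]) auto
  obtain m where m: "m \<in> {0..l}" "\<forall>u\<in>{0..l}. Z m \<omega> \<le> Z u \<omega>"
    using continuous_attains_inf[OF _ _ cont] l by auto
  have "Z m \<omega> \<le> I \<omega>" unfolding I by (rule cINF_greatest) (use m l in auto)
  then have "Z m \<omega> = I \<omega>" using le[of m] m(1) by simp
  moreover have "x < \<rho> \<omega> \<longleftrightarrow> (\<exists>u. 0 \<le> u \<and> u < l \<and> Z u \<omega> = I \<omega> \<and> x < ennreal u)" for x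
    unfolding \<rho>_def[OF elim(5)] less_SUP_iff l(2) by (auto simp: ennreal_less_iff)
  ultimately show ?case using l le m(1) elim(2,3) by (intro exI[of _ l]) auto
qed

text \<open>\<open>Z\<close> is 1 at both ends of \<open>[0, L]\<close>, so a minimum of at most
  \<open>a < 1\<close> is attained strictly inside. Only such times are seen by a hitting time that
  starts after 0 and is compared strictly with \<open>L\<close>.\<close>

lemma AE_I_le_iff:
  assumes a: "0 \<le> a" "a < 1"
  shows "AE \<omega> in M. I \<omega> \<le> a \<longleftrightarrow> hitting_time 0 (space M) (\<lambda>_. a) \<omega> < L \<omega>"
  using AE_minimum AE_space
proof eventually_elim
  case (elim \<omega>)
  then obtain l where l: "0 < l" "L \<omega> = ennreal l" "Z 0 \<omega> = 1" "Z l \<omega> = 1"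
      "\<forall>u. 0 \<le> u \<longrightarrow> u \<le> l \<longrightarrow> I \<omega> \<le> Z u \<omega>" "\<exists>m. 0 \<le> m \<and> m \<le> l \<and> Z m \<omega> = I \<omega>" by auto
  have iff: "hitting_time 0 (space M) (\<lambda>_. a) \<omega> < L \<omega> \<longleftrightarrow> (\<exists>u. 0 < u \<and> u < l \<and> Z u \<omega> \<le> a)"
    unfolding l(2) using elim(2) by (subst hitting_time_less_iff) auto
  show ?case
  proof
    assume le: "I \<omega> \<le> a"
    obtain m where m: "0 \<le> m" "m \<le> l" "Z m \<omega> = I \<omega>" using l(6) by auto
    have "m \<noteq> 0" "m \<noteq> l" using m(3) le a l(3,4) by auto
    then show "hitting_time 0 (space M) (\<lambda>_. a) \<omega> < L \<omega>" unfolding iff using m le by (intro exI[of _ m]) auto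
  next
    assume "hitting_time 0 (space M) (\<lambda>_. a) \<omega> < L \<omega>"
    then obtain u where "0 < u" "u < l" "Z u \<omega> \<le> a" unfolding iff by auto
    then show "I \<omega> \<le> a" using l(5) by (auto intro: order_trans[of _ "Z u \<omega>"])
  qed
qed

lemma prob_hitting_level:
  assumes a: "0 \<le> a" "a < 1"
  shows "prob {\<omega>\<in>space M. hitting_time 0 (space M) (\<lambda>_. a) \<omega> < L \<omega>} = a"
proof -
  note sp = space_M_in_F[OF order_refl]
  have Y: "(\<lambda>_. a) \<in> borel_measurable (F 0)" by simp
  have le: "AE \<omega> in M. 0 \<le> a \<and> (\<forall>s. 0 \<le> s \<longrightarrow> s \<le> 0 \<longrightarrow> a \<le> Z s \<omega>)"
    using AE_Z_0
  proof eventually_elim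
    case (elim \<omega>)
    have "s = 0" if "0 \<le> s" "s \<le> 0" for s :: real using that by simp
    then show ?case using a elim by auto
  qed
  have "prob {\<omega>\<in>space M. hitting_time 0 (space M) (\<lambda>_. a) \<omega> < L \<omega>} = (\<integral>\<omega>. indicator (space M) \<omega> * a \<partial>M)"
    by (rule prob_hitting_time_less_L[OF order_refl sp Y le])
  also have "\<dots> = (\<integral>\<omega>. a \<partial>M)" by (rule Bochner_Integration.integral_cong) auto
  finally show ?thesis by (simp add: prob_space)
qed

lemma hitting_level_sets: "{\<omega>\<in>space M. hitting_time 0 (space M) (\<lambda>_. a) \<omega> < L \<omega>} \<in> sets M"
proof -
  have "ext_stopping_time F (hitting_time 0 (space M) (\<lambda>_. a))"
    by (intro ext_stopping_time_hitting_time space_M_in_F) auto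
  note [measurable] = ext_stopping_time_measurable[OF this]
  show ?thesis by measurable
qed

lemma I_range: "AE \<omega> in M. 0 \<le> I \<omega> \<and> I \<omega> \<le> 1"
  using AE_minimum AE_Z_range by eventually_elim (metis order_refl less_imp_le)

text \<open>The infimum extends up to a random time. Its level sets agree almost surely with
  measurable events formed from hitting times, and completeness makes them measurable.\<close>

lemma I_measurable: "I \<in> borel_measurable M"
proof (rule borel_measurableI_le)
  fix a :: real
  consider "a < 0" | "0 \<le> a" "a < 1" | "1 \<le> a" by linarith
  then show "{\<omega>\<in>space M. I \<omega> \<le> a} \<in> sets M"
  proof cases
    case 1
    have "AE \<omega> in M. \<omega> \<in> {} \<longleftrightarrow> \<omega> \<in> {\<omega>\<in>space M. I \<omega> \<le> a}"
      using I_range by eventually_elim (use 1 in auto)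
    then show ?thesis by (rule in_sets_AE) auto
  next
    case 2
    have "AE \<omega> in M. \<omega> \<in> {\<omega>\<in>space M. hitting_time 0 (space M) (\<lambda>_. a) \<omega> < L \<omega>} \<longleftrightarrow> \<omega> \<in> {\<omega>\<in>space M. I \<omega> \<le> a}"
      using AE_I_le_iff[OF 2] by eventually_elim auto
    then show ?thesis by (rule in_sets_AE[OF _ hitting_level_sets]) auto
  next
    case 3
    have "AE \<omega> in M. \<omega> \<in> space M \<longleftrightarrow> \<omega> \<in> {\<omega>\<in>space M. I \<omega> \<le> a}"
      using I_range AE_space by eventually_elim (use 3 in auto)
    then show ?thesis by (rule in_sets_AE) auto
  qed
qed

lemma prob_I_le: "0 \<le> a \<Longrightarrow> a < 1 \<Longrightarrow> prob {\<omega>\<in>space M. I \<omega> \<le> a} = a"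
proof -
  assume a: "0 \<le> a" "a < 1"
  have "prob {\<omega>\<in>space M. I \<omega> \<le> a} = prob {\<omega>\<in>space M. hitting_time 0 (space M) (\<lambda>_. a) \<omega> < L \<omega>}"
  proof (rule finite_measure_eq_AE)
    show "AE \<omega> in M. \<omega> \<in> {\<omega>\<in>space M. I \<omega> \<le> a} \<longleftrightarrow> \<omega> \<in> {\<omega>\<in>space M. hitting_time 0 (space M) (\<lambda>_. a) \<omega> < L \<omega>}"
      using AE_I_le_iff[OF a] by eventually_elim auto
  qed (use I_measurable hitting_level_sets in auto)
  then show ?thesis using prob_hitting_level[OF a] by simp
qed

lemma I_uniform: "distributed M lborel I (\<lambda>x. indicator {0..1} x / measure lborel {0..1::real})"
proof (rule uniform_distrI_borel_atLeastAtMost[OF I_measurable])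
  fix t :: real assume t: "0 \<le> t" "t \<le> 1"
  show "prob {\<omega>\<in>space M. I \<omega> \<le> t} = (t - 0) / (1 - 0)"
  proof (cases "t < 1")
    case True
    then show ?thesis using prob_I_le[of t] t by simp
  next
    case False
    then have "t = 1" using t by simp
    have "prob {\<omega>\<in>space M. I \<omega> \<le> t} = 1"
      by (rule prob_Collect_eq_1[THEN iffD2]) (use I_measurable I_range \<open>t = 1\<close> in auto)
    then show ?thesis using \<open>t = 1\<close> by simp
  qed
qed simp

text \<open>\<open>P[I < 1]\<close> is at least \<open>P[I \<le> a] = a\<close> for each
  \<open>a < 1\<close>. As \<open>Z\<close> is 1 at \<open>L\<close>, this is what keeps the minimum
  away from \<open>L\<close>.\<close>

lemma AE_I_less_1: "AE \<omega> in M. I \<omega> < 1"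
proof -
  note [measurable] = I_measurable
  have "a \<le> prob {\<omega>\<in>space M. I \<omega> < 1}" if "0 \<le> a" "a < 1" for a
  proof -
    have "prob {\<omega>\<in>space M. I \<omega> \<le> a} \<le> prob {\<omega>\<in>space M. I \<omega> < 1}"
      using that by (intro finite_measure_mono) auto
    then show ?thesis by (simp add: prob_I_le[OF that])
  qed
  then have "1 - 1 / real (Suc n) \<le> prob {\<omega>\<in>space M. I \<omega> < 1}" for n by simp
  moreover have "(\<lambda>n. 1 - 1 / real (Suc n)) \<longlonglongrightarrow> 1 - 0" by (intro tendsto_intros LIMSEQ_Suc[OF lim_const_over_n])
  ultimately have "1 - 0 \<le> prob {\<omega>\<in>space M. I \<omega> < 1}" by (intro LIMSEQ_le_const2[of "\<lambda>n. 1 - 1 / real (Suc n)"]) auto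
  then have "prob {\<omega>\<in>space M. I \<omega> < 1} = 1" using prob_le_1[of "{\<omega>\<in>space M. I \<omega> < 1}"] by simp
  then show ?thesis by (subst (asm) prob_Collect_eq_1) auto
qed

section \<open>The Azema supermartingale of \<open>\<rho>\<close>\<close>

abbreviation J :: "real \<Rightarrow> 'a \<Rightarrow> real" where
  "J t \<omega> \<equiv> (INF u\<in>{0..t}. Z u \<omega>)"

lemma J_measurable: "0 \<le> t \<Longrightarrow> J t \<in> borel_measurable (F t)"
  by (rule running_inf_measurable[OF Z_adapted Z_cadlag])

text \<open>Both sides say that a minimiser lies in \<open>(t, L)\<close>. If \<open>Z\<close>
  reaches \<open>J t\<close> at some \<open>u\<close> in that interval, a minimiser \<open>m\<close>
  is either after \<open>t\<close>, or \<open>m \<le> t\<close>; in the second case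
  \<open>Z u \<le> J t \<le> Z m = I\<close>, so that \<open>u\<close> is a minimiser as
  well.\<close>

lemma AE_less_\<rho>_iff:
  assumes t: "0 \<le> t"
  shows "AE \<omega> in M. \<omega> \<in> A \<longrightarrow> (ennreal t < \<rho> \<omega> \<longleftrightarrow> hitting_time t A (J t) \<omega> < L \<omega>)"
  using AE_minimum AE_I_less_1 AE_space
proof eventually_elim
  case (elim \<omega>)
  then obtain l where l: "0 < l" "L \<omega> = ennreal l" "Z l \<omega> = 1"
      "\<forall>u. 0 \<le> u \<longrightarrow> u \<le> l \<longrightarrow> I \<omega> \<le> Z u \<omega>" "\<exists>m. 0 \<le> m \<and> m \<le> l \<and> Z m \<omega> = I \<omega>"
      "\<forall>x. x < \<rho> \<omega> \<longleftrightarrow> (\<exists>u. 0 \<le> u \<and> u < l \<and> Z u \<omega> = I \<omega> \<and> x < ennreal u)" by auto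
  note J_le = running_inf_le[OF Z_cadlag[OF elim(3)]]
  have "ennreal t < \<rho> \<omega> \<longleftrightarrow> (\<exists>u. t < u \<and> u < l \<and> Z u \<omega> = I \<omega>)"
  proof -
    have "0 \<le> u \<and> u < l \<and> Z u \<omega> = I \<omega> \<and> ennreal t < ennreal u \<longleftrightarrow> t < u \<and> u < l \<and> Z u \<omega> = I \<omega>" for u
      using t by (auto simp: ennreal_less_iff)
    then show ?thesis using l(6) by simp
  qed
  also have "\<dots> \<longleftrightarrow> (\<exists>u. t < u \<and> u < l \<and> Z u \<omega> \<le> J t \<omega>)"
  proof
    assume "\<exists>u. t < u \<and> u < l \<and> Z u \<omega> = I \<omega>"
    then obtain u where u: "t < u" "u < l" "Z u \<omega> = I \<omega>" by auto
    have "I \<omega> \<le> J t \<omega>" by (rule cINF_greatest) (use t u l(4) in auto)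
    then show "\<exists>u. t < u \<and> u < l \<and> Z u \<omega> \<le> J t \<omega>" using u by auto
  next
    assume "\<exists>u. t < u \<and> u < l \<and> Z u \<omega> \<le> J t \<omega>"
    then obtain u where u: "t < u" "u < l" "Z u \<omega> \<le> J t \<omega>" by auto
    obtain m where m: "0 \<le> m" "m \<le> l" "Z m \<omega> = I \<omega>" using l(5) by auto
    have "m \<noteq> l" using m(3) l(3) elim(2) by auto
    show "\<exists>u. t < u \<and> u < l \<and> Z u \<omega> = I \<omega>"
    proof (cases "t < m")
      case True
      then show ?thesis using m \<open>m \<noteq> l\<close> by (intro exI[of _ m]) auto
    next
      case False
      then have "J t \<omega> \<le> Z m \<omega>" using m by (intro J_le) auto
      moreover have "I \<omega> \<le> Z u \<omega>" using l(4) u t by auto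
      ultimately have "Z u \<omega> = I \<omega>" using m(3) u(3) by linarith
      then show ?thesis using u by auto
    qed
  qed
  finally show ?case unfolding l(2) using t by (simp add: hitting_time_less_iff)
qed

lemma ext_stopping_time_hitting_J:
  "0 \<le> t \<Longrightarrow> A \<in> sets (F t) \<Longrightarrow> ext_stopping_time F (hitting_time t A (J t))"
  by (intro ext_stopping_time_hitting_time J_measurable)

lemma \<rho>_measurable: "\<rho> \<in> borel_measurable M"
proof (rule borel_measurableI_greater)
  fix y :: ennreal
  show "{\<omega>\<in>space M. y < \<rho> \<omega>} \<in> sets M"
  proof (cases y)
    case (real t)
    then have t: "0 \<le> t" by simp
    note sp = space_M_in_F[OF t]
    note [measurable] = ext_stopping_time_measurable[OF ext_stopping_time_hitting_J[OF t sp]]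
    show ?thesis
    proof (rule in_sets_AE)
      show "{\<omega>\<in>space M. hitting_time t (space M) (J t) \<omega> < L \<omega>} \<in> sets M" by measurable
      show "AE \<omega> in M. \<omega> \<in> {\<omega>\<in>space M. hitting_time t (space M) (J t) \<omega> < L \<omega>} \<longleftrightarrow> \<omega> \<in> {\<omega>\<in>space M. y < \<rho> \<omega>}"
        using AE_less_\<rho>_iff[OF t, of "space M"] AE_space by eventually_elim (use real in auto)
    qed auto
  qed simp
qed

lemma AE_J_range:
  assumes t: "0 \<le> t"
  shows "AE \<omega> in M. 0 \<le> J t \<omega> \<and> (\<forall>s. 0 \<le> s \<longrightarrow> s \<le> t \<longrightarrow> J t \<omega> \<le> Z s \<omega>)"
  using AE_Z_range AE_space
proof eventually_elim
  case (elim \<omega>)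
  have "0 \<le> J t \<omega>" by (rule cINF_greatest) (use elim t in auto)
  then show ?case using running_inf_le[OF Z_cadlag[OF elim(2)]] by auto
qed

text \<open>Off \<open>A\<close> the hitting time is infinite and thus not below \<open>L\<close>,
  so the event \<open>A\<close> is carried by the hitting time itself. With \<open>A\<close> ranging
  over \<open>F t\<close>, these identities characterise \<open>J t\<close> as the conditional
  probability.\<close>

lemma prob_less_\<rho>:
  assumes t: "0 \<le> t" and A: "A \<in> sets (F t)"
  shows "prob {\<omega>\<in>space M. \<omega> \<in> A \<and> ennreal t < \<rho> \<omega>} = (\<integral>\<omega>. indicator A \<omega> * J t \<omega> \<partial>M)"
proof -
  note [measurable] = ext_stopping_time_measurable[OF ext_stopping_time_hitting_J[OF t A]] \<rho>_measurable
  have [measurable]: "A \<in> sets M" using A t sets_F_subset by auto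
  have "prob {\<omega>\<in>space M. \<omega> \<in> A \<and> ennreal t < \<rho> \<omega>} = prob {\<omega>\<in>space M. hitting_time t A (J t) \<omega> < L \<omega>}"
  proof (rule finite_measure_eq_AE)
    show "AE \<omega> in M. \<omega> \<in> {\<omega>\<in>space M. \<omega> \<in> A \<and> ennreal t < \<rho> \<omega>} \<longleftrightarrow> \<omega> \<in> {\<omega>\<in>space M. hitting_time t A (J t) \<omega> < L \<omega>}"
      using AE_less_\<rho>_iff[OF t, of A] AE_L
    proof eventually_elim
      case (elim \<omega>)
      obtain l where l: "L \<omega> = ennreal l" using elim(2) by (cases "L \<omega>") auto
      have "\<omega> \<in> A" if "hitting_time t A (J t) \<omega> < L \<omega>"
        using that t unfolding l by (simp add: hitting_time_less_iff)
      then show ?case using elim(1) by auto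
    qed
  qed measurable
  also have "\<dots> = (\<integral>\<omega>. indicator A \<omega> * J t \<omega> \<partial>M)"
    by (rule prob_hitting_time_less_L[OF t A J_measurable[OF t] AE_J_range[OF t]])
  finally show ?thesis .
qed

lemma azema_\<rho>: "azema_supermartingale M F \<rho> J"
  unfolding azema_supermartingale_def
proof (intro conjI ballI allI impI)
  show "adapted F J" using J_measurable by (simp add: adapted_def)
  show "cadlag (\<lambda>t. J t \<omega>)" if "\<omega> \<in> space M" for \<omega> by (rule cadlag_running_inf[OF Z_cadlag[OF that]])
  fix t :: real assume t: "0 \<le> t"
  interpret sigma_finite_subalgebra M "F t" by (rule sigma_finite_subalgebra_F[OF t])
  note [measurable] = \<rho>_measurable
  have JM[measurable]: "J t \<in> borel_measurable M" by (rule measurable_F_M[OF J_measurable[OF t] t])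
  let ?W = "indicator {\<omega>\<in>space M. ennreal t < \<rho> \<omega>} :: 'a \<Rightarrow> real"
  have "AE \<omega> in M. real_cond_exp M (F t) ?W \<omega> = J t \<omega>"
  proof (rule real_cond_exp_charact)
    show "integrable M ?W" by (rule integrable_const_bound[where B=1]) (auto split: split_indicator)
    show "integrable M (J t)"
    proof (rule integrable_const_bound[where B=1])
      show "AE \<omega> in M. norm (J t \<omega>) \<le> 1"
        using AE_J_range[OF t] AE_Z_range
      proof eventually_elim
        case (elim \<omega>)
        then have "0 \<le> J t \<omega>" "J t \<omega> \<le> Z 0 \<omega>" "Z 0 \<omega> \<le> 1" using t by auto
        then show ?case by simp
      qed
    qed (rule JM)
    show "J t \<in> borel_measurable (F t)" by (rule J_measurable[OF t])
    fix A assume A: "A \<in> sets (F t)"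
    have [measurable]: "A \<in> sets M" using A t sets_F_subset by auto
    have "(\<integral>\<omega>\<in>A. ?W \<omega> \<partial>M) = (\<integral>\<omega>. indicator {\<omega>\<in>space M. \<omega> \<in> A \<and> ennreal t < \<rho> \<omega>} \<omega> \<partial>M)"
      unfolding set_lebesgue_integral_def
      by (rule Bochner_Integration.integral_cong[OF refl]) (auto split: split_indicator)
    also have "\<dots> = (\<integral>\<omega>. indicator A \<omega> * J t \<omega> \<partial>M)" using prob_less_\<rho>[OF t A] by simp
    also have "\<dots> = (\<integral>\<omega>\<in>A. J t \<omega> \<partial>M)" by (simp add: set_lebesgue_integral_def)
    finally show "(\<integral>\<omega>\<in>A. ?W \<omega> \<partial>M) = (\<integral>\<omega>\<in>A. J t \<omega> \<partial>M)" .
  qed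
  then show "AE \<omega> in M. J t \<omega> = real_cond_exp M (F t) ?W \<omega>" by eventually_elim simp
qed

text \<open>Positivity comes from \<open>P[\<rho> > 0] = E[J\<^sub>0] = E[Z\<^sub>0] = 1\<close>,
  finiteness from \<open>\<rho> \<le> L\<close>.\<close>

lemma AE_\<rho>: "AE \<omega> in M. 0 < \<rho> \<omega> \<and> \<rho> \<omega> < \<infinity>"
proof -
  note [measurable] = \<rho>_measurable
  note sp = space_M_in_F[OF order_refl]
  have "prob {\<omega>\<in>space M. 0 < \<rho> \<omega>} = (\<integral>\<omega>. indicator (space M) \<omega> * J 0 \<omega> \<partial>M)"
    using prob_less_\<rho>[OF order_refl sp] by (simp cong: conj_cong)
  also have "\<dots> = (\<integral>\<omega>. 1 \<partial>M)"
  proof (rule integral_cong_AE)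
    show "AE \<omega> in M. indicator (space M) \<omega> * J 0 \<omega> = 1" using AE_Z_0 AE_space by eventually_elim simp
    show "(\<lambda>\<omega>. indicator (space M) \<omega> * J 0 \<omega>) \<in> borel_measurable M"
      using measurable_F_M[OF J_measurable[of 0]] by simp
  qed simp
  finally have "prob {\<omega>\<in>space M. 0 < \<rho> \<omega>} = 1" by (simp add: prob_space)
  then have "AE \<omega> in M. 0 < \<rho> \<omega>" by (subst (asm) prob_Collect_eq_1) auto
  moreover have "AE \<omega> in M. \<rho> \<omega> \<le> L \<omega>"
    using AE_space
  proof eventually_elim
    case (elim \<omega>)
    then show ?case unfolding \<rho>_def[OF elim] by (intro SUP_least) auto
  qed
  ultimately show ?thesis using AE_L by eventually_elim (auto intro: le_less_trans)
qed

lemma pseudo_stopping_time_\<rho>: "pseudo_stopping_time M F \<rho>"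
proof (rule pseudo_stopping_time_decreasing_azema[OF continuous_martingales azema_\<rho> _ \<rho>_measurable AE_\<rho>])
  show "AE \<omega> in M. \<forall>s t. 0 \<le> s \<longrightarrow> s \<le> t \<longrightarrow> J t \<omega> \<le> J s \<omega>"
    using AE_space by eventually_elim (use running_inf_antimono[OF Z_cadlag] in blast)
qed

end

theorem proposition5:
  fixes M :: "'a measure" and F :: "real \<Rightarrow> 'a measure"
    and L \<rho> :: "'a \<Rightarrow> ennreal" and Z :: "real \<Rightarrow> 'a \<Rightarrow> real" and I :: "'a \<Rightarrow> real"
  assumes "usual_filtered_prob_space M F"
    and "\<And>X. cadlag_martingale M F X \<Longrightarrow> AE \<omega> in M. continuous_on {0..} (\<lambda>t. X t \<omega>)"
    and "end_of_predictable_set M F L"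
    and "\<And>T. ext_stopping_time F T \<Longrightarrow> {\<omega>\<in>space M. L \<omega> = T \<omega>} \<in> null_sets M"
    and "azema_supermartingale M F L Z"
    and "\<And>\<omega>. \<omega> \<in> space M \<Longrightarrow> I \<omega> = (INF u\<in>{u. 0 \<le> u \<and> ennreal u \<le> L \<omega>}. Z u \<omega>)"
    and "\<And>\<omega>. \<omega> \<in> space M \<Longrightarrow>
           \<rho> \<omega> = (SUP t\<in>{t. 0 \<le> t \<and> ennreal t < L \<omega> \<and> Z t \<omega> = I \<omega>}. ennreal t)"
  shows "distributed M lborel I (\<lambda>x. indicator {0..1} x / measure lborel {0..1::real}) \<and>
    azema_supermartingale M F \<rho> (\<lambda>t \<omega>. INF u\<in>{0..t}. Z u \<omega>) \<and>
    pseudo_stopping_time M F \<rho>"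
proof -
  obtain \<Gamma> where \<Gamma>: "\<Gamma> \<in> sets (predictable_sigma M F)" "\<And>\<omega>. \<omega> \<in> space M \<Longrightarrow> L \<omega> = end_of \<Gamma> \<omega>"
    using assms(3) unfolding end_of_predictable_set_def by auto
  interpret honest_time_minimum M F L Z \<Gamma> I \<rho>
    by (intro honest_time_minimum.intro honest_time.intro honest_time_axioms.intro
        honest_time_minimum_axioms.intro assms \<Gamma>)
  show ?thesis using I_uniform azema_\<rho> pseudo_stopping_time_\<rho> by simp
qed

end
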